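(* Let $\mathcal H$ be a separable complex Hilbert space and let $\boldsymbol T=(T_1,T_2)$ be a left-inverse commuting pair of bounded linear operators on $\mathcal H$ which is an analytic toral $2$-isometry. Then there exist a Hilbert space $\mathcal E$ and positive $\mathcal L(\mathcal E)$-valued operator measures $\mu_1,\mu_2$ on the unit circle $\mathbb T$ such that $\boldsymbol T$ is unitarily equivalent to the pair $(M_{z_1},M_{z_2})$ of multiplication operators by the coordinate functions on $\mathcal D_{\mathcal E}(\mu_1,\mu_2)$; that is, there is a unitary $U:\mathcal H\to\mathcal D_{\mathcal E}(\mu_1,\mu_2)$ with $UT_i=M_{z_i}U$ for $i=1,2$.
   Context: A pair $(T_1,T_2)$ of left invertible commuting operators is left-inverse commuting if $L_1T_2=T_2L_1$ and $L_2T_1=T_1L_2$, where $L_i=(T_i^*T_i)^{-1}T_i^*$. A commuting pair $(T_1,T_2)$ is a toral $2$-isometry if $I-T_i^*T_i-T_j^*T_j+T_j^*T_i^*T_iT_j=0$ for all $i,j\in\{1,2\}$ (including $i=j$). It is analytic if each $T_i$ is analytic, i.e. $\bigcap_{m\ge1}T_i^m\mathcal H=\{0\}$. A positive $\mathcal L(\mathcal E)$-valued operator measure $\mu$ on $\mathbb T$ is a map from Borel subsets of $\mathbb T$ to positive bounded operators on $\mathcal E$ such that $\sigma\mapsto\langle\mu(\sigma)x,y\rangle$ is a complex Borel measure for all $x,y\in\mathcal E$. Its Poisson integral is the operator-valued function $P_\mu(z)=\int_{\mathbb T}\frac{1-|z|^2}{|\zeta-z|^2}\,d\mu(\zeta)$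 (defined weakly), $z\in\mathbb D$. Let $dA$ be normalized area measure on the open unit disc $\mathbb D$ and $dt$ normalized arc-length measure on $\mathbb T$. For an $\mathcal E$-valued holomorphic function $f$ on $\mathbb D^2$ put $$D_{\mathcal E}(\mu_1,\mu_2)(f)=\lim_{r\to1^-}\int_{\mathbb D}\int_{\mathbb T}\langle P_{\mu_1}(z_1)\partial_1f(z_1,re^{it}),\partial_1f(z_1,re^{it})\rangle\,dt\,dA(z_1)+\lim_{r\to1^-}\int_{\mathbb D}\int_{\mathbb T}\langle P_{\mu_2}(z_2)\partial_2f(re^{it},z_2),\partial_2f(re^{it},z_2)\rangle\,dt\,dA(z_2).$$ $\mathcal D_{\mathcal E}(\mu_1,\mu_2)$ is the Hilbert space of all $f$ in the $\mathcal E$-valued Hardy space $H^2(\mathbb D^2)$ (holomorphic $f=\sum a_{m,n}z_1^mz_2^n$, $a_{m,n}\in\mathcal E$, with $\|f\|_{H^2}^2=\sum\|a_{m,n}\|^2<\infty$) with $D_{\mathcal E}(\mu_1,\mu_2)(f)<\infty$, with norm $\|f\|^2=\|f\|^2_{H^2(\mathbb D^2)}+D_{\mathcal E}(\mu_1,\mu_2)(f)$. On it $M_{z_1},M_{z_2}$ are bounded operators. *)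

theory Defs
  imports "HOL-Analysis.Analysis"
begin

section \<open>Complex Hilbert spaces\<close>

text \<open>
  A complex inner product space carries its underlying real inner product space structure
  (and hence the norm topology), with real inner product the real part of the complex one.
  The complex inner product is linear in the first argument.
\<close>

class complex_inner = real_inner +
  fixes scaleC :: "complex \<Rightarrow> 'a \<Rightarrow> 'a" (infixr "*\<^sub>C" 75)
    and cinner :: "'a \<Rightarrow> 'a \<Rightarrow> complex"
  assumes scaleC_add_right: "c *\<^sub>C (x + y) = c *\<^sub>C x + c *\<^sub>C y"
    and scaleC_add_left: "(c + d) *\<^sub>C x = c *\<^sub>C x + d *\<^sub>C x"
    and scaleC_scaleC: "c *\<^sub>C d *\<^sub>C x = (c * d) *\<^sub>C x"
    and scaleC_of_real: "complex_of_real r *\<^sub>C x = r *\<^sub>R x"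
    and cinner_commute: "cinner x y = cnj (cinner y x)"
    and cinner_add_left: "cinner (x + y) z = cinner x z + cinner y z"
    and cinner_scaleC_left: "cinner (c *\<^sub>C x) y = c * cinner x y"
    and Re_cinner: "Re (cinner x y) = inner x y"

class chilbert_space = complex_inner + complete_space

instantiation complex :: chilbert_space
begin

definition scaleC_complex :: "complex \<Rightarrow> complex \<Rightarrow> complex"
  where "scaleC_complex c x = c * x"

definition cinner_complex :: "complex \<Rightarrow> complex \<Rightarrow> complex"
  where "cinner_complex x y = x * cnj y"

instance
  by standard
    (simp_all add: scaleC_complex_def cinner_complex_def inner_complex_def algebra_simps
      scaleR_conv_of_real)

end

text \<open>A closed complex subspace, a Hilbert space with the inherited inner product.\<close>

definition hilbert_subspace :: "'a::chilbert_space set \<Rightarrow> bool"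
  where "hilbert_subspace E \<longleftrightarrow>
    0 \<in> E \<and> (\<forall>x\<in>E. \<forall>y\<in>E. x + y \<in> E) \<and> (\<forall>c. \<forall>x\<in>E. c *\<^sub>C x \<in> E) \<and> closed E"


section \<open>Bounded operators\<close>

definition bounded_clinear :: "('a::complex_inner \<Rightarrow> 'b::complex_inner) \<Rightarrow> bool"
  where "bounded_clinear T \<longleftrightarrow>
    (\<forall>x y. T (x + y) = T x + T y) \<and> (\<forall>c x. T (c *\<^sub>C x) = c *\<^sub>C T x) \<and>
    (\<exists>K. \<forall>x. norm (T x) \<le> K * norm x)"

text \<open>The adjoint exists and is unique for a bounded operator on a Hilbert space.\<close>

definition cadjoint :: "('a::complex_inner \<Rightarrow> 'b::complex_inner) \<Rightarrow> 'b \<Rightarrow> 'a"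
  where "cadjoint T = (THE S. \<forall>x y. cinner (T x) y = cinner x (S y))"

definition left_invertible :: "('a::complex_inner \<Rightarrow> 'a) \<Rightarrow> bool"
  where "left_invertible T \<longleftrightarrow> (\<exists>L. bounded_clinear L \<and> L \<circ> T = id)"

text \<open>For left invertible \<open>T\<close> the operator \<open>T\<^sup>*T\<close> is bijective, so that
  \<^const>\<open>inv\<close> is its inverse.\<close>

definition canonical_left_inverse :: "('a::complex_inner \<Rightarrow> 'a) \<Rightarrow> 'a \<Rightarrow> 'a"
  where "canonical_left_inverse T = inv (cadjoint T \<circ> T) \<circ> cadjoint T"

definition left_inverse_commuting ::
    "('a::complex_inner \<Rightarrow> 'a) \<Rightarrow> ('a \<Rightarrow> 'a) \<Rightarrow> bool"
  where "left_inverse_commuting T1 T2 \<longleftrightarrow>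
    left_invertible T1 \<and> left_invertible T2 \<and> T1 \<circ> T2 = T2 \<circ> T1 \<and>
    canonical_left_inverse T1 \<circ> T2 = T2 \<circ> canonical_left_inverse T1 \<and>
    canonical_left_inverse T2 \<circ> T1 = T1 \<circ> canonical_left_inverse T2"

definition toral_2_isometry :: "('a::complex_inner \<Rightarrow> 'a) \<Rightarrow> ('a \<Rightarrow> 'a) \<Rightarrow> bool"
  where "toral_2_isometry T1 T2 \<longleftrightarrow> T1 \<circ> T2 = T2 \<circ> T1 \<and>
    (\<forall>S\<in>{T1, T2}. \<forall>T\<in>{T1, T2}. \<forall>x.
      x - cadjoint S (S x) - cadjoint T (T x) + cadjoint T (cadjoint S (S (T x))) = 0)"

definition analytic_operator :: "('a::complex_inner \<Rightarrow> 'a) \<Rightarrow> bool"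
  where "analytic_operator T \<longleftrightarrow> (\<Inter>m\<in>{1..}. range (T ^^ m)) = {0}"


section \<open>Operator measures on the unit circle and their Poisson integrals\<close>

abbreviation circle_borel :: "complex measure"
  where "circle_borel \<equiv> restrict_space borel (sphere 0 1)"

definition complex_circle_measure :: "(complex set \<Rightarrow> complex) \<Rightarrow> bool"
  where "complex_circle_measure \<nu> \<longleftrightarrow> \<nu> {} = 0 \<and>
    (\<forall>A :: nat \<Rightarrow> complex set. range A \<subseteq> sets circle_borel \<longrightarrow> disjoint_family A \<longrightarrow>
      (\<lambda>n. \<nu> (A n)) sums \<nu> (\<Union>n. A n))"

text \<open>
  Integration against a complex measure, by writing it as
  \<open>\<nu> = \<nu>\<^sub>0 + i \<nu>\<^sub>1 - \<nu>\<^sub>2 - i \<nu>\<^sub>3\<close> with finite positive measures \<open>\<nu>\<^sub>k\<close>; the value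
  does not depend on the decomposition.
\<close>

definition has_circle_integral ::
    "(complex \<Rightarrow> complex) \<Rightarrow> (complex set \<Rightarrow> complex) \<Rightarrow> complex \<Rightarrow> bool"
  where "has_circle_integral f \<nu> I \<longleftrightarrow> (\<exists>M :: nat \<Rightarrow> complex measure.
    (\<forall>k<4. sets (M k) = sets circle_borel \<and> finite_measure (M k) \<and> integrable (M k) f) \<and>
    (\<forall>\<sigma>\<in>sets circle_borel. \<nu> \<sigma> = (\<Sum>k<4. \<i> ^ k * complex_of_real (measure (M k) \<sigma>))) \<and>
    I = (\<Sum>k<4. \<i> ^ k * (LINT \<zeta>|M k. f \<zeta>)))"

text \<open>Operators on a closed subspace \<open>E\<close> are total functions on the ambient space of which
  only the values on \<open>E\<close> matter.\<close>

definition positive_operator_on :: "'a::chilbert_space set \<Rightarrow> ('a \<Rightarrow> 'a) \<Rightarrow> bool"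
  where "positive_operator_on E A \<longleftrightarrow>
    (\<forall>x\<in>E. A x \<in> E) \<and> (\<forall>x\<in>E. \<forall>y\<in>E. A (x + y) = A x + A y) \<and>
    (\<forall>c. \<forall>x\<in>E. A (c *\<^sub>C x) = c *\<^sub>C A x) \<and>
    (\<exists>K. \<forall>x\<in>E. norm (A x) \<le> K * norm x) \<and>
    (\<forall>x\<in>E. cinner (A x) x \<in> \<real>\<^sub>\<ge>\<^sub>0)"

definition positive_operator_measure ::
    "'a::chilbert_space set \<Rightarrow> (complex set \<Rightarrow> 'a \<Rightarrow> 'a) \<Rightarrow> bool"
  where "positive_operator_measure E \<mu> \<longleftrightarrow>
    (\<forall>\<sigma>\<in>sets circle_borel. positive_operator_on E (\<mu> \<sigma>)) \<and>
    (\<forall>x\<in>E. \<forall>y\<in>E. complex_circle_measure (\<lambda>\<sigma>. cinner (\<mu> \<sigma> x) y))"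

definition poisson_kernel :: "complex \<Rightarrow> complex \<Rightarrow> real"
  where "poisson_kernel z \<zeta> = (1 - (norm z)\<^sup>2) / (norm (\<zeta> - z))\<^sup>2"

definition poisson_integral ::
    "'a::chilbert_space set \<Rightarrow> (complex set \<Rightarrow> 'a \<Rightarrow> 'a) \<Rightarrow> complex \<Rightarrow> 'a \<Rightarrow> 'a"
  where "poisson_integral E \<mu> z x = (THE u. u \<in> E \<and>
    (\<forall>y\<in>E. has_circle_integral (\<lambda>\<zeta>. complex_of_real (poisson_kernel z \<zeta>))
      (\<lambda>\<sigma>. cinner (\<mu> \<sigma> x) y) (cinner u y)))"


section \<open>The Hardy space of the bidisc\<close>

abbreviation bidisc :: "(complex \<times> complex) set"
  where "bidisc \<equiv> ball 0 1 \<times> ball 0 1"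

definition has_power_series ::
    "(complex \<times> complex \<Rightarrow> 'a::chilbert_space) \<Rightarrow> (nat \<times> nat \<Rightarrow> 'a) \<Rightarrow> bool"
  where "has_power_series f a \<longleftrightarrow> (\<forall>(z1, z2)\<in>bidisc.
    ((\<lambda>(m, n). (z1 ^ m * z2 ^ n) *\<^sub>C a (m, n)) has_sum f (z1, z2)) UNIV)"

text \<open>Functions on the bidisc are represented by total functions vanishing outside of it,
  so that equality of functions on the bidisc is equality.\<close>

definition hardy_space ::
    "'a::chilbert_space set \<Rightarrow> (complex \<times> complex \<Rightarrow> 'a) set"
  where "hardy_space E = {f. (\<forall>z. z \<notin> bidisc \<longrightarrow> f z = 0) \<and>
    (\<exists>a. range a \<subseteq> E \<and> has_power_series f a \<and> (\<lambda>k. (norm (a k))\<^sup>2) summable_on UNIV)}"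

definition hardy_norm_sq :: "(complex \<times> complex \<Rightarrow> 'a::chilbert_space) \<Rightarrow> real"
  where "hardy_norm_sq f = infsum (\<lambda>k. (norm ((THE a. has_power_series f a) k))\<^sup>2) UNIV"


section \<open>Dirichlet-type spaces on the bidisc\<close>

definition complex_deriv :: "(complex \<Rightarrow> 'a::chilbert_space) \<Rightarrow> complex \<Rightarrow> 'a"
  where "complex_deriv g z = (THE d. (g has_derivative (\<lambda>h. h *\<^sub>C d)) (at z))"

definition partial1 ::
    "(complex \<times> complex \<Rightarrow> 'a::chilbert_space) \<Rightarrow> complex \<times> complex \<Rightarrow> 'a"
  where "partial1 f = (\<lambda>(z1, z2). complex_deriv (\<lambda>w. f (w, z2)) z1)"

definition partial2 ::
    "(complex \<times> complex \<Rightarrow> 'a::chilbert_space) \<Rightarrow> complex \<times> complex \<Rightarrow> 'a"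
  where "partial2 f = (\<lambda>(z1, z2). complex_deriv (\<lambda>w. f (z1, w)) z2)"

definition area_measure :: "complex measure"
  where "area_measure = uniform_measure lborel (ball 0 1)"

text \<open>Normalized arc length in terms of the angle \<open>t\<close>, the point on the circle being
  \<^term>\<open>cis t\<close>.\<close>

definition angle_measure :: "real measure"
  where "angle_measure = uniform_measure lborel {0..2 * pi}"

text \<open>
  The integrands are nonnegative, so the integrals are taken in \<open>[0, \<infinity>]\<close>; they are
  nondecreasing in \<open>r\<close>, so the limits exist there.
\<close>

definition dirichlet_integral ::
    "'a::chilbert_space set \<Rightarrow> (complex set \<Rightarrow> 'a \<Rightarrow> 'a) \<Rightarrow> (complex set \<Rightarrow> 'a \<Rightarrow> 'a) \<Rightarrow>
     (complex \<times> complex \<Rightarrow> 'a) \<Rightarrow> ennreal"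
  where "dirichlet_integral E \<mu>1 \<mu>2 f =
    Lim (at_left 1) (\<lambda>r::real.
      \<integral>\<^sup>+ z1. \<integral>\<^sup>+ t. ennreal (Re (cinner
          (poisson_integral E \<mu>1 z1 (partial1 f (z1, complex_of_real r * cis t)))
          (partial1 f (z1, complex_of_real r * cis t)))) \<partial>angle_measure \<partial>area_measure) +
    Lim (at_left 1) (\<lambda>r::real.
      \<integral>\<^sup>+ z2. \<integral>\<^sup>+ t. ennreal (Re (cinner
          (poisson_integral E \<mu>2 z2 (partial2 f (complex_of_real r * cis t, z2)))
          (partial2 f (complex_of_real r * cis t, z2)))) \<partial>angle_measure \<partial>area_measure)"

definition dirichlet_space ::
    "'a::chilbert_space set \<Rightarrow> (complex set \<Rightarrow> 'a \<Rightarrow> 'a) \<Rightarrow> (complex set \<Rightarrow> 'a \<Rightarrow> 'a) \<Rightarrow>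
     (complex \<times> complex \<Rightarrow> 'a) set"
  where "dirichlet_space E \<mu>1 \<mu>2 = {f \<in> hardy_space E. dirichlet_integral E \<mu>1 \<mu>2 f < \<infinity>}"

definition dirichlet_norm ::
    "'a::chilbert_space set \<Rightarrow> (complex set \<Rightarrow> 'a \<Rightarrow> 'a) \<Rightarrow> (complex set \<Rightarrow> 'a \<Rightarrow> 'a) \<Rightarrow>
     (complex \<times> complex \<Rightarrow> 'a) \<Rightarrow> real"
  where "dirichlet_norm E \<mu>1 \<mu>2 f =
    sqrt (hardy_norm_sq f + enn2real (dirichlet_integral E \<mu>1 \<mu>2 f))"

definition mult_z1 :: "(complex \<times> complex \<Rightarrow> 'a::chilbert_space) \<Rightarrow> complex \<times> complex \<Rightarrow> 'a"
  where "mult_z1 f = (\<lambda>(z1, z2). z1 *\<^sub>C f (z1, z2))"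

definition mult_z2 :: "(complex \<times> complex \<Rightarrow> 'a::chilbert_space) \<Rightarrow> complex \<times> complex \<Rightarrow> 'a"
  where "mult_z2 f = (\<lambda>(z1, z2). z2 *\<^sub>C f (z1, z2))"

text \<open>A unitary is a surjective complex-linear isometry.\<close>

definition unitary_onto_dirichlet ::
    "'a::chilbert_space set \<Rightarrow> (complex set \<Rightarrow> 'a \<Rightarrow> 'a) \<Rightarrow> (complex set \<Rightarrow> 'a \<Rightarrow> 'a) \<Rightarrow>
     ('h::chilbert_space \<Rightarrow> complex \<times> complex \<Rightarrow> 'a) \<Rightarrow> bool"
  where "unitary_onto_dirichlet E \<mu>1 \<mu>2 U \<longleftrightarrow>
    bij_betw U UNIV (dirichlet_space E \<mu>1 \<mu>2) \<and>
    (\<forall>x y. U (x + y) = (\<lambda>z. U x z + U y z)) \<and>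
    (\<forall>c x. U (c *\<^sub>C x) = (\<lambda>z. c *\<^sub>C U x z)) \<and>
    (\<forall>x. dirichlet_norm E \<mu>1 \<mu>2 (U x) = norm x)"

end

(* For D_i = T_i* T_i - I the forms <D_i T_i^n x, x> are positive definite sequences, hence the
moments of measures on the circle, which polarize to operator measures; compressed to
E = ker L_1 \<inter> ker L_2 they are mu_1 and mu_2.  U maps x to the power series with the coefficients
P L_1^m L_2^n x, where P projects onto E.  In one variable,
||x||^2 = sum_n ||P L^n x||^2 + sum_(n >= 1) <D L^n x, L^n x>, and the last sum is the Dirichlet
integral of the power series; both are compared by means of Abel means of the Taylor polynomials.
Since (T_1, T_2) is left-inverse commuting, T_2 L_2 commutes with L_1 and D_1, and the identity can
be applied in each variable separately.  For surjectivity, Abel means of the energies of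
rectangular partial sums of f are at most the Dirichlet integral, so some of them have bounded
norm, and a bounded nested sequence of closed affine subspaces has a common point. *)

theory Submission
  imports Defs "HOL-Probability.Probability"
begin

subsection \<open>Complex inner product spaces\<close>

text \<open>The obstacle is that Taylor polynomials need not converge in norm. The polynomial of
  degree at most \<open>n\<close> misses \<open>x\<close> by
  \<open>(T ^^ Suc n) ((L ^^ Suc n) x)\<close>, whose squared norm is
  \<open>(norm ((L ^^ Suc n) x))^2 + Suc n * q ((L ^^ Suc n) x)\<close>. Analyticity makes the first
  summand tend to 0; the second is only \<open>Suc n\<close> times the term of a convergent series,
  but its Abel means tend to 0. Abel means also fit the Dirichlet integral exactly: against the
  Poisson integral, \<open>z ^ j * cnj z ^ k\<close> has over the disc of radius \<open>R\<close>
  the weight \<open>R ^ (2 * max j k + 2) / (max j k + 1)\<close>. The derivative contributes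
  \<open>Suc j * Suc k\<close>, which leaves \<open>min (Suc j) (Suc k)\<close>, the weight in the
  energy of a polynomial. So the integral over that disc is the Abel mean at \<open>R^2\<close> of
  the energies of the Taylor polynomials. In two variables no joint estimate arises: the mixed toral
  identity makes the form of \<open>D1\<close> invariant under \<open>T2\<close>, and as
  \<open>D1\<close> also commutes with \<open>T2 L2\<close>, its energy splits orthogonally along
  the Taylor coefficients in the second variable. The same holds with the roles exchanged.\<close>

instance chilbert_space \<subseteq> banach ..

lemma scaleC_zero_right [simp]: "c *\<^sub>C (0::'a::complex_inner) = 0"
  using scaleC_add_right[of c "0::'a" 0] by simp

lemma scaleC_zero_left [simp]: "0 *\<^sub>C (x::'a::complex_inner) = 0"
  using scaleC_of_real[of 0 x] by simp

lemma scaleC_one [simp]: "1 *\<^sub>C (x::'a::complex_inner) = x"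
  using scaleC_of_real[of 1 x] by simp

lemma scaleC_minus_left: "(- c) *\<^sub>C (x::'a::complex_inner) = - (c *\<^sub>C x)"
  using scaleC_add_left[of "-c" c x] by (simp add: eq_neg_iff_add_eq_0)

lemma scaleC_minus_right: "c *\<^sub>C (- x::'a::complex_inner) = - (c *\<^sub>C x)"
  using scaleC_add_right[of c "-x" x] by (simp add: eq_neg_iff_add_eq_0)

lemma scaleC_diff_right: "c *\<^sub>C (x - y::'a::complex_inner) = c *\<^sub>C x - c *\<^sub>C y"
  using scaleC_add_right[of c x "-y"] by (simp add: scaleC_minus_right)

lemma cinner_add_right: "cinner x (y + z) = cinner x y + cinner x z"
  by (metis cinner_add_left cinner_commute complex_cnj_add)

lemma cinner_scaleC_right: "cinner x (c *\<^sub>C y) = cnj c * cinner x y"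
  by (metis cinner_scaleC_left cinner_commute complex_cnj_mult)

lemma cinner_zero_left [simp]: "cinner 0 x = 0"
  using cinner_add_left[of 0 0 x] by simp

lemma cinner_zero_right [simp]: "cinner x 0 = 0"
  using cinner_add_right[of x 0 0] by simp

lemma cinner_minus_left: "cinner (- x) y = - cinner x y"
  using cinner_add_left[of "-x" x y] by (simp add: eq_neg_iff_add_eq_0)

lemma cinner_minus_right: "cinner x (- y) = - cinner x y"
  using cinner_add_right[of x "-y" y] by (simp add: eq_neg_iff_add_eq_0)

lemma cinner_diff_left: "cinner (x - y) z = cinner x z - cinner y z"
  using cinner_add_left[of x "-y" z] by (simp add: cinner_minus_left)

lemma cinner_diff_right: "cinner x (y - z) = cinner x y - cinner x z"
  using cinner_add_right[of x y "-z"] by (simp add: cinner_minus_right)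

lemma cinner_sum_left: "cinner (\<Sum>i\<in>I. f i) y = (\<Sum>i\<in>I. cinner (f i) y)"
  by (induction I rule: infinite_finite_induct) (simp_all add: cinner_add_left)

lemma cinner_sum_right: "cinner x (\<Sum>i\<in>I. f i) = (\<Sum>i\<in>I. cinner x (f i))"
  by (induction I rule: infinite_finite_induct) (simp_all add: cinner_add_right)

lemma scaleC_sum_right: "c *\<^sub>C (\<Sum>i\<in>I. f i) = (\<Sum>i\<in>I. c *\<^sub>C (f i :: 'a::complex_inner))"
  by (induction I rule: infinite_finite_induct) (simp_all add: scaleC_add_right)

lemma cinner_self: "cinner x x = complex_of_real ((norm x)\<^sup>2)"
proof -
  have "Im (cinner x x) = 0"
    using arg_cong[OF cinner_commute[of x x], of Im] by simp
  then show ?thesis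
    by (simp add: complex_eq_iff Re_cinner power2_norm_eq_inner)
qed

lemma norm_scaleC [simp]: "norm (c *\<^sub>C (x::'a::complex_inner)) = cmod c * norm x"
proof -
  have c: "cnj c * c = (complex_of_real (cmod c))\<^sup>2"
    by (metis complex_norm_square mult.commute of_real_power)
  have "complex_of_real ((norm (c *\<^sub>C x))\<^sup>2) = complex_of_real ((cmod c * norm x)\<^sup>2)"
    unfolding cinner_self[symmetric] power_mult_distrib
    by (simp add: cinner_scaleC_left cinner_scaleC_right cinner_self[of x] mult.assoc[symmetric]
        c of_real_power of_real_mult)
  then have "(norm (c *\<^sub>C x))\<^sup>2 = (cmod c * norm x)\<^sup>2"
    using of_real_eq_iff by blast
  then show ?thesis by (simp add: power2_eq_iff_nonneg)
qed

text \<open>Bounds on a modulus reduce to bounds on a real part by rotating one argument of a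
  sesquilinear form.\<close>

lemma unimodular_rotation: "\<exists>u. cmod u = 1 \<and> u * z = complex_of_real (cmod z)"
proof (cases "z = 0")
  case False
  then show ?thesis
    by (intro exI[of _ "cnj z / cmod z"])
      (simp add: norm_divide complex_norm_square[symmetric] power2_eq_square field_simps)
qed (auto intro: exI[of _ 1])

text \<open>Rotating \<open>x\<close> makes the complex inner product real and nonnegative, and then
  the Cauchy-Schwarz inequality of the real inner product applies.\<close>

lemma cmod_cinner_le: "cmod (cinner x y) \<le> norm x * norm y"
proof -
  obtain u where u: "cmod u = 1" "u * cinner x y = cmod (cinner x y)"
    using unimodular_rotation by blast
  have "cmod (cinner x y) = Re (cinner (u *\<^sub>C x) y)"
    by (simp add: cinner_scaleC_left u)
  also have "\<dots> \<le> norm (u *\<^sub>C x) * norm y"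
    by (simp add: Re_cinner norm_cauchy_schwarz del: norm_scaleC)
  finally show ?thesis using u by simp
qed

lemma cinner_eqI: "(\<And>y. cinner x y = cinner z y) \<Longrightarrow> x = z"
proof -
  assume "\<And>y. cinner x y = cinner z y"
  then have "cinner (x - z) (x - z) = 0" by (simp add: cinner_diff_left)
  then show "x = z" by (simp add: cinner_self)
qed

lemma bounded_bilinear_scaleC: "bounded_bilinear ((*\<^sub>C) :: complex \<Rightarrow> 'a::complex_inner \<Rightarrow> 'a)"
proof
  show "\<exists>K. \<forall>a b. norm (a *\<^sub>C (b::'a)) \<le> norm a * norm b * K"
    by (rule exI[of _ 1]) simp
  show "(r *\<^sub>R a) *\<^sub>C b = r *\<^sub>R a *\<^sub>C b" for r a and b::'a
    by (simp add: scaleR_conv_of_real scaleC_scaleC[symmetric] scaleC_of_real[symmetric])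
  show "a *\<^sub>C r *\<^sub>R b = r *\<^sub>R a *\<^sub>C b" for r a and b::'a
    by (simp add: scaleC_of_real[symmetric] scaleC_scaleC mult.commute)
qed (simp_all add: scaleC_add_left scaleC_add_right)

lemma bounded_bilinear_cinner: "bounded_bilinear (cinner :: 'a::complex_inner \<Rightarrow> 'a \<Rightarrow> complex)"
proof
  show "\<exists>K. \<forall>a b::'a. norm (cinner a b) \<le> norm a * norm b * K"
    by (rule exI[of _ 1]) (simp add: cmod_cinner_le)
  show "cinner (r *\<^sub>R a) b = r *\<^sub>R cinner a b" for r and a b::'a
    by (simp add: scaleC_of_real[symmetric, of r a] cinner_scaleC_left scaleR_conv_of_real)
  show "cinner a (r *\<^sub>R b) = r *\<^sub>R cinner a b" for r and a b::'a
    by (simp add: scaleC_of_real[symmetric, of r b] cinner_scaleC_right scaleR_conv_of_real)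
qed (simp_all add: cinner_add_left cinner_add_right)

lemmas tendsto_cinner = bounded_bilinear.tendsto[OF bounded_bilinear_cinner]

lemma bounded_linear_cinner_left: "bounded_linear (\<lambda>x. cinner x y)"
  by (rule bounded_bilinear.bounded_linear_left[OF bounded_bilinear_cinner])

lemma bounded_linear_scaleC_right: "bounded_linear (\<lambda>x::'a::complex_inner. c *\<^sub>C x)"
  by (rule bounded_bilinear.bounded_linear_right[OF bounded_bilinear_scaleC])

lemma bounded_linear_scaleC_left: "bounded_linear (\<lambda>c. c *\<^sub>C (x::'a::complex_inner))"
  by (rule bounded_bilinear.bounded_linear_left[OF bounded_bilinear_scaleC])

lemma norm_add_sq: "(norm (x + y :: 'a::complex_inner))\<^sup>2 = (norm x)\<^sup>2 + (norm y)\<^sup>2 + 2 * Re (cinner x y)"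
  by (simp add: Re_cinner power2_norm_eq_inner inner_add_left inner_add_right inner_commute)

section \<open>Bounded operators and polarization\<close>

lemma bounded_clinearI:
  assumes "\<And>x y. T (x + y) = T x + T y" "\<And>c x. T (c *\<^sub>C x) = c *\<^sub>C T x"
    "\<And>x. norm (T x) \<le> K * norm x"
  shows "bounded_clinear T"
  using assms unfolding bounded_clinear_def by blast

locale bounded_op =
  fixes A :: "'a::complex_inner \<Rightarrow> 'b::complex_inner"
  assumes bounded_clinear: "bounded_clinear A"
begin

lemma add: "A (x + y) = A x + A y"
  and scaleC: "A (c *\<^sub>C x) = c *\<^sub>C A x"
  using bounded_clinear by (simp_all add: bounded_clinear_def)

lemma bounded_linear: "bounded_linear A"
proof -
  obtain K where "\<And>x. norm (A x) \<le> K * norm x"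
    using bounded_clinear by (auto simp: bounded_clinear_def)
  then show ?thesis
    by (intro bounded_linear_intro[where K=K])
      (simp_all add: add scaleC scaleC_of_real[symmetric] mult.commute)
qed

lemma linear: "linear A"
  using bounded_linear by (simp add: bounded_linear.linear)

lemmas zero = linear_0[OF linear]
lemmas diff = linear_diff[OF linear]
lemmas sum = linear_sum[OF linear]
lemmas tendsto = bounded_linear.tendsto[OF bounded_linear]

lemma continuous_on: "continuous_on S A"
  by (rule linear_continuous_on[OF bounded_linear])

lemma bound: obtains K where "K > 0" "\<And>x. norm (A x) \<le> K * norm x"
  using bounded_linear.pos_bounded[OF bounded_linear] by (auto simp: mult.commute)

end

lemma bounded_clinear_compose:
  assumes "bounded_clinear S" "bounded_clinear T" shows "bounded_clinear (\<lambda>x. S (T x))"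
proof -
  interpret S: bounded_op S by unfold_locales fact
  interpret T: bounded_op T by unfold_locales fact
  obtain K where K: "\<And>x. norm (S (T x)) \<le> norm x * K"
    using bounded_linear.bounded[OF bounded_linear_compose[OF S.bounded_linear T.bounded_linear]] by auto
  show ?thesis
    by (rule bounded_clinearI[where K=K]) (use K in \<open>simp_all add: S.add T.add S.scaleC T.scaleC mult.commute\<close>)
qed

lemma bounded_clinear_id: "bounded_clinear (\<lambda>x. x)"
  by (rule bounded_clinearI[where K=1]) simp_all

lemma bounded_clinear_funpow:
  fixes T :: "'a::complex_inner \<Rightarrow> 'a"
  shows "bounded_clinear T \<Longrightarrow> bounded_clinear (T ^^ n)"
proof (induction n)
  case 0
  show ?case using bounded_clinear_id by (simp add: id_def)
next
  case (Suc n)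
  then show ?case using bounded_clinear_compose[of T "T ^^ n"] by (simp add: comp_def)
qed

lemma bounded_clinear_add:
  assumes "bounded_clinear S" "bounded_clinear T" shows "bounded_clinear (\<lambda>x. S x + T x)"
proof -
  interpret S: bounded_op S by unfold_locales fact
  interpret T: bounded_op T by unfold_locales fact
  obtain K where K: "\<And>x. norm (S x + T x) \<le> norm x * K"
    using bounded_linear.bounded[OF bounded_linear_add[OF S.bounded_linear T.bounded_linear]] by auto
  show ?thesis
    by (rule bounded_clinearI[where K=K])
      (use K in \<open>simp_all add: S.add T.add S.scaleC T.scaleC mult.commute scaleC_add_right\<close>)
qed

lemma bounded_clinear_scaleC:
  assumes "bounded_clinear S" shows "bounded_clinear (\<lambda>x. c *\<^sub>C S x)"
proof -
  interpret S: bounded_op S by unfold_locales fact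
  obtain K where K: "K > 0" "\<And>x. norm (S x) \<le> K * norm x" using S.bound by blast
  show ?thesis
    by (rule bounded_clinearI[where K="cmod c * K"])
      (use K in \<open>simp_all add: S.add S.scaleC scaleC_add_right scaleC_scaleC mult.assoc mult.commute[of c] mult_left_mono\<close>)
qed

lemma bounded_clinear_diff:
  assumes "bounded_clinear S" "bounded_clinear T" shows "bounded_clinear (\<lambda>x. S x - T x)"
  using bounded_clinear_add[OF assms(1) bounded_clinear_scaleC[OF assms(2), of "-1"]]
  by (simp add: scaleC_minus_left)

lemma bounded_clinear_zero: "bounded_clinear (\<lambda>x. 0)"
  by (rule bounded_clinearI[where K=0]) simp_all

lemma bounded_clinear_sum:
  "(\<And>i. i \<in> I \<Longrightarrow> bounded_clinear (f i)) \<Longrightarrow> bounded_clinear (\<lambda>x. \<Sum>i\<in>I. f i x)"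
  by (induction I rule: infinite_finite_induct) (simp_all add: bounded_clinear_zero bounded_clinear_add)

text \<open>With a fourth root of unity \<open>u\<close> for \<open>\<i> ^ k\<close>, the four terms
  of the expansion carry the factors \<open>u\<close>, 1, \<open>u^2\<close> and \<open>u\<close>.
  Summing over the four roots kills all but the second.\<close>

lemma cinner_polarization:
  assumes "bounded_clinear A"
  shows "cinner (A x) y = (\<Sum>k<4. \<i> ^ k / 4 * cinner (A (x + \<i> ^ k *\<^sub>C y)) (x + \<i> ^ k *\<^sub>C y))"
proof -
  interpret A: bounded_op A by unfold_locales fact
  have *: "u * cinner (A (x + u *\<^sub>C y)) (x + u *\<^sub>C y) =
    u * cinner (A x) x + (u * cnj u) * cinner (A x) y + u^2 * cinner (A y) x + (u * cnj u) * u * cinner (A y) y" for u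
    by (simp add: A.add A.scaleC cinner_add_left cinner_add_right cinner_scaleC_left cinner_scaleC_right
        algebra_simps power2_eq_square)
  have "(\<Sum>k<4. \<i> ^ k / 4 * cinner (A (x + \<i> ^ k *\<^sub>C y)) (x + \<i> ^ k *\<^sub>C y)) =
    (\<Sum>u\<leftarrow>[1, \<i>, -1, -\<i>]. u * cinner (A (x + u *\<^sub>C y)) (x + u *\<^sub>C y)) / 4"
    by (simp add: eval_nat_numeral lessThan_Suc)
  also have "\<dots> = cinner (A x) y"
    unfolding * by simp
  finally show ?thesis by simp
qed

subsection \<open>Hilbert spaces\<close>

text \<open>This replaces weak compactness: the elements of almost minimal norm in the sets form a
  Cauchy sequence by the parallelogram law.\<close>

lemma nested_convex_inter:
  fixes C :: "nat \<Rightarrow> 'a::chilbert_space set"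
  assumes closed: "\<And>n. closed (C n)" and convex: "\<And>n. convex (C n)" and dec: "decseq C"
    and bdd: "\<And>n. \<exists>x\<in>C n. norm x \<le> B"
  shows "\<exists>x. \<forall>n. x \<in> C n"
proof -
  define d where "d n = Inf (norm ` C n)" for n
  have bb: "bdd_below (norm ` C n)" for n by (rule bdd_belowI[of _ 0]) auto
  have ne: "C n \<noteq> {}" for n using bdd by blast
  have d_le: "d n \<le> norm x" if "x \<in> C n" for n x
    unfolding d_def using bb that by (simp add: cInf_lower)
  have d_nn: "0 \<le> d n" for n unfolding d_def by (rule cInf_greatest) (use ne in auto)
  have dB: "d n \<le> B" for n using bdd d_le by (meson order_trans)
  have inc: "incseq d"
    unfolding incseq_def d_def
    by (intro allI impI cInf_superset_mono bb image_mono) (use ne dec in \<open>auto simp: decseq_def\<close>)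
  obtain l where l: "d \<longlonglongrightarrow> l" using incseq_convergent[OF inc, of B] dB by blast
  have "\<exists>x\<in>C n. norm x < d n + inverse (real (Suc n))" for n
  proof -
    have "d n < d n + inverse (real (Suc n))" by simp
    then show ?thesis unfolding d_def using cInf_lessD[of "norm ` C n"] ne by fastforce
  qed
  then obtain x where x: "\<And>n. x n \<in> C n" "\<And>n. norm (x n) < d n + inverse (real (Suc n))" by metis
  have up: "(\<lambda>n. d n + inverse (real (Suc n))) \<longlonglongrightarrow> l"
    using tendsto_add[OF l LIMSEQ_inverse_real_of_nat] by simp
  have xl: "(\<lambda>n. norm (x n)) \<longlonglongrightarrow> l"
    by (rule tendsto_sandwich[OF _ _ l up]) (use x d_le in \<open>auto intro!: always_eventually less_imp_le\<close>)
  have key: "(norm (x m - x n))\<^sup>2 \<le> 2 * (norm (x m))\<^sup>2 + 2 * (norm (x n))\<^sup>2 - 4 * (d n)\<^sup>2" if "n \<le> m" for m n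
  proof -
    have "x m \<in> C n" using x(1)[of m] dec that by (auto simp: decseq_def)
    then have "(1/2) *\<^sub>R x m + (1/2) *\<^sub>R x n \<in> C n"
      using convex[of n] x(1)[of n] by (auto simp: convex_def)
    from d_le[OF this] have "d n \<le> norm ((1/2) *\<^sub>R (x m + x n))" by (simp add: scaleR_add_right)
    then have "2 * d n \<le> norm (x m + x n)" by simp
    then have "(2 * d n)\<^sup>2 \<le> (norm (x m + x n))\<^sup>2" using d_nn[of n] by (intro power_mono) auto
    moreover have "(norm (x m - x n))\<^sup>2 + (norm (x m + x n))\<^sup>2 = 2 * (norm (x m))\<^sup>2 + 2 * (norm (x n))\<^sup>2"
      by (simp add: power2_norm_eq_inner inner_diff_left inner_diff_right inner_add_left inner_add_right inner_commute)
    ultimately show ?thesis by (simp add: power_mult_distrib)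
  qed
  have "Cauchy x"
  proof (rule metric_CauchyI)
    fix e :: real assume "e > 0"
    define \<delta> where "\<delta> = e\<^sup>2 / 8"
    have "\<delta> > 0" using \<open>e > 0\<close> by (simp add: \<delta>_def)
    have "(\<lambda>n. (norm (x n))\<^sup>2) \<longlonglongrightarrow> l\<^sup>2" "(\<lambda>n. (d n)\<^sup>2) \<longlonglongrightarrow> l\<^sup>2"
      by (intro tendsto_power xl l)+
    from order_tendstoD(2)[OF this(1), of "l\<^sup>2 + \<delta>"] order_tendstoD(1)[OF this(2), of "l\<^sup>2 - \<delta>"]
    have "\<forall>\<^sub>F n in sequentially. (norm (x n))\<^sup>2 < l\<^sup>2 + \<delta> \<and> (d n)\<^sup>2 > l\<^sup>2 - \<delta>"
      using \<open>\<delta> > 0\<close> by (auto simp: eventually_conj_iff)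
    then obtain N where N: "\<And>n. n \<ge> N \<Longrightarrow> (norm (x n))\<^sup>2 < l\<^sup>2 + \<delta> \<and> (d n)\<^sup>2 > l\<^sup>2 - \<delta>"
      by (auto simp: eventually_sequentially)
    have *: "norm (x m - x n) < e" if "N \<le> n" "n \<le> m" for m n
    proof -
      have "(norm (x m - x n))\<^sup>2 < e\<^sup>2"
        using key[OF that(2)] N[OF that(1)] N[of m] that by (simp add: \<delta>_def)
      then show ?thesis using \<open>e > 0\<close> by (simp add: power2_less_imp_less)
    qed
    show "\<exists>M. \<forall>m\<ge>M. \<forall>n\<ge>M. dist (x m) (x n) < e"
      using * by (intro exI[of _ N]) (metis dist_norm norm_minus_commute nle_le)
  qed
  then obtain y where y: "x \<longlonglongrightarrow> y" using Cauchy_convergent_iff convergent_def by blast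
  have "y \<in> C n" for n
  proof (rule closed_sequentially[OF closed])
    show "x (k + n) \<in> C n" for k using x(1)[of "k + n"] decseqD[OF dec, of n "k + n"] by auto
    show "(\<lambda>k. x (k + n)) \<longlonglongrightarrow> y" using y by (rule LIMSEQ_ignore_initial_segment)
  qed
  then show ?thesis by blast
qed

lemma cinner_eq_0_if_min:
  assumes "\<And>c. norm v \<le> norm (v + c *\<^sub>C h)"
  shows "cinner v h = 0"
proof (rule ccontr)
  assume a: "cinner v h \<noteq> 0"
  \<comment> \<open>The perturbation \<open>c *\<^sub>C h\<close> below changes the squared norm by
    \<open>t * (t * (norm h)^2 - 2)\<close> times the squared modulus of \<open>cinner v h\<close>.
    Any positive \<open>t\<close> with \<open>t * (norm h)^2 < 2\<close> makes this negative; the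
    summand 1 covers \<open>h = 0\<close>.\<close>
  define t where "t = 1 / ((norm h)\<^sup>2 + 1)"
  have pos: "(norm h)\<^sup>2 + 1 > 0" by (simp add: add_nonneg_pos)
  have t: "t > 0" "t * (norm h)\<^sup>2 < 1" using pos by (simp_all add: t_def field_simps)
  define c where "c = - complex_of_real t * cinner v h"
  have "cinner v (c *\<^sub>C h) = - complex_of_real (t * (cmod (cinner v h))\<^sup>2)"
    by (simp add: c_def cinner_scaleC_right mult.commute[of "cnj (cinner v h)"] complex_norm_square[symmetric])
  then have Re: "Re (cinner v (c *\<^sub>C h)) = - (t * (cmod (cinner v h))\<^sup>2)"
    by simp
  have "(norm v)\<^sup>2 \<le> (norm (v + c *\<^sub>C h))\<^sup>2" by (intro power_mono assms) simp
  also have "\<dots> = (norm v)\<^sup>2 + t * (t * (norm h)\<^sup>2) * (cmod (cinner v h))\<^sup>2 - 2 * t * (cmod (cinner v h))\<^sup>2"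
    unfolding norm_add_sq Re
    using t by (simp add: c_def norm_mult power_mult_distrib power2_eq_square)
  also have "\<dots> = (norm v)\<^sup>2 + t * (t * (norm h)\<^sup>2 - 2) * (cmod (cinner v h))\<^sup>2" by (simp add: algebra_simps)
  also have "\<dots> < (norm v)\<^sup>2" using a t by (simp add: mult_less_0_iff zero_less_mult_iff)
  finally show False by simp
qed

text \<open>A vector \<open>v\<close> of minimal norm on the hyperplane \<open>f y = 1\<close> is
  orthogonal to the kernel of \<open>f\<close>, so \<open>f\<close> is the inner product with
  \<open>v\<close> divided by its squared norm. The minimum is attained by
  \<open>nested_convex_inter\<close>, applied to the hyperplane cut with balls whose radii decrease
  to its distance from 0.\<close>

lemma riesz_representation:
  fixes f :: "'a::chilbert_space \<Rightarrow> complex"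
  assumes "bounded_clinear f"
  shows "\<exists>u. \<forall>y. f y = cinner y u"
proof (cases "\<forall>y. f y = 0")
  case False
  interpret f: bounded_op f by unfold_locales fact
  from False obtain y0 where y0: "f y0 \<noteq> 0" by auto
  define S where "S = {y. f y = 1}"
  have fS: "closed S" unfolding S_def by (intro closed_Collect_eq f.continuous_on continuous_on_const)
  have cS: "convex S"
    unfolding S_def convex_def
    by (auto simp: f.add linear_scale[OF f.linear] scaleR_conv_of_real of_real_add[symmetric] simp del: of_real_add)
  have "f ((1 / f y0) *\<^sub>C y0) = 1" using y0 by (simp add: f.scaleC scaleC_complex_def)
  then have neS: "S \<noteq> {}" by (auto simp: S_def)
  define d where "d = Inf (norm ` S)"
  have bb: "bdd_below (norm ` S)" by (rule bdd_belowI[of _ 0]) auto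
  define C where "C n = S \<inter> cball 0 (d + inverse (real (Suc n)))" for n
  have "\<exists>x. \<forall>n. x \<in> C n"
  proof (rule nested_convex_inter)
    show "closed (C n)" "convex (C n)" for n unfolding C_def using fS cS by (auto intro: convex_Int)
    show "decseq C"
      unfolding decseq_def C_def
      by (intro allI impI Int_mono subset_refl) (simp add: subset_cball le_imp_inverse_le)
    show "\<exists>x\<in>C n. norm x \<le> d + 1" for n
    proof -
      have "d < d + inverse (real (Suc n))" by simp
      then obtain x where "x \<in> S" "norm x < d + inverse (real (Suc n))"
        unfolding d_def using cInf_lessD[of "norm ` S"] neS by fastforce
      moreover have "inverse (real (Suc n)) \<le> 1" by (simp add: inverse_le_1_iff)
      ultimately show ?thesis by (intro bexI[of _ x]) (auto simp: C_def)
    qed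
  qed
  then obtain v where v: "\<And>n. v \<in> C n" by blast
  have fv: "f v = 1" using v[of 0] by (simp add: C_def S_def)
  have "norm v \<le> d"
  proof (rule LIMSEQ_le_const)
    show "(\<lambda>n. d + inverse (real (Suc n))) \<longlonglongrightarrow> d"
      using tendsto_add[OF tendsto_const LIMSEQ_inverse_real_of_nat, of d] by simp
    show "\<exists>N. \<forall>n\<ge>N. norm v \<le> d + inverse (real (Suc n))" using v by (auto simp: C_def)
  qed
  then have min: "norm v \<le> norm y" if "f y = 1" for y
    using bb that by (auto simp: d_def S_def intro: order_trans cInf_lower)
  have orth: "cinner h v = 0" if "f h = 0" for h
  proof -
    have "cinner v h = 0"
      by (rule cinner_eq_0_if_min, rule min) (simp add: f.add f.scaleC fv that scaleC_complex_def)
    then show ?thesis using cinner_commute[of h v] by simp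
  qed
  have "v \<noteq> 0" using fv f.zero by auto
  have "f y = cinner y (complex_of_real (1 / (norm v)\<^sup>2) *\<^sub>C v)" for y
  proof -
    have "cinner (y - f y *\<^sub>C v) v = 0"
      by (rule orth) (simp add: f.diff f.scaleC fv scaleC_complex_def)
    then show ?thesis
      using \<open>v \<noteq> 0\<close> by (simp add: cinner_diff_left cinner_scaleC_left cinner_scaleC_right cinner_self)
  qed
  then show ?thesis by blast
qed (auto intro: exI[of _ 0])

section \<open>Adjoints, and operators from limits of quadratic forms\<close>

lemma cadjoint_unique_ex:
  fixes T :: "'a::chilbert_space \<Rightarrow> 'b::complex_inner"
  assumes "bounded_clinear T"
  shows "\<exists>!S. \<forall>x y. cinner (T x) y = cinner x (S y)"
proof -
  interpret T: bounded_op T by unfold_locales fact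
  obtain K where K: "\<And>x. norm (T x) \<le> K * norm x" using T.bound by blast
  have "\<exists>u. \<forall>x. cinner (T x) y = cinner x u" for y
  proof (rule riesz_representation, rule bounded_clinearI)
    show "norm (cinner (T x) y) \<le> (K * norm y) * norm x" for x
      using order_trans[OF cmod_cinner_le mult_right_mono[OF K norm_ge_zero]]
      by (simp add: mult.assoc mult.left_commute mult.commute)
  qed (simp_all add: T.add T.scaleC cinner_add_left cinner_scaleC_left scaleC_complex_def)
  then obtain S where S: "\<And>x y. cinner (T x) y = cinner x (S y)" by metis
  show ?thesis
  proof (rule ex1I[of _ S])
    show "S' = S" if "\<forall>x y. cinner (T x) y = cinner x (S' y)" for S'
    proof (rule ext, rule cinner_eqI)
      show "cinner (S' y) x = cinner (S y) x" for x y
        using that S by (metis cinner_commute)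
    qed
  qed (simp add: S)
qed

lemma cinner_cadjoint:
  fixes T :: "'a::chilbert_space \<Rightarrow> 'b::complex_inner"
  assumes "bounded_clinear T"
  shows "cinner (T x) y = cinner x (cadjoint T y)"
  using theI'[OF cadjoint_unique_ex[OF assms]] unfolding cadjoint_def by blast

lemma cinner_cadjoint_left:
  fixes T :: "'a::chilbert_space \<Rightarrow> 'b::complex_inner"
  assumes "bounded_clinear T"
  shows "cinner (cadjoint T y) x = cinner y (T x)"
  by (metis cinner_cadjoint[OF assms] cinner_commute)

lemma bounded_clinear_cadjoint:
  fixes T :: "'a::chilbert_space \<Rightarrow> 'b::complex_inner"
  assumes "bounded_clinear T"
  shows "bounded_clinear (cadjoint T)"
proof -
  interpret T: bounded_op T by unfold_locales fact
  obtain K where K: "K > 0" "\<And>x. norm (T x) \<le> K * norm x" using T.bound by blast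
  note adj = cinner_cadjoint_left[OF assms]
  show ?thesis
  proof (rule bounded_clinearI)
    show "cadjoint T (x + y) = cadjoint T x + cadjoint T y" for x y
      by (rule cinner_eqI) (simp add: adj cinner_add_left)
    show "cadjoint T (c *\<^sub>C x) = c *\<^sub>C cadjoint T x" for c x
      by (rule cinner_eqI) (simp add: adj cinner_scaleC_left)
    show "norm (cadjoint T y) \<le> K * norm y" for y
    proof (cases "cadjoint T y = 0")
      case False
      have "(norm (cadjoint T y))\<^sup>2 = cmod (cinner (cadjoint T y) (cadjoint T y))"
        by (simp add: cinner_self norm_power)
      also have "\<dots> \<le> norm y * norm (T (cadjoint T y))" unfolding adj by (rule cmod_cinner_le)
      also have "\<dots> \<le> norm y * (K * norm (cadjoint T y))" by (intro mult_left_mono K) simp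
      finally have "norm (cadjoint T y) * norm (cadjoint T y) \<le> (K * norm y) * norm (cadjoint T y)"
        by (simp add: power2_eq_square mult_ac)
      then show ?thesis using False by simp
    qed (use K(1) in simp)
  qed
qed

text \<open>Polarization turns convergence of the quadratic forms into convergence of the
  sesquilinear forms. The limit is again sesquilinear, the bound on \<open>q\<close> makes it
  bounded, and the Riesz representation gives its operator. This is how integrals against the
  spectral measures become operators.\<close>

lemma quadratic_form_limit:
  fixes A :: "nat \<Rightarrow> 'a::chilbert_space \<Rightarrow> 'a"
  assumes A: "\<And>n. bounded_clinear (A n)"
    and lim: "\<And>x. (\<lambda>n. cinner (A n x) x) \<longlonglongrightarrow> q x"
    and bnd: "\<And>x. cmod (q x) \<le> C * (norm x)\<^sup>2"
  shows "\<exists>A. bounded_clinear A \<and> (\<forall>x. q x = cinner (A x) x)"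
proof -
  interpret A: bounded_op "A n" for n by (simp add: bounded_op_def A)
  define B where "B x y = (\<Sum>k<4. \<i> ^ k / 4 * q (x + \<i> ^ k *\<^sub>C y))" for x y
  have limB: "(\<lambda>n. cinner (A n x) y) \<longlonglongrightarrow> B x y" for x y
  proof -
    have "(\<lambda>n. \<Sum>k<4. \<i> ^ k / 4 * cinner (A n (x + \<i> ^ k *\<^sub>C y)) (x + \<i> ^ k *\<^sub>C y)) \<longlonglongrightarrow> B x y"
      unfolding B_def by (intro tendsto_intros lim)
    moreover have "(\<lambda>n. cinner (A n x) y) =
        (\<lambda>n. \<Sum>k<4. \<i> ^ k / 4 * cinner (A n (x + \<i> ^ k *\<^sub>C y)) (x + \<i> ^ k *\<^sub>C y))"
      by (rule ext, rule cinner_polarization[OF A])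
    ultimately show ?thesis by (rule ssubst[rotated])
  qed
  have B_add1: "B (x + x') y = B x y + B x' y" for x x' y
    using tendsto_add[OF limB[of x y] limB[of x' y]] limB[of "x + x'" y]
    by (simp add: A.add cinner_add_left LIMSEQ_unique)
  have B_add2: "B x (y + y') = B x y + B x y'" for x y' y
    using tendsto_add[OF limB[of x y] limB[of x y']] limB[of x "y + y'"]
    by (simp add: cinner_add_right LIMSEQ_unique)
  have B_sc1: "B (c *\<^sub>C x) y = c * B x y" for c x y
    using tendsto_mult_left[OF limB[of x y], of c] limB[of "c *\<^sub>C x" y]
    by (simp add: A.scaleC cinner_scaleC_left LIMSEQ_unique)
  have B_sc2: "B x (c *\<^sub>C y) = cnj c * B x y" for c x y
    using tendsto_mult_left[OF limB[of x y], of "cnj c"] limB[of x "c *\<^sub>C y"]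
    by (simp add: cinner_scaleC_right LIMSEQ_unique)
  have Bq: "B x x = q x" for x using limB[of x x] lim[of x] by (rule LIMSEQ_unique)

  \<comment> \<open>For unit vectors \<open>x + \<i> ^ k *\<^sub>C y\<close> has norm at most 2, so
    each of the four polarization terms is at most \<open>C * 4 / 4\<close>. General vectors follow
    by scaling.\<close>
  have bnd1: "cmod (B x y) \<le> 4 * C" if "norm x = 1" "norm y = 1" for x y
  proof -
    have C: "C \<ge> 0" using order_trans[OF norm_ge_zero bnd[of x]] that by simp
    have "cmod (B x y) \<le> (\<Sum>k<4::nat. C)"
      unfolding B_def
    proof (rule sum_norm_le)
      fix k :: nat
      have "norm (x + \<i> ^ k *\<^sub>C y) \<le> 2"
        using norm_triangle_ineq[of x "\<i> ^ k *\<^sub>C y"] that by (simp add: norm_power)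
      then have "(norm (x + \<i> ^ k *\<^sub>C y))\<^sup>2 \<le> 2\<^sup>2" by (intro power_mono) auto
      then have "cmod (q (x + \<i> ^ k *\<^sub>C y)) \<le> C * 4"
        using order_trans[OF bnd mult_left_mono[OF _ C]] by simp
      then show "cmod (\<i> ^ k / 4 * q (x + \<i> ^ k *\<^sub>C y)) \<le> C"
        by (simp add: norm_mult norm_divide norm_power)
    qed
    then show ?thesis by simp
  qed
  have B0: "B 0 y = 0" "B y 0 = 0" for y using B_sc1[of 0 0] B_sc2[of _ 0 0] by simp_all
  have bndB: "cmod (B x y) \<le> 4 * C * norm x * norm y" for x y
  proof (cases "x = 0 \<or> y = 0")
    case False
    define x' where "x' = complex_of_real (1 / norm x) *\<^sub>C x"
    define y' where "y' = complex_of_real (1 / norm y) *\<^sub>C y"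
    have n: "norm x' = 1" "norm y' = 1" using False by (simp_all add: x'_def y'_def norm_divide)
    have "x = complex_of_real (norm x) *\<^sub>C x'" "y = complex_of_real (norm y) *\<^sub>C y'"
      using False by (simp_all add: x'_def y'_def scaleC_scaleC)
    then have "B x y = complex_of_real (norm x) * (complex_of_real (norm y) * B x' y')"
      by (metis B_sc1 B_sc2 complex_cnj_complex_of_real)
    then have "cmod (B x y) = norm x * norm y * cmod (B x' y')" by (simp add: norm_mult)
    also have "\<dots> \<le> norm x * norm y * (4 * C)" by (intro mult_left_mono bnd1 n) simp
    finally show ?thesis by (simp add: mult_ac)
  qed (auto simp: B0)
  have "\<exists>u. \<forall>y. cnj (B x y) = cinner y u" for x
  proof (rule riesz_representation, rule bounded_clinearI)
    show "cmod (cnj (B x y)) \<le> 4 * C * norm x * norm y" for y using bndB by simp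
  qed (simp_all add: B_add2 B_sc2 scaleC_complex_def)
  then obtain A' where A': "\<And>x y. cnj (B x y) = cinner y (A' x)" by metis
  then have BA: "cinner (A' x) y = B x y" for x y
    by (metis cinner_commute complex_cnj_cnj)
  have "bounded_clinear A'"
  proof (rule bounded_clinearI)
    show "A' (x + y) = A' x + A' y" for x y by (rule cinner_eqI) (simp add: BA cinner_add_left B_add1)
    show "A' (c *\<^sub>C x) = c *\<^sub>C A' x" for c x by (rule cinner_eqI) (simp add: BA cinner_scaleC_left B_sc1)
    show "norm (A' x) \<le> (4 * \<bar>C\<bar>) * norm x" for x
    proof (cases "A' x = 0")
      case False
      have "(norm (A' x))\<^sup>2 = cmod (B x (A' x))"
        by (simp add: BA[symmetric] cinner_self norm_power)
      also have "\<dots> \<le> 4 * C * norm x * norm (A' x)" by (rule bndB)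
      also have "\<dots> \<le> 4 * \<bar>C\<bar> * norm x * norm (A' x)" by (intro mult_right_mono) auto
      finally show ?thesis using False by (simp add: power2_eq_square)
    qed simp
  qed
  then show ?thesis using BA Bq by metis
qed

subsection \<open>The canonical left inverse\<close>

lemma bij_gram_if_expansive:
  fixes T :: "'a::chilbert_space \<Rightarrow> 'a"
  assumes T: "bounded_clinear T" and exp: "\<And>x. norm x \<le> norm (T x)"
  shows "bij (cadjoint T \<circ> T)" "norm x \<le> norm (cadjoint T (T x))"
proof -
  define S where "S x = cadjoint T (T x)" for x
  interpret S: bounded_op S
    unfolding bounded_op_def S_def[abs_def]
    by (rule bounded_clinear_compose[OF bounded_clinear_cadjoint[OF T] T])
  have SR: "(norm x)\<^sup>2 \<le> Re (cinner (S x) x)" for x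
    by (simp add: S_def cinner_cadjoint_left[OF T] cinner_self power_mono exp)
  have S_lower: "norm x \<le> norm (S x)" for x
  proof (cases "x = 0")
    case False
    have "(norm x)\<^sup>2 \<le> norm (S x) * norm x"
      using SR complex_Re_le_cmod cmod_cinner_le by (meson order_trans)
    then show ?thesis using False by (simp add: power2_eq_square)
  qed simp
  then show "norm x \<le> norm (cadjoint T (T x))" by (simp add: S_def)
  obtain K0 where "K0 > 0" and K0: "\<And>x. norm (S x) \<le> K0 * norm x" using S.bound by blast
  \<comment> \<open>The maximum with 1 keeps \<open>r\<close> at most 1, so that the square root
    defining \<open>c\<close> is that of a nonnegative number.\<close>
  define K where "K = max K0 1"
  have K: "K \<ge> 1" "norm (S x) \<le> K * norm x" for x
  proof -
    have "K0 * norm x \<le> K * norm x" by (rule mult_right_mono) (simp_all add: K_def)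
    then show "norm (S x) \<le> K * norm x" using K0[of x] by (rule order_trans[rotated])
  qed (simp add: K_def)
  \<comment> \<open>\<open>I - K\<^sup>-\<^sup>2 S\<close> is a strict contraction, so \<open>S x = y\<close> can be solved by Banach's fixed point theorem.\<close>
  define r where "r = 1 / K\<^sup>2"
  \<comment> \<open>The squared norm of \<open>x - r *\<^sub>R S x\<close> is at most
    \<open>1 + r^2 * K^2 - 2 * r\<close> times that of \<open>x\<close>, and
    \<open>r * K^2 = 1\<close> turns this factor into \<open>1 - r\<close>.\<close>
  define c where "c = sqrt (1 - r)"
  have r: "0 < r" "r \<le> 1" using K(1) by (simp_all add: r_def)
  have contr: "norm (x - r *\<^sub>R S x) \<le> c * norm x" for x
  proof -
    have "(norm (x - r *\<^sub>R S x))\<^sup>2 = (norm x)\<^sup>2 + r\<^sup>2 * (norm (S x))\<^sup>2 - 2 * r * Re (cinner (S x) x)"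
      using norm_add_sq[of x "- (r *\<^sub>R S x)"]
      by (simp add: Re_cinner inner_commute power_mult_distrib)
    also have "\<dots> \<le> (norm x)\<^sup>2 + r\<^sup>2 * (K * norm x)\<^sup>2 - 2 * r * (norm x)\<^sup>2"
    proof -
      have "(norm (S x))\<^sup>2 \<le> (K * norm x)\<^sup>2" using K by (intro power_mono) auto
      then have "r\<^sup>2 * (norm (S x))\<^sup>2 \<le> r\<^sup>2 * (K * norm x)\<^sup>2" by (intro mult_left_mono) auto
      moreover have "2 * r * (norm x)\<^sup>2 \<le> 2 * r * Re (cinner (S x) x)"
        using r SR by (intro mult_left_mono) auto
      ultimately show ?thesis by linarith
    qed
    also have "r\<^sup>2 * (K * norm x)\<^sup>2 = r * (norm x)\<^sup>2"
      using K(1) by (simp add: r_def power_mult_distrib) (simp add: power2_eq_square)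
    also have "(norm x)\<^sup>2 + r * (norm x)\<^sup>2 - 2 * r * (norm x)\<^sup>2 = (c * norm x)\<^sup>2"
      using r by (simp add: c_def power_mult_distrib algebra_simps)
    finally show ?thesis by (rule power2_le_imp_le) (use r in \<open>simp add: c_def\<close>)
  qed
  have "\<exists>x. S x = y" for y
  proof -
    have "\<exists>!x. x - r *\<^sub>R (S x - y) = x"
    proof (rule banach_fix_type)
      show "0 \<le> c" using r by (simp add: c_def)
      show "c < 1" using r by (simp add: c_def)
      show "\<forall>x z. dist (x - r *\<^sub>R (S x - y)) (z - r *\<^sub>R (S z - y)) \<le> c * dist x z"
      proof (intro allI)
        fix x z
        have "(x - r *\<^sub>R (S x - y)) - (z - r *\<^sub>R (S z - y)) = (x - z) - r *\<^sub>R S (x - z)"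
          by (simp add: S.diff scaleR_diff_right)
        then show "dist (x - r *\<^sub>R (S x - y)) (z - r *\<^sub>R (S z - y)) \<le> c * dist x z"
          by (simp only: dist_norm contr)
      qed
    qed
    then obtain x where "x - r *\<^sub>R (S x - y) = x" by blast
    then show ?thesis using r by (intro exI[of _ x]) simp
  qed
  moreover have "inj S"
  proof (rule injI)
    show "a = b" if "S a = S b" for a b using S_lower[of "a - b"] that by (simp add: S.diff)
  qed
  ultimately have "bij S" unfolding bij_def surj_def by metis
  then show "bij (cadjoint T \<circ> T)" by (simp add: S_def[abs_def] comp_def)
qed

text \<open>\<open>T \<circ> L\<close> is \<open>T\<close> times the inverse Gram operator times the
  adjoint of \<open>T\<close>, hence self-adjoint. For the last claim, an operator that commutes
  with \<open>T\<close> and its adjoint commutes with the Gram operator and therefore with its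
  inverse.\<close>

lemma canonical_left_inverse_expansive:
  fixes T :: "'a::chilbert_space \<Rightarrow> 'a"
  assumes T: "bounded_clinear T" and exp: "\<And>x. norm x \<le> norm (T x)"
  defines "L \<equiv> canonical_left_inverse T"
  shows "bounded_clinear L" "L (T x) = x" "cinner (T (L x)) y = cinner x (T (L y))"
    "\<And>A. bounded_clinear A \<Longrightarrow> (\<And>x. A (T x) = T (A x)) \<Longrightarrow>
      (\<And>x. A (cadjoint T x) = cadjoint T (A x)) \<Longrightarrow> A (L x) = L (A x)"
proof -
  define S where "S = cadjoint T \<circ> T"
  have bij: "bij S" unfolding S_def by (rule bij_gram_if_expansive[OF T exp])
  have low: "norm x \<le> norm (S x)" for x
    unfolding S_def using bij_gram_if_expansive[OF T exp] by simp
  interpret S: bounded_op S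
    unfolding bounded_op_def S_def comp_def
    by (rule bounded_clinear_compose[OF bounded_clinear_cadjoint[OF T] T])
  have Si: "S (inv S y) = y" "inv S (S y) = y" for y
    using bij by (simp_all add: bij_is_surj surj_f_inv_f bij_is_inj)
  have inj: "x = y" if "S x = S y" for x y using Si(2) that by metis
  have L: "L x = inv S (cadjoint T x)" for x by (simp add: L_def canonical_left_inverse_def S_def)
  have "bounded_clinear (inv S)"
  proof (rule bounded_clinearI)
    show "norm (inv S x) \<le> 1 * norm x" for x using low[of "inv S x"] by (simp add: Si)
  qed (rule inj, simp add: Si S.add S.scaleC)+
  then show "bounded_clinear L"
    unfolding L[abs_def] by (rule bounded_clinear_compose[OF _ bounded_clinear_cadjoint[OF T]])
  show "L (T x) = x" for x unfolding L using Si(2)[of x] by (simp add: S_def)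
  have S_adj: "cinner (S x) y = cinner x (S y)" for x y
    by (simp add: S_def cinner_cadjoint_left[OF T] cinner_cadjoint[OF T])
  have "cinner (inv S x) y = cinner x (inv S y)" for x y
    using S_adj[of "inv S x" "inv S y"] by (simp add: Si)
  then show "cinner (T (L x)) y = cinner x (T (L y))"
    by (simp add: L cinner_cadjoint[OF T] cinner_cadjoint_left[OF T])
  fix A assume A: "bounded_clinear A" "\<And>x. A (T x) = T (A x)" "\<And>x. A (cadjoint T x) = cadjoint T (A x)"
  have "A (inv S y) = inv S (A y)" for y
  proof (rule inj)
    have "S (A x) = A (S x)" for x by (simp add: S_def A)
    then show "S (A (inv S y)) = S (inv S (A y))" by (simp add: Si)
  qed
  then show "A (L x) = L (A x)" by (simp add: L A)
qed

subsection \<open>Two-isometries\<close>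

text \<open>\<open>D\<close> is the defect operator, adjoint of \<open>T\<close> times
  \<open>T\<close> minus identity, given by its form so that adjoints stay out of the calculations.
  The second identity, invariance of this form under \<open>T\<close>, is the 2-isometry
  equation.\<close>

locale two_isometry =
  fixes T D :: "'a::chilbert_space \<Rightarrow> 'a"
  assumes T: "bounded_clinear T" and D: "bounded_clinear D"
    and cinner_T_T: "cinner (T x) (T y) = cinner x y + cinner (D x) y"
    and cinner_D_T_T: "cinner (D (T x)) (T y) = cinner (D x) y"
begin

sublocale T: bounded_op T by unfold_locales (rule T)
sublocale D: bounded_op D by unfold_locales (rule D)
sublocale Tn: bounded_op "T ^^ n" for n by unfold_locales (rule bounded_clinear_funpow[OF T])

definition q where "q x = Re (cinner (D x) x)"

lemma D_adj: "cinner (D x) y = cinner x (D y)"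
proof -
  have "cinner (D x) y = cinner (T x) (T y) - cinner x y" by (simp add: cinner_T_T)
  also have "\<dots> = cnj (cinner (T y) (T x) - cinner y x)"
    by (simp add: cinner_commute[of "T x" "T y"] cinner_commute[of x y])
  also have "\<dots> = cnj (cinner (D y) x)" by (simp add: cinner_T_T)
  also have "\<dots> = cinner x (D y)" by (rule cinner_commute[symmetric])
  finally show ?thesis .
qed

lemma cinner_D_self: "cinner (D x) x = complex_of_real (q x)"
proof -
  have "Im (cinner (D x) x) = 0"
    using arg_cong[OF cinner_commute[of "D x" x], of Im] D_adj[of x x] by simp
  then show ?thesis by (simp add: q_def complex_eq_iff)
qed

lemma cinner_D_Tn: "cinner (D ((T ^^ n) x)) ((T ^^ n) y) = cinner (D x) y"
  by (induction n) (simp_all add: cinner_D_T_T)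

lemma q_T: "q (T x) = q x" and q_Tn: "q ((T ^^ n) x) = q x"
  by (simp_all add: q_def cinner_D_T_T cinner_D_Tn)

lemma norm_T_sq: "(norm (T x))\<^sup>2 = (norm x)\<^sup>2 + q x"
  using arg_cong[OF cinner_T_T[of x x], of Re] by (simp add: cinner_self q_def)

lemma norm_Tn_sq: "(norm ((T ^^ n) x))\<^sup>2 = (norm x)\<^sup>2 + n * q x"
  by (induction n) (simp_all add: norm_T_sq q_Tn algebra_simps)

text \<open>The squared norm of \<open>(T ^^ n) x\<close> is affine in \<open>n\<close> with slope
  \<open>q x\<close>, so a negative slope would make it negative eventually.\<close>

lemma q_nonneg: "0 \<le> q x"
proof (rule ccontr)
  assume neg: "\<not> 0 \<le> q x"
  obtain n :: nat where "(norm x)\<^sup>2 < n * (- q x)"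
    using reals_Archimedean3[of "- q x"] neg by (auto simp: not_le)
  then have "(norm ((T ^^ n) x))\<^sup>2 < 0" unfolding norm_Tn_sq by simp
  then show False by (simp add: not_less[symmetric])
qed

lemma T_expansive: "norm x \<le> norm (T x)"
  by (rule power2_le_imp_le) (simp_all add: norm_T_sq q_nonneg)

lemma q_zero [simp]: "q 0 = 0" by (simp add: q_def)

lemma q_bound: obtains K where "K > 0" "\<And>x. q x \<le> K * (norm x)\<^sup>2"
proof -
  obtain K where K: "K > 0" "\<And>x. norm (D x) \<le> K * norm x" using D.bound by blast
  have "q x \<le> K * (norm x)\<^sup>2" for x
  proof -
    have "q x \<le> cmod (cinner (D x) x)" unfolding q_def by (rule complex_Re_le_cmod)
    also have "\<dots> \<le> norm (D x) * norm x" by (rule cmod_cinner_le)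
    also have "\<dots> \<le> K * norm x * norm x" by (intro mult_right_mono K) simp
    finally show ?thesis by (simp add: power2_eq_square mult.assoc)
  qed
  then show ?thesis using K(1) that by blast
qed

lemma q_add: "q (x + y) = q x + q y + 2 * Re (cinner (D x) y)"
proof -
  have "Re (cinner (D y) x) = Re (cinner (D x) y)"
    using arg_cong[OF cinner_commute[of "D y" x], of Re] D_adj[of x y] by simp
  then show ?thesis by (simp add: q_def D.add cinner_add_left cinner_add_right)
qed

lemma q_scaleC: "q (c *\<^sub>C x) = (cmod c)\<^sup>2 * q x"
proof -
  have "cinner (D (c *\<^sub>C x)) (c *\<^sub>C x) = (c * cnj c) * cinner (D x) x"
    by (simp add: D.scaleC cinner_scaleC_left cinner_scaleC_right)
  also have "\<dots> = complex_of_real ((cmod c)\<^sup>2 * q x)"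
    by (simp add: complex_norm_square[symmetric] cinner_D_self)
  finally show ?thesis unfolding q_def[of "c *\<^sub>C x"] by simp
qed

text \<open>Positivity of \<open>q\<close> at \<open>s x - t y\<close> with \<open>s * t = 1\<close>
  bounds the cross term. The free parameter lets the factor of \<open>q x\<close> come arbitrarily
  close to 1, at the expense of \<open>q y\<close>.\<close>

lemma q_add_le:
  assumes "\<delta> > 0" shows "q (x + y) \<le> (1 + \<delta>) * q x + (1 + 1 / \<delta>) * q y"
proof -
  obtain s t where st: "s\<^sup>2 = \<delta>" "t\<^sup>2 = 1 / \<delta>" "s * t = 1"
    using assms by (intro that[of "sqrt \<delta>" "1 / sqrt \<delta>"]) (simp_all add: power_divide)
  have "0 \<le> q (complex_of_real s *\<^sub>C x + complex_of_real (- t) *\<^sub>C y)" by (rule q_nonneg)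
  also have "\<dots> = s\<^sup>2 * q x + t\<^sup>2 * q y - 2 * (s * t) * Re (cinner (D x) y)"
    by (simp add: q_add q_scaleC D.scaleC cinner_scaleC_left cinner_scaleC_right del: of_real_minus)
  also have "\<dots> = \<delta> * q x + (1 / \<delta>) * q y - 2 * Re (cinner (D x) y)" by (simp add: st)
  finally show ?thesis by (simp add: q_add algebra_simps)
qed

lemma cmod_cinner_D_le: "2 * cmod (cinner (D x) y) \<le> q x + q y"
proof -
  obtain u where u: "cmod u = 1" "u * cinner (D x) y = cmod (cinner (D x) y)"
    using unimodular_rotation by blast
  have "0 \<le> q ((- u) *\<^sub>C x + y)" by (rule q_nonneg)
  also have "\<dots> = q x + q y - 2 * cmod (cinner (D x) y)"
    using u by (simp add: q_add q_scaleC D.scaleC cinner_scaleC_left)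
  finally show ?thesis by simp
qed

end

text \<open>\<open>T_L_adj\<close> makes the idempotent \<open>T \<circ> L\<close> the orthogonal
  projection onto the range of \<open>T\<close>, which identifies \<open>L\<close> as the canonical
  left inverse. The assumption \<open>pure\<close> is analyticity.\<close>

locale pure_two_isometry = two_isometry T D for T D :: "'a::chilbert_space \<Rightarrow> 'a" +
  fixes L
  assumes L: "bounded_clinear L" and L_T [simp]: "L (T x) = x"
    and T_L_adj: "cinner (T (L x)) y = cinner x (T (L y))"
    and pure: "(\<And>m. x \<in> range (T ^^ m)) \<Longrightarrow> x = 0"
begin

sublocale L: bounded_op L by unfold_locales (rule L)
sublocale Ln: bounded_op "L ^^ n" for n by unfold_locales (rule bounded_clinear_funpow[OF L])

definition P where "P x = x - T (L x)"

sublocale P: bounded_op P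
  unfolding bounded_op_def P_def[abs_def]
  by (rule bounded_clinear_diff[OF bounded_clinear_id bounded_clinear_compose[OF T L]])

lemma P_T [simp]: "P (T x) = 0" and L_P [simp]: "L (P x) = 0"
  by (simp_all add: P_def L.diff)

lemma P_eq: "L x = 0 \<Longrightarrow> P x = x"
  by (simp add: P_def T.zero)

lemma P_adj: "cinner (P x) y = cinner x (P y)"
  by (simp add: P_def cinner_diff_left cinner_diff_right T_L_adj)

lemma cinner_P_T: "cinner (P x) (T y) = 0"
  by (simp add: P_adj)

text \<open>\<open>x\<close> is the orthogonal sum of \<open>P x\<close> and \<open>T (L x)\<close>,
  and \<open>norm_T_sq\<close> evaluates the second part. Iterating this along the powers of
  \<open>L\<close> gives the one-variable norm identity.\<close>

lemma norm_decomp: "(norm x)\<^sup>2 = (norm (P x))\<^sup>2 + q (L x) + (norm (L x))\<^sup>2"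
  using norm_add_sq[of "P x" "T (L x)"] by (simp add: cinner_P_T norm_T_sq) (simp add: P_def)

lemma norm_L_le: "norm (L x) \<le> norm x"
  by (rule power2_le_imp_le) (use norm_decomp[of x] q_nonneg[of "L x"] in simp_all)

lemma norm_Ln_le: "norm ((L ^^ n) x) \<le> norm x"
  by (induction n) (auto intro: order_trans[OF norm_L_le])

lemma norm_expand:
  "(norm x)\<^sup>2 = (\<Sum>k<n. (norm (P ((L ^^ k) x)))\<^sup>2 + q ((L ^^ Suc k) x)) + (norm ((L ^^ n) x))\<^sup>2"
proof (induction n)
  case (Suc n)
  then show ?case using norm_decomp[of "(L ^^ n) x"] by simp
qed simp

lemma Ln_Tn [simp]: "(L ^^ n) ((T ^^ n) x) = x"
  by (induction n arbitrary: x) (simp_all add: funpow_swap1)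

lemma Ln_Tk: "n \<le> k \<Longrightarrow> (L ^^ n) ((T ^^ k) x) = (T ^^ (k - n)) x"
  using Ln_Tn[of n "(T ^^ (k - n)) x"] by (metis funpow_add comp_apply le_add_diff_inverse)

lemma Ln_Tk': "k < n \<Longrightarrow> L a = 0 \<Longrightarrow> (L ^^ n) ((T ^^ k) a) = 0"
proof -
  assume "k < n" "L a = 0"
  then obtain d where "n = d + (1 + k)" by (metis add.commute add_Suc_right less_imp_Suc_add plus_1_eq_Suc)
  then have "(L ^^ n) ((T ^^ k) a) = (L ^^ d) (L a)"
    by (simp only: funpow_add comp_apply Ln_Tn) simp
  then show ?thesis using \<open>L a = 0\<close> by (simp add: Ln.zero)
qed

text \<open>The right-hand side is the Taylor polynomial of \<open>x\<close>; it telescopes because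
  \<open>P\<close> is the identity minus \<open>T \<circ> L\<close>.\<close>

lemma remainder: "x - (T ^^ n) ((L ^^ n) x) = (\<Sum>k<n. (T ^^ k) (P ((L ^^ k) x)))"
proof (induction n)
  case (Suc n)
  have *: "(T ^^ n) (P ((L ^^ n) x)) = (T ^^ n) ((L ^^ n) x) - (T ^^ Suc n) ((L ^^ Suc n) x)"
    by (simp add: P_def Tn.diff funpow_swap1)
  show ?case unfolding sum.lessThan_Suc Suc[symmetric] * by (simp del: funpow.simps)
qed simp

lemma summable_P_q: "summable (\<lambda>k. (norm (P ((L ^^ k) x)))\<^sup>2 + q ((L ^^ Suc k) x))"
proof (rule summableI_nonneg_bounded)
  show "(\<Sum>k<n. (norm (P ((L ^^ k) x)))\<^sup>2 + q ((L ^^ Suc k) x)) \<le> (norm x)\<^sup>2" for n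
    using norm_expand[of x n] zero_le_power2[of "norm ((L ^^ n) x)"] by linarith
qed (simp add: q_nonneg)

lemma summable_P: "summable (\<lambda>k. (norm (P ((L ^^ k) x)))\<^sup>2)"
  by (rule summable_comparison_test'[where N=0, OF summable_P_q[of x]]) (auto simp: q_nonneg)

lemma summable_q: "summable (\<lambda>k. q ((L ^^ Suc k) x))"
  by (rule summable_comparison_test'[where N=0, OF summable_P_q[of x]]) (auto simp: q_nonneg)

text \<open>Infinitely many \<open>T\<^sup>n L\<^sup>n x\<close> lie in a fixed ball, since \<open>\<Sum> q (L\<^sup>n x)\<close> converges and the
  harmonic series does not. Convex combinations of them come close to \<open>\<Inter> T\<^sup>m H = {0}\<close>, while
  \<open>L\<^sup>n\<close> eventually annihilates \<open>x\<close> minus such a combination.\<close>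

lemma Ln_tendsto_0: "(\<lambda>n. (L ^^ n) x) \<longlonglongrightarrow> 0"
proof -
  define w where "w n = (T ^^ n) ((L ^^ n) x)" for n
  define I where "I = {n. n * q ((L ^^ n) x) \<le> 1}"
  have I_inf: "\<exists>n\<ge>m. n \<in> I" for m
  proof (rule ccontr)
    assume "\<not> (\<exists>n\<ge>m. n \<in> I)"
    then have *: "n * q ((L ^^ n) x) > 1" if "n \<ge> m" for n using that by (force simp: I_def)
    have "summable (\<lambda>n. inverse (real n))"
    proof (rule summable_comparison_test')
      show "summable (\<lambda>k. q ((L ^^ k) x))"         by (rule summable_Suc_iff[THEN iffD1, OF summable_q])
      show "norm (inverse (real n)) \<le> q ((L ^^ n) x)" if "n \<ge> Suc m" for n
        using *[of n] that by (simp add: field_simps)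
    qed
    then show False using not_summable_harmonic[where 'a=real] by simp
  qed
  define C where "C m = closure (convex hull (w ` {n \<in> I. m \<le> n}))" for m
  have "\<exists>y. \<forall>m. y \<in> C m"
  proof (rule nested_convex_inter)
    show "decseq C" unfolding decseq_def C_def by (intro allI impI closure_mono hull_mono) auto
    show "\<exists>y\<in>C m. norm y \<le> sqrt ((norm x)\<^sup>2 + 1)" for m
    proof -
      obtain n where n: "n \<ge> m" "n \<in> I" using I_inf by blast
      have "(norm (w n))\<^sup>2 \<le> (norm x)\<^sup>2 + 1"
        unfolding w_def norm_Tn_sq
        using n(2) by (intro add_mono power_mono norm_Ln_le) (auto simp: I_def)
      then have "norm (w n) \<le> sqrt ((norm x)\<^sup>2 + 1)" by (rule real_le_rsqrt)
      moreover have "w n \<in> C m" unfolding C_def using n by (intro subsetD[OF closure_subset] hull_inc) auto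
      ultimately show ?thesis by blast
    qed
  qed (simp_all add: C_def convex_closure)
  then obtain y where y: "\<And>m. y \<in> C m" by blast
  have "y \<in> range (T ^^ m)" for m
  proof -
    \<comment> \<open>\<open>(T ^^ m) \<circ> (L ^^ m)\<close> fixes exactly the range of
      \<open>T ^^ m\<close>. Described in this way the range is visibly closed and convex, and it
      contains every \<open>w n\<close> with \<open>m \<le> n\<close>.\<close>
    have "C m \<subseteq> {y. (T ^^ m) ((L ^^ m) y) = y}"
      unfolding C_def
    proof (intro closure_minimal hull_minimal)
      show "closed {y. (T ^^ m) ((L ^^ m) y) = y}"
        by (intro closed_Collect_eq continuous_on_compose2[OF Tn.continuous_on Ln.continuous_on] continuous_on_id) auto
      show "convex {y. (T ^^ m) ((L ^^ m) y) = y}"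
        by (auto simp: convex_def Ln.add Tn.add linear_scale[OF Ln.linear] linear_scale[OF Tn.linear])
      show "w ` {n \<in> I. m \<le> n} \<subseteq> {y. (T ^^ m) ((L ^^ m) y) = y}"
      proof safe
        fix n assume "m \<le> n"
        then show "(T ^^ m) ((L ^^ m) (w n)) = w n"
          by (simp add: w_def Ln_Tk) (metis funpow_add comp_apply le_add_diff_inverse)
      qed
    qed
    then have "(T ^^ m) ((L ^^ m) y) = y" using y[of m] by auto
    then show ?thesis by (metis rangeI)
  qed
  then have "y = 0" by (rule pure)
  then have 0: "0 \<in> C 0" using y by metis
  have hull: "convex hull (w ` {n \<in> I. 0 \<le> n}) \<subseteq> {z. \<exists>n. (L ^^ n) (x - z) = 0}"
  proof (rule hull_minimal)
    show "w ` {n \<in> I. 0 \<le> n} \<subseteq> {z. \<exists>n. (L ^^ n) (x - z) = 0}"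
    proof safe
      fix n
      have "(L ^^ n) (x - w n) = 0" by (simp add: w_def Ln.diff)
      then show "\<exists>n'. (L ^^ n') (x - w n) = 0" by blast
    qed
    have mono: "(L ^^ k) y = 0" if "(L ^^ n) y = 0" "n \<le> k" for n k y
    proof -
      have "(L ^^ k) y = (L ^^ (k - n)) ((L ^^ n) y)" using that(2) by (metis comp_apply funpow_add le_add_diff_inverse2)
      then show ?thesis using that by (simp add: Ln.zero)
    qed
    show "convex {z. \<exists>n. (L ^^ n) (x - z) = 0}"
    proof (rule convexI, safe)
      fix a b m n and u v :: real
      assume ab: "(L ^^ m) (x - a) = 0" "(L ^^ n) (x - b) = 0" and "u + v = 1"
      then have x: "x = u *\<^sub>R x + v *\<^sub>R x" by (simp add: scaleR_add_left[symmetric])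
      have "x - (u *\<^sub>R a + v *\<^sub>R b) = u *\<^sub>R (x - a) + v *\<^sub>R (x - b)"
        by (subst x) (simp add: algebra_simps)
      then have "(L ^^ max m n) (x - (u *\<^sub>R a + v *\<^sub>R b)) = 0"
        using mono[OF ab(1), of "max m n"] mono[OF ab(2), of "max m n"]
        by (simp only: Ln.add linear_scale[OF Ln.linear]) simp
      then show "\<exists>n. (L ^^ n) (x - (u *\<^sub>R a + v *\<^sub>R b)) = 0" by blast
    qed
  qed
  show ?thesis
  proof (rule LIMSEQ_I)
    fix e :: real assume "e > 0"
    \<comment> \<open>Once a power of \<open>L\<close> kills \<open>x - z\<close>, the later powers
      agree on \<open>x\<close> and \<open>z\<close>. Since \<open>L\<close> is a contraction, they
      are then smaller than \<open>e\<close> at \<open>x\<close>.\<close>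
    then obtain z where z: "z \<in> convex hull (w ` {n \<in> I. 0 \<le> n})" "dist z 0 < e"
      using 0 unfolding C_def closure_approachable by blast
    then obtain N where N: "(L ^^ N) (x - z) = 0" using hull by auto
    have "norm ((L ^^ n) x - 0) < e" if "n \<ge> N" for n
    proof -
      have "(L ^^ n) (x - z) = (L ^^ (n - N)) ((L ^^ N) (x - z))"
        using that by (metis comp_apply funpow_add le_add_diff_inverse2)
      then have "(L ^^ n) x = (L ^^ n) z" by (simp add: N Ln.zero) (simp add: Ln.diff)
      then show ?thesis using norm_Ln_le[of n z] z(2) by simp
    qed
    then show "\<exists>N. \<forall>n\<ge>N. norm ((L ^^ n) x - 0) < e" by blast
  qed
qed

text \<open>This is the value that the Dirichlet integral of the power series with coefficients
  \<open>P ((L ^^ k) x)\<close> will turn out to have, see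
  \<open>dirichlet_energy_eq\<close>.\<close>

definition energy where "energy x = (\<Sum>k. q ((L ^^ Suc k) x))"

lemma energy_nonneg: "0 \<le> energy x"
  unfolding energy_def by (intro suminf_nonneg summable_q q_nonneg)

lemma norm_sq_eq: "(norm x)\<^sup>2 = (\<Sum>k. (norm (P ((L ^^ k) x)))\<^sup>2) + energy x"
proof -
  have "(\<lambda>n. (\<Sum>k<n. (norm (P ((L ^^ k) x)))\<^sup>2 + q ((L ^^ Suc k) x)) + (norm ((L ^^ n) x))\<^sup>2)
      \<longlonglongrightarrow> (\<Sum>k. (norm (P ((L ^^ k) x)))\<^sup>2 + q ((L ^^ Suc k) x)) + (norm (0::'a))\<^sup>2"
    by (intro tendsto_add tendsto_power tendsto_norm Ln_tendsto_0 summable_LIMSEQ summable_P_q)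
  then have "(\<lambda>n::nat. (norm x)\<^sup>2) \<longlonglongrightarrow> (\<Sum>k. (norm (P ((L ^^ k) x)))\<^sup>2 + q ((L ^^ Suc k) x))"
    by (simp only: norm_expand[of x, symmetric]) simp
  then have "(norm x)\<^sup>2 = (\<Sum>k. (norm (P ((L ^^ k) x)))\<^sup>2 + q ((L ^^ Suc k) x))"
    by (rule LIMSEQ_unique[OF tendsto_const])
  then show ?thesis by (simp only: energy_def suminf_add[OF summable_P summable_q])
qed

lemma energy_le: "energy x \<le> (norm x)\<^sup>2"
  using norm_sq_eq[of x] suminf_nonneg[OF summable_P[of x]] by simp

lemma energy_add_le:
  assumes "\<delta> > 0" shows "energy (x + y) \<le> (1 + \<delta>) * energy x + (1 + 1 / \<delta>) * energy y"
proof -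
  have "energy (x + y) \<le> (\<Sum>k. (1 + \<delta>) * q ((L ^^ Suc k) x) + (1 + 1 / \<delta>) * q ((L ^^ Suc k) y))"
    unfolding energy_def
    by (intro suminf_le summable_q summable_add summable_mult)
      (simp only: Ln.add q_add_le assms)
  then show ?thesis
    by (simp only: energy_def suminf_mult[OF summable_q]
        suminf_add[OF summable_mult[OF summable_q] summable_mult[OF summable_q], symmetric])
qed

text \<open>The energy of \<open>\<Sum>\<^sub>k\<^sub>\<le>\<^sub>N T\<^sup>k a\<^sub>k\<close> when all \<open>a\<^sub>k\<close> are in the kernel of \<open>L\<close>.\<close>

definition poly_energy :: "nat \<Rightarrow> (nat \<Rightarrow> 'a) \<Rightarrow> complex" where
  "poly_energy N a = (\<Sum>j\<le>N. \<Sum>k\<le>N. of_nat (min j k) * cinner (D ((T ^^ j) (a j))) ((T ^^ k) (a k)))"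

text \<open>\<open>L ^^ i\<close> lowers the exponents by \<open>i\<close> and kills the terms with
  smaller exponents. The form of \<open>D\<close> does not notice a common shift, so the pair
  \<open>j\<close>, \<open>k\<close> contributes the same number once for each \<open>i\<close> from
  1 to \<open>min j k\<close>.\<close>

lemma energy_poly:
  assumes a: "\<And>k. L (a k) = 0"
  shows "complex_of_real (energy (\<Sum>k\<le>N. (T ^^ k) (a k))) = poly_energy N a"
proof -
  define y where "y = (\<Sum>k\<le>N. (T ^^ k) (a k))"
  define g where "g j k = cinner (D ((T ^^ j) (a j))) ((T ^^ k) (a k))" for j k
  have Ly: "(L ^^ i) y = (\<Sum>k\<le>N. if i \<le> k then (T ^^ (k - i)) (a k) else 0)" for i
    unfolding y_def Ln.sum by (rule sum.cong) (auto simp: Ln_Tk Ln_Tk' a)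
  have shift: "cinner (D ((T ^^ (j - i)) (a j))) ((T ^^ (k - i)) (a k)) = g j k" if "i \<le> j" "i \<le> k" for i j k
  proof -
    have "(T ^^ j) (a j) = (T ^^ i) ((T ^^ (j - i)) (a j))" "(T ^^ k) (a k) = (T ^^ i) ((T ^^ (k - i)) (a k))"
      using that by (metis comp_apply funpow_add le_add_diff_inverse)+
    then show ?thesis by (simp add: g_def cinner_D_Tn)
  qed
  have qL: "complex_of_real (q ((L ^^ i) y)) = (\<Sum>j\<le>N. \<Sum>k\<le>N. if i \<le> j \<and> i \<le> k then g j k else 0)" for i
    unfolding cinner_D_self[symmetric] Ly D.sum cinner_sum_left cinner_sum_right
    by (subst sum.swap, intro sum.cong refl) (auto simp: shift D.zero)
  have "energy y = (\<Sum>i<N. q ((L ^^ Suc i) y))"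
    unfolding energy_def
    by (rule suminf_finite) (simp, simp only: Ly, subst sum.neutral, auto)
  then have "complex_of_real (energy y) = (\<Sum>i<N. \<Sum>j\<le>N. \<Sum>k\<le>N. if Suc i \<le> j \<and> Suc i \<le> k then g j k else 0)"
    by (simp only: of_real_sum qL)
  also have "\<dots> = (\<Sum>j\<le>N. \<Sum>k\<le>N. \<Sum>i<N. if Suc i \<le> j \<and> Suc i \<le> k then g j k else 0)"
    by (subst sum.swap, rule sum.cong[OF refl], rule sum.swap)
  also have "\<dots> = (\<Sum>j\<le>N. \<Sum>k\<le>N. of_nat (min j k) * g j k)"
  proof (intro sum.cong refl)
    fix j k assume "j \<in> {..N}" "k \<in> {..N}"
    then have "i < N \<and> Suc i \<le> j \<and> Suc i \<le> k \<longleftrightarrow> i < min j k" for i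
      unfolding atMost_iff by linarith
    then have *: "{..<N} \<inter> {i. Suc i \<le> j \<and> Suc i \<le> k} = {..<min j k}" by blast
    show "(\<Sum>i<N. if Suc i \<le> j \<and> Suc i \<le> k then g j k else 0) = of_nat (min j k) * g j k"
      by (subst sum.If_cases) (simp_all only: * finite_lessThan sum_constant card_lessThan mult_zero_right add_0_right)
  qed
  finally show ?thesis by (simp add: y_def poly_energy_def g_def)
qed

end

subsection \<open>Abel means\<close>

definition abel_mean :: "real \<Rightarrow> (nat \<Rightarrow> real) \<Rightarrow> real" where
  "abel_mean r f = (1 - r) * (\<Sum>n. r ^ n * f n)"

text \<open>Each of the first \<open>Suc n\<close> powers of \<open>r\<close> is at least
  \<open>r ^ n\<close>. The bound is uniform in \<open>r\<close>, which makes it a majorant in the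
  limit \<open>r\<close> to 1.\<close>

lemma one_minus_mult_power_le:
  assumes "0 \<le> r" "r \<le> (1::real)" shows "(1 - r) * (real (Suc n) * r ^ n) \<le> 1"
proof -
  have "(\<Sum>k<Suc n. r ^ n) \<le> (\<Sum>k<Suc n. r ^ k)"
    using assms by (intro sum_mono power_decreasing) auto
  then have "(1 - r) * (real (Suc n) * r ^ n) \<le> (1 - r) * (\<Sum>k<Suc n. r ^ k)"
    using assms by (intro mult_left_mono) auto
  also have "\<dots> = 1 - r ^ Suc n" by (rule sum_gp_basic[of r n, folded lessThan_Suc_atMost])
  also have "\<dots> \<le> 1" using assms by simp
  finally show ?thesis .
qed

lemma summable_abel_bounded:
  assumes "0 \<le> r" "r < (1::real)" "\<And>n. \<bar>f n\<bar> \<le> B"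
  shows "summable (\<lambda>n. r ^ n * f n)"
proof (rule summable_comparison_test'[where N=0])
  show "summable (\<lambda>n. r ^ n * B)" using assms by (intro summable_mult2 summable_geometric) auto
  show "norm (r ^ n * f n) \<le> r ^ n * B" for n
    using assms by (simp add: abs_mult power_abs mult_left_mono)
qed

text \<open>The tail contributes less than \<open>e / 2\<close> for every \<open>r\<close>, while
  the \<open>N\<close> initial terms contribute at most \<open>(1 - r) * (N * B)\<close>, which
  vanishes in the limit.\<close>

lemma abel_mean_tendsto_0:
  assumes f: "f \<longlonglongrightarrow> 0" and nn: "\<And>n. 0 \<le> f n"
  shows "((\<lambda>r. abel_mean r f) \<longlongrightarrow> 0) (at_left 1)"
proof (rule tendstoI)
  fix e :: real assume e: "e > 0"
  obtain B where B: "\<And>n. \<bar>f n\<bar> \<le> B" "B > 0"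
    using convergent_imp_Bseq[OF convergentI[OF f]] by (auto simp: Bseq_def)
  obtain N where N: "\<And>n. n \<ge> N \<Longrightarrow> f n < e / 2"
    using order_tendstoD(2)[OF f, of "e/2"] e by (auto simp: eventually_sequentially)
  have bnd: "\<bar>abel_mean r f\<bar> < e" if r: "0 < r" "r < 1" "(1 - r) * (real N * B) < e / 2" for r
  proof -
    have s: "summable (\<lambda>n. r ^ n * f n)" using r B by (intro summable_abel_bounded) auto
    have "(\<Sum>n. r ^ n * f n) = (\<Sum>n. r ^ (n + N) * f (n + N)) + (\<Sum>n<N. r ^ n * f n)"
      by (rule suminf_split_initial_segment[OF s])
    also have "(\<Sum>n<N. r ^ n * f n) \<le> (\<Sum>n<N. B)"
    proof (rule sum_mono)
      fix n
      have "r ^ n * f n \<le> 1 * B" using r B(1)[of n] nn[of n] by (intro mult_mono power_le_one) auto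
      then show "r ^ n * f n \<le> B" by simp
    qed
    also have "(\<Sum>n. r ^ (n + N) * f (n + N)) \<le> (\<Sum>n. r ^ n * (e / 2))"
    proof (rule suminf_le)
      show "r ^ (n + N) * f (n + N) \<le> r ^ n * (e / 2)" for n
        using r N[of "n + N"] nn by (intro mult_mono power_decreasing) auto
      show "summable (\<lambda>n. r ^ (n + N) * f (n + N))" using s by (rule summable_ignore_initial_segment)
      show "summable (\<lambda>n. r ^ n * (e / 2))" using r by (intro summable_mult2 summable_geometric) auto
    qed
    also have "(\<Sum>n. r ^ n * (e / 2)) = 1 / (1 - r) * (e / 2)"
      using r by (subst suminf_mult2[symmetric]) (auto simp: suminf_geometric intro: summable_geometric)
    finally have "abel_mean r f \<le> (1 - r) * (1 / (1 - r) * (e / 2) + real N * B)"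
      unfolding abel_mean_def using r by (intro mult_left_mono) auto
    also have "\<dots> = e / 2 + (1 - r) * (real N * B)" using r by (simp add: field_simps)
    also have "\<dots> < e" using r by simp
    finally have "abel_mean r f < e" .
    moreover have "0 \<le> abel_mean r f"
      unfolding abel_mean_def using r nn by (intro mult_nonneg_nonneg suminf_nonneg s) auto
    ultimately show ?thesis by simp
  qed
  have "((\<lambda>r. (1 - r) * (real N * B)) \<longlongrightarrow> (1 - 1) * (real N * B)) (at_left 1)"
    by (intro tendsto_intros)
  then have "\<forall>\<^sub>F r in at_left 1. (1 - r) * (real N * B) < e / 2"
    using e by (intro order_tendstoD(2)) auto
  moreover have "\<forall>\<^sub>F r in at_left (1::real). 0 < r \<and> r < 1"
    using eventually_at_left_real[of 0 1] by (auto elim: eventually_mono)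
  ultimately show "\<forall>\<^sub>F r in at_left 1. dist (abel_mean r f) 0 < e"
    by eventually_elim (use bnd in auto)
qed

lemma summable_abel_weighted:
  assumes r: "0 \<le> r" "r < (1::real)" and b: "summable b" "\<And>n. 0 \<le> b n"
  shows "summable (\<lambda>n. r ^ n * (real (Suc n) * b n))"
proof (rule summable_comparison_test'[where N=0])
  show "summable (\<lambda>n. 1 / (1 - r) * b n)" by (intro summable_mult b)
  show "norm (r ^ n * (real (Suc n) * b n)) \<le> 1 / (1 - r) * b n" for n
  proof -
    have "real (Suc n) * r ^ n \<le> 1 / (1 - r)"
      using one_minus_mult_power_le[of r n] r by (simp add: field_simps)
    then have "real (Suc n) * r ^ n * b n \<le> 1 / (1 - r) * b n" by (rule mult_right_mono) (rule b)
    then show ?thesis using r b(2)[of n] by (simp add: mult_ac)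
  qed
qed

text \<open>The averaged sequence itself need not tend to 0. Its weight
  \<open>(1 - r) * Suc n * r ^ n\<close> is at most 1 and tends to 0 for each \<open>n\<close>, so
  Tannery's theorem applies with the majorant \<open>b\<close>.\<close>

lemma abel_mean_weighted_tendsto_0:
  assumes b: "summable b" "\<And>n. 0 \<le> b n"
  shows "((\<lambda>r. abel_mean r (\<lambda>n. real (Suc n) * b n)) \<longlongrightarrow> 0) (at_left 1)"
proof -
  have ev: "\<forall>\<^sub>F r in at_left (1::real). 0 < r \<and> r < 1"
    using eventually_at_left_real[of 0 1] by (auto elim: eventually_mono)
  have "((\<lambda>r. \<Sum>n. (1 - r) * (r ^ n * (real (Suc n) * b n))) \<longlongrightarrow> (\<Sum>n. 0)) (at_left 1)"
  proof (rule conjunct2[OF conjunct2[OF tannerys_theorem[where F="at_left 1" and M=b]]])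
    show "((\<lambda>r. (1 - r) * (r ^ k * (real (Suc k) * b k))) \<longlongrightarrow> 0) (at_left 1)" for k
    proof -
      have "((\<lambda>r. (1 - r) * (r ^ k * (real (Suc k) * b k))) \<longlongrightarrow> (1 - 1) * (1 ^ k * (real (Suc k) * b k))) (at_left 1)"
        by (intro tendsto_intros)
      then show ?thesis by simp
    qed
    show "\<forall>\<^sub>F (k, r) in at_top \<times>\<^sub>F at_left 1. norm ((1 - r) * (r ^ k * (real (Suc k) * b k))) \<le> b k"
    proof -
      have "\<forall>\<^sub>F (k, r) in (at_top :: nat filter) \<times>\<^sub>F at_left (1::real). 0 < r \<and> r < 1"
        by (subst eventually_prod2) (use ev in auto)
      then show ?thesis
      proof (eventually_elim, safe)
        fix k and r :: real assume r: "0 < r" "r < 1"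
        have "(1 - r) * (real (Suc k) * r ^ k) * b k \<le> 1 * b k"
          using r by (intro mult_right_mono one_minus_mult_power_le b) auto
        then show "norm ((1 - r) * (r ^ k * (real (Suc k) * b k))) \<le> b k"
          using r b(2)[of k] by (simp add: abs_mult mult_ac)
      qed
    qed
  qed (use b in \<open>auto simp: trivial_limit_at_left_real\<close>)
  then have "((\<lambda>r. \<Sum>n. (1 - r) * (r ^ n * (real (Suc n) * b n))) \<longlongrightarrow> 0) (at_left 1)"
    unfolding suminf_zero .
  then show ?thesis
  proof (rule Lim_transform_eventually)
    show "\<forall>\<^sub>F r in at_left 1. (\<Sum>n. (1 - r) * (r ^ n * (real (Suc n) * b n))) = abel_mean r (\<lambda>n. real (Suc n) * b n)"
      using ev
    proof eventually_elim
      case (elim r)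
      then show ?case unfolding abel_mean_def by (intro suminf_mult summable_abel_weighted b) auto
    qed
  qed
qed

lemma abel_mean_add:
  assumes "summable (\<lambda>n. r ^ n * f n)" "summable (\<lambda>n. r ^ n * g n)"
  shows "abel_mean r (\<lambda>n. f n + g n) = abel_mean r f + abel_mean r g"
  by (simp only: abel_mean_def distrib_left suminf_add[OF assms, symmetric])

lemma abel_mean_cmult:
  assumes "summable (\<lambda>n. r ^ n * f n)"
  shows "abel_mean r (\<lambda>n. c * f n) = c * abel_mean r f"
  using suminf_mult[OF assms, of c] by (simp add: abel_mean_def mult_ac)

lemma abel_mean_const:
  assumes "0 \<le> r" "r < 1" shows "abel_mean r (\<lambda>n. c) = c"
  using assms by (simp add: abel_mean_def suminf_mult2[symmetric] suminf_geometric summable_geometric)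

lemma abel_mean_mono:
  assumes "0 \<le> r" "r < 1" "\<And>n. f n \<le> g n" "summable (\<lambda>n. r ^ n * f n)" "summable (\<lambda>n. r ^ n * g n)"
  shows "abel_mean r f \<le> abel_mean r g"
  unfolding abel_mean_def using assms by (intro mult_left_mono suminf_le) auto

context pure_two_isometry
begin

text \<open>The energies of the Taylor polynomials of \<open>x\<close> need not converge to the energy of \<open>x\<close>, but
  their Abel means do.\<close>

lemma abel_energy:
  defines "e \<equiv> \<lambda>x n. energy (x - (T ^^ Suc n) ((L ^^ Suc n) x))"
  shows "0 \<le> r \<Longrightarrow> r < 1 \<Longrightarrow> summable (\<lambda>n. r ^ n * e x n)"
    and "((\<lambda>r. abel_mean r (e x)) \<longlongrightarrow> energy x) (at_left 1)"
proof -
  define w where "w n = (T ^^ Suc n) ((L ^^ Suc n) x)" for n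
  define b where "b n = q ((L ^^ Suc n) x)" for n
  \<comment> \<open>This is the squared norm of the remainder \<open>w n\<close> and so bounds its
    energy. Its first part tends to 0, its second is a weighted term of a convergent series, and
    hence its Abel means tend to 0.\<close>
  define f where "f n = (norm ((L ^^ Suc n) x))\<^sup>2 + real (Suc n) * b n" for n
  have e: "e x n = energy (x - w n)" for n by (simp only: e_def w_def)
  have fw: "f n = (norm (w n))\<^sup>2" for n unfolding f_def w_def norm_Tn_sq b_def ..
  have b: "summable b" "0 \<le> b n" for n
    unfolding b_def using summable_q q_nonneg by auto
  have Lb: "\<bar>(norm ((L ^^ Suc n) x))\<^sup>2\<bar> \<le> (norm x)\<^sup>2" for n
    using norm_Ln_le[of "Suc n" x] by (simp only: abs_power2 power_mono norm_ge_zero)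
  have sL: "summable (\<lambda>n. r ^ n * (norm ((L ^^ Suc n) x))\<^sup>2)" if "0 \<le> r" "r < 1" for r :: real
    by (rule summable_abel_bounded[OF that Lb])
  have sf: "summable (\<lambda>n. r ^ n * f n)" if "0 \<le> r" "r < 1" for r :: real
    using summable_add[OF sL summable_abel_weighted[OF _ _ b]] that by (simp only: f_def distrib_left)
  have sc: "summable (\<lambda>n. r ^ n * c)" if "0 \<le> r" "r < 1" for r c :: real
    using that by (intro summable_mult2 summable_geometric) auto
  have up: "e x n \<le> (1 + \<delta>) * energy x + (1 + 1 / \<delta>) * f n" if "\<delta> > 0" for \<delta> n
  proof -
    have "e x n \<le> (1 + \<delta>) * energy x + (1 + 1 / \<delta>) * energy (- w n)"
      using energy_add_le[OF that, of x "- w n"] by (simp add: e)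
    also have "\<dots> \<le> (1 + \<delta>) * energy x + (1 + 1 / \<delta>) * f n"
      using energy_le[of "- w n"] that by (intro add_left_mono mult_left_mono) (auto simp: fw)
    finally show ?thesis .
  qed
  have low: "energy x \<le> (1 + \<delta>) * e x n + (1 + 1 / \<delta>) * f n" if "\<delta> > 0" for \<delta> n
  proof -
    have "energy x \<le> (1 + \<delta>) * e x n + (1 + 1 / \<delta>) * energy (w n)"
      using energy_add_le[OF that, of "x - w n" "w n"] by (simp add: e)
    also have "\<dots> \<le> (1 + \<delta>) * e x n + (1 + 1 / \<delta>) * f n"
      using energy_le[of "w n"] that by (intro add_left_mono mult_left_mono) (auto simp: fw)
    finally show ?thesis .
  qed
  have se: "summable (\<lambda>n. r ^ n * e x n)" if r: "0 \<le> r" "r < 1" for r :: real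
  proof (rule summable_comparison_test'[where N=0])
    show "summable (\<lambda>n. r ^ n * (2 * energy x) + 2 * (r ^ n * f n))"
      by (intro summable_add summable_mult sf sc r)
    show "norm (r ^ n * e x n) \<le> r ^ n * (2 * energy x) + 2 * (r ^ n * f n)" for n
      using mult_left_mono[OF up[of 1 n], of "r ^ n"] r energy_nonneg[of "x - w n"]
      by (simp add: e abs_mult algebra_simps)
  qed
  then show "0 \<le> r \<Longrightarrow> r < 1 \<Longrightarrow> summable (\<lambda>n. r ^ n * e x n)" .
  have AU: "abel_mean r (e x) \<le> (1 + \<delta>) * energy x + (1 + 1 / \<delta>) * abel_mean r f"
    and AL: "energy x \<le> (1 + \<delta>) * abel_mean r (e x) + (1 + 1 / \<delta>) * abel_mean r f"
    if r: "0 < r" "r < 1" and "\<delta> > 0" for r \<delta>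
  proof -
    have s1: "summable (\<lambda>n. r ^ n * ((1 + \<delta>) * energy x))" using r by (intro sc) auto
    have s2: "summable (\<lambda>n. r ^ n * ((1 + 1 / \<delta>) * f n))"
      using summable_mult[OF sf, of r "1 + 1 / \<delta>"] r by (simp add: mult_ac)
    have s3: "summable (\<lambda>n. r ^ n * ((1 + \<delta>) * e x n))"
      using summable_mult[OF se, of r "1 + \<delta>"] r by (simp add: mult_ac)
    have "abel_mean r (e x) \<le> abel_mean r (\<lambda>n. (1 + \<delta>) * energy x + (1 + 1 / \<delta>) * f n)"
      by (rule abel_mean_mono) (use r up[OF that(3)] se summable_add[OF s1 s2] in \<open>simp_all add: distrib_left\<close>)
    also have "\<dots> = (1 + \<delta>) * energy x + (1 + 1 / \<delta>) * abel_mean r f"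
      using r by (simp only: abel_mean_add[OF s1 s2] abel_mean_cmult[OF sf] abel_mean_const)
    finally show "abel_mean r (e x) \<le> (1 + \<delta>) * energy x + (1 + 1 / \<delta>) * abel_mean r f" .
    have "abel_mean r (\<lambda>n. energy x) \<le> abel_mean r (\<lambda>n. (1 + \<delta>) * e x n + (1 + 1 / \<delta>) * f n)"
      by (rule abel_mean_mono) (use r low[OF that(3)] sc[of r "energy x"] summable_add[OF s3 s2] in \<open>simp_all add: distrib_left\<close>)
    also have "\<dots> = (1 + \<delta>) * abel_mean r (e x) + (1 + 1 / \<delta>) * abel_mean r f"
      using r by (simp only: abel_mean_add[OF s3 s2] abel_mean_cmult[OF sf] abel_mean_cmult[OF se])
    finally show "energy x \<le> (1 + \<delta>) * abel_mean r (e x) + (1 + 1 / \<delta>) * abel_mean r f"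
      using r by (simp only: abel_mean_const less_imp_le)
  qed
  have Af: "((\<lambda>r. abel_mean r f) \<longlongrightarrow> 0) (at_left 1)"
  proof -
    have "(\<lambda>n. (norm ((L ^^ Suc n) x))\<^sup>2) \<longlonglongrightarrow> (norm (0::'a))\<^sup>2"
      by (intro tendsto_power tendsto_norm LIMSEQ_Suc Ln_tendsto_0)
    then have "((\<lambda>r. abel_mean r (\<lambda>n. (norm ((L ^^ Suc n) x))\<^sup>2) + abel_mean r (\<lambda>n. real (Suc n) * b n)) \<longlongrightarrow> 0 + 0) (at_left 1)"
      by (intro tendsto_add abel_mean_tendsto_0 abel_mean_weighted_tendsto_0 b) auto
    then show ?thesis
      unfolding add_0_right
    proof (rule Lim_transform_eventually)
      show "\<forall>\<^sub>F r in at_left 1. abel_mean r (\<lambda>n. (norm ((L ^^ Suc n) x))\<^sup>2) + abel_mean r (\<lambda>n. real (Suc n) * b n) = abel_mean r f"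
        using eventually_at_left_real[of 0 1, simplified]
      proof eventually_elim
        case (elim r)
        show ?case unfolding f_def
          by (rule abel_mean_add[symmetric]) (use elim sL summable_abel_weighted[OF _ _ b] in auto)
      qed
    qed
  qed
  have ev: "\<forall>\<^sub>F r in at_left (1::real). 0 < r \<and> r < 1"
    using eventually_at_left_real[of 0 1] by (auto elim: eventually_mono)
  show "((\<lambda>r. abel_mean r (e x)) \<longlongrightarrow> energy x) (at_left 1)"
  proof (rule order_tendstoI)
    fix c assume c: "c < energy x"
    \<comment> \<open>Chosen so that \<open>\<delta> * c\<close> takes at most half of the gap
      \<open>energy x - c\<close>; the other half absorbs the Abel mean of \<open>f\<close>. The
      summand 1 avoids a division by 0.\<close>
    define \<delta> where "\<delta> = (energy x - c) / (2 * (\<bar>c\<bar> + 1))"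
    have \<delta>: "\<delta> > 0" using c by (simp add: \<delta>_def)
    have "\<delta> * c \<le> \<delta> * (\<bar>c\<bar> + 1)" using \<delta> by (intro mult_left_mono) auto
    also have "\<dots> = (energy x - c) / 2" by (simp add: \<delta>_def field_simps)
    finally have gap: "energy x - (1 + \<delta>) * c > 0" using c by (simp add: algebra_simps)
    have "((\<lambda>r. (1 + 1 / \<delta>) * abel_mean r f) \<longlongrightarrow> (1 + 1 / \<delta>) * 0) (at_left 1)"
      by (intro tendsto_intros Af)
    then have "\<forall>\<^sub>F r in at_left 1. (1 + 1 / \<delta>) * abel_mean r f < energy x - (1 + \<delta>) * c"
      using gap by (intro order_tendstoD(2)) auto
    then show "\<forall>\<^sub>F r in at_left 1. c < abel_mean r (e x)"
      using ev
    proof eventually_elim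
      case (elim r)
      then have "energy x \<le> (1 + \<delta>) * abel_mean r (e x) + (1 + 1 / \<delta>) * abel_mean r f"
        using AL[of r \<delta>] \<delta> by simp
      then have "(1 + \<delta>) * c < (1 + \<delta>) * abel_mean r (e x)" using elim by linarith
      then show ?case using \<delta> by (simp add: mult_less_cancel_left_pos)
    qed
  next
    fix c assume c: "energy x < c"
    define \<delta> where "\<delta> = (c - energy x) / (2 * (energy x + 1))"
    have \<delta>: "\<delta> > 0" using c energy_nonneg[of x] by (simp add: \<delta>_def)
    have "\<delta> * energy x \<le> \<delta> * (energy x + 1)" using \<delta> by (intro mult_left_mono) auto
    also have "\<dots> = (c - energy x) / 2" using energy_nonneg[of x] by (simp add: \<delta>_def field_simps)
    finally have gap: "c - (1 + \<delta>) * energy x > 0" using c by (simp add: algebra_simps)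
    have "((\<lambda>r. (1 + 1 / \<delta>) * abel_mean r f) \<longlongrightarrow> (1 + 1 / \<delta>) * 0) (at_left 1)"
      by (intro tendsto_intros Af)
    then have "\<forall>\<^sub>F r in at_left 1. (1 + 1 / \<delta>) * abel_mean r f < c - (1 + \<delta>) * energy x"
      using gap by (intro order_tendstoD(2)) auto
    then show "\<forall>\<^sub>F r in at_left 1. abel_mean r (e x) < c"
      using ev
    proof eventually_elim
      case (elim r)
      then show ?case using AU[of r \<delta>] \<delta> by simp
    qed
  qed
qed

end

subsection \<open>Moments of the area measure\<close>

text \<open>Transports Lebesgue measure to \<open>real^2\<close>, where its invariance under
  orthogonal transformations can be used. Agreement on boxes suffices.\<close>

lemma lborel_complex_eq_distr:
  "distr lborel borel (\<lambda>v::real^2. Complex (v $ 1) (v $ 2)) = lborel"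
proof (rule sym, rule lborel_eqI)
  fix l u :: complex assume le: "\<And>b. b \<in> Basis \<Longrightarrow> l \<bullet> b \<le> u \<bullet> b"
  have le': "Re l \<le> Re u" "Im l \<le> Im u" using le[of 1] le[of \<i>] by (auto simp: Basis_complex_def)
  have cont: "continuous_on UNIV (\<lambda>v::real^2. Complex (v $ 1) (v $ 2))"
    unfolding Complex_eq by (intro continuous_intros)
  then have [measurable]: "(\<lambda>v::real^2. Complex (v $ 1) (v $ 2)) \<in> borel_measurable borel"
    by (rule borel_measurable_continuous_onI)
  define l' u' :: "real^2" where "l' = vector [Re l, Im l]" and "u' = vector [Re u, Im u]"
  have B: "(\<lambda>v::real^2. Complex (v $ 1) (v $ 2)) -` box l u = box l' u'"
    by (auto simp: in_box_complex_iff mem_box_cart forall_2 l'_def u'_def)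
  have le2: "\<And>b. b \<in> Basis \<Longrightarrow> l' \<bullet> b \<le> u' \<bullet> b"
    using le' by (auto simp: Basis_vec_def UNIV_2 l'_def u'_def inner_axis)
  have "emeasure (distr lborel borel (\<lambda>v::real^2. Complex (v $ 1) (v $ 2))) (box l u) = emeasure lborel (box l' u')"
    by (subst emeasure_distr) (simp_all add: B)
  also have "\<dots> = ennreal (\<Prod>b\<in>Basis. (u' - l') \<bullet> b)"
    using le2 by (rule emeasure_lborel_box)
  also have "(\<Prod>b\<in>Basis. (u' - l') \<bullet> b) = (Re u - Re l) * (Im u - Im l)"
  proof -
    have B2: "Basis = {axis 1 1, axis 2 (1::real) :: real^2}" by (auto simp: Basis_vec_def UNIV_2)
    have "axis 1 1 \<noteq> (axis 2 1 :: real^2)" by (simp add: axis_eq_axis)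
    then show ?thesis unfolding B2 by (simp add: inner_axis l'_def u'_def)
  qed
  also have "\<dots> = (\<Prod>b\<in>Basis. (u - l) \<bullet> b)" by (simp add: Basis_complex_def)
  finally show "emeasure (distr lborel borel (\<lambda>v::real^2. Complex (v $ 1) (v $ 2))) (box l u) =
    ennreal (\<Prod>b\<in>Basis. (u - l) \<bullet> b)" .
qed simp

text \<open>Multiplication by \<open>w\<close> is an orthogonal transformation in real coordinates
  and preserves Lebesgue measure.\<close>

lemma lborel_complex_rotation:
  assumes w: "cmod w = 1"
  shows "distr lborel borel (\<lambda>z. w * z) = (lborel :: complex measure)"
proof (rule sym, rule lborel_eqI)
  fix l u :: complex assume le: "\<And>b. b \<in> Basis \<Longrightarrow> l \<bullet> b \<le> u \<bullet> b"
  define g where "g v = Complex (v $ 1) (v $ 2)" for v :: "real^2"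
  define h where "h z = (vector [Re z, Im z] :: real^2)" for z
  have gh: "g (h z) = z" "h (g v) = v" for z v
    by (auto simp: g_def h_def vec_eq_iff forall_2 complex_eq_iff)
  have cont: "continuous_on UNIV g" unfolding g_def Complex_eq by (intro continuous_intros)
  then have [measurable]: "g \<in> borel_measurable borel" by (rule borel_measurable_continuous_onI)
  have g_lin: "g (x + y) = g x + g y" "g (c *\<^sub>R x) = c *\<^sub>R g x" for x y c
    by (simp_all add: g_def complex_eq_iff)
  have h_lin: "h (x + y) = h x + h y" "h (c *\<^sub>R x) = c *\<^sub>R h x" for x y c
    by (simp_all add: h_def vec_eq_iff forall_2)
  have norm_g: "cmod (g v) = norm v" for v
    by (simp add: g_def norm_vec_def L2_set_def UNIV_2 cmod_def)
  \<comment> \<open>The inverse rotation: its image of \<open>B\<close> is the preimage of the box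
    under multiplication by \<open>w\<close>, and preimages are what \<open>distr\<close>
    measures.\<close>
  define f where "f v = h (cnj w * g v)" for v
  have lin: "linear f" unfolding f_def
    by (intro linearI) (simp_all add: g_lin h_lin algebra_simps)
  have orth: "orthogonal_transformation f"
    unfolding orthogonal_transformation using lin
    by (auto simp: f_def norm_mult w simp flip: norm_g) (simp add: gh norm_mult w)
  define B where "B = g -` box l u"
  have "B \<in> sets borel" unfolding B_def
    by (rule measurable_sets_borel[of g borel]) simp_all
  have emB: "emeasure lborel B = ennreal (\<Prod>b\<in>Basis. (u - l) \<bullet> b)"
  proof -
    have "emeasure lborel B = emeasure (distr lborel borel g) (box l u)"
      by (subst emeasure_distr) (simp_all add: B_def)
    then show ?thesis
      using emeasure_lborel_box[OF le] by (simp only: lborel_complex_eq_distr[folded g_def[abs_def]])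
  qed
  have fB: "f ` B = g -` ((\<lambda>z. w * z) -` box l u)"
  proof -
    have 1: "w * g (f v) = g v" for v
      using w by (simp add: f_def gh mult.assoc[symmetric] complex_norm_square[symmetric])
    have 2: "f (h (w * g v)) = v" for v
      using w by (simp add: f_def gh mult.assoc[symmetric] mult.commute[of _ w] complex_norm_square[symmetric])
    have "v \<in> f ` B" if "w * g v \<in> box l u" for v
      using that 2[of v] by (intro image_eqI[of _ f "h (w * g v)"]) (simp_all add: B_def gh)
    then show ?thesis using 1 by (auto simp: B_def)
  qed
  have lm: "B \<in> lmeasurable"
    using \<open>B \<in> sets borel\<close> emB by (intro fmeasurableI) auto
  have "emeasure (distr lborel borel (\<lambda>z. w * z)) (box l u) = emeasure (distr lborel borel g) ((\<lambda>z. w * z) -` box l u)"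
    by (subst emeasure_distr) (simp_all add: lborel_complex_eq_distr[folded g_def[abs_def]])
  also have "\<dots> = emeasure lborel (f ` B)"
  proof (subst emeasure_distr)
    have "(\<lambda>z. w * z) -` box l u \<inter> space borel \<in> sets borel" by (rule measurable_sets[of _ borel borel]) simp_all
    then show "(\<lambda>z. w * z) -` box l u \<in> sets borel" by simp
  qed (simp_all add: fB)
  also have "\<dots> = emeasure lebesgue (f ` B)"
  proof -
    have "(\<lambda>v. w * g v) -` box l u \<inter> space borel \<in> sets borel" by (rule measurable_sets[of _ _ borel]) simp_all
    then have "f ` B \<in> sets borel" by (simp add: fB vimage_def)
    then show ?thesis by simp
  qed
  also have "\<dots> = ennreal (measure lebesgue (f ` B))"
    by (rule emeasure_eq_measure2[OF measurable_orthogonal_image[OF orth lm]])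
  also have "\<dots> = ennreal (measure lebesgue B)" by (simp only: measure_orthogonal_image[OF orth lm])
  also have "\<dots> = emeasure lebesgue B" by (rule emeasure_eq_measure2[OF lm, symmetric])
  also have "\<dots> = ennreal (\<Prod>b\<in>Basis. (u - l) \<bullet> b)" using \<open>B \<in> sets borel\<close> emB by simp
  finally show "emeasure (distr lborel borel (\<lambda>z. w * z)) (box l u) = ennreal (\<Prod>b\<in>Basis. (u - l) \<bullet> b)" .
qed simp

lemma emeasure_ball_complex: "0 \<le> r \<Longrightarrow> emeasure lborel (ball (0::complex) r) = ennreal (pi * r\<^sup>2)"
  by (simp add: emeasure_ball unit_ball_vol_2)

text \<open>Writing \<open>cmod z ^ n\<close> as the integral of its derivative from 0 to
  \<open>cmod z\<close> and exchanging the integrals leaves areas of annuli, so polar coordinates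
  are avoided. Exponent 0 is separate, because a constant is not recovered from its
  derivative.\<close>

lemma nn_integral_radial_moment:
  assumes "0 < R"
  shows "(\<integral>\<^sup>+z. ennreal (cmod z ^ (2 * a)) * indicator (ball 0 R) z \<partial>lborel) = ennreal (pi * R ^ (2 * a + 2) / (a + 1))"
proof (cases "a = 0")
  case True
  then show ?thesis using assms by (simp add: emeasure_ball_complex power2_eq_square)
next
  case False
  define n where "n = 2 * a"
  have n: "n \<ge> 1" using False by (simp add: n_def)
  define d where "d s = real n * s ^ (n - 1)" for s :: real
  have d[measurable]: "d \<in> borel_measurable borel" unfolding d_def by measurable
  have FTC: "(\<integral>\<^sup>+s. ennreal (d s) * indicator {0..x} s \<partial>lborel) = ennreal (x ^ n)" if "0 \<le> x" for x
    using n that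
    by (subst nn_integral_FTC_Icc[where F="\<lambda>s. s ^ n"]) (auto simp: d_def intro!: derivative_eq_intros)
  have "(\<integral>\<^sup>+z. ennreal (cmod z ^ n) * indicator (ball 0 R) z \<partial>lborel) =
    (\<integral>\<^sup>+z. (\<integral>\<^sup>+s. ennreal (d s) * indicator {0..cmod z} s * indicator (ball 0 R) z \<partial>lborel) \<partial>lborel)"
    by (subst nn_integral_multc) (simp_all add: FTC)
  also have "\<dots> = (\<integral>\<^sup>+s. (\<integral>\<^sup>+z. ennreal (d s) * indicator {0..cmod z} s * indicator (ball 0 R) z \<partial>lborel) \<partial>lborel)"
  proof (rule lborel_pair.Fubini')
    have "(\<lambda>(s::real, z::complex). ennreal (d s) * (if 0 \<le> s \<and> s \<le> cmod z then 1 else 0) * (if cmod z < R then 1 else 0))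
      \<in> borel_measurable (lborel \<Otimes>\<^sub>M lborel)"
      by measurable
    then show "(\<lambda>(s::real, z::complex). ennreal (d s) * indicator {0..cmod z} s * indicator (ball 0 R) z) \<in> borel_measurable (lborel \<Otimes>\<^sub>M lborel)"
      by (rule measurable_cong[THEN iffD1, rotated]) (auto simp: indicator_def)
  qed
  also have "\<dots> = (\<integral>\<^sup>+s. ennreal (pi * d s * (R\<^sup>2 - s\<^sup>2)) * indicator {0..R} s \<partial>lborel)"
  proof (rule nn_integral_cong)
    fix s :: real
    show "(\<integral>\<^sup>+z. ennreal (d s) * indicator {0..cmod z} s * indicator (ball 0 R) z \<partial>lborel) =
      ennreal (pi * d s * (R\<^sup>2 - s\<^sup>2)) * indicator {0..R} s"
    proof (cases "0 \<le> s \<and> s \<le> R")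
      case True
      have "emeasure lborel (ball (0::complex) R - ball 0 s) = ennreal (pi * R\<^sup>2) - ennreal (pi * s\<^sup>2)"
        using True assms by (subst emeasure_Diff) (auto simp: emeasure_ball_complex)
      then have *: "emeasure lborel (ball (0::complex) R - ball 0 s) = ennreal (pi * (R\<^sup>2 - s\<^sup>2))"
        by (simp add: ennreal_minus algebra_simps)
      have "(\<integral>\<^sup>+z. ennreal (d s) * indicator {0..cmod z} s * indicator (ball 0 R) z \<partial>lborel) =
        (\<integral>\<^sup>+z. ennreal (d s) * indicator (ball (0::complex) R - ball 0 s) z \<partial>lborel)"
        using True by (intro nn_integral_cong) (auto simp: indicator_def)
      also have "\<dots> = ennreal (d s) * ennreal (pi * (R\<^sup>2 - s\<^sup>2))"
        by (subst nn_integral_cmult_indicator) (simp_all add: *)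
      also have "\<dots> = ennreal (pi * d s * (R\<^sup>2 - s\<^sup>2))"
        using True by (subst ennreal_mult[symmetric]) (auto simp: d_def algebra_simps power_mono)
      finally show ?thesis using True by simp
    next
      case False
      then have "(\<integral>\<^sup>+z. ennreal (d s) * indicator {0..cmod z} s * indicator (ball (0::complex) R) z \<partial>lborel) = (\<integral>\<^sup>+(z::complex). 0 \<partial>lborel)"
        by (intro nn_integral_cong) (auto simp: indicator_def)
      then show ?thesis using False by simp
    qed
  qed
  also have "\<dots> = ennreal (pi * (R ^ n * R\<^sup>2 - real n / (n + 2) * R ^ (n + 2)))"
  proof -
    define p where "p = n + 2"
    define F where "F s = pi * (s ^ n * R\<^sup>2 - real n / p * s ^ p)" for s
    have "(\<integral>\<^sup>+s. ennreal (pi * d s * (R\<^sup>2 - s\<^sup>2)) * indicator {0..R} s \<partial>lborel) = ennreal (F R - F 0)"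
    proof (rule nn_integral_FTC_Icc)
      fix s assume s: "s \<in> {0..R}"
      have "(F has_real_derivative pi * (real n * s ^ (n - 1) * R\<^sup>2 - real n / p * (real p * s ^ (p - 1)))) (at s)"
        unfolding F_def by (auto intro!: derivative_eq_intros)
      moreover have "real n / p * (real p * s ^ (p - 1)) = real n * s ^ (n - 1) * s\<^sup>2"
        using n by (simp add: power_add[symmetric] p_def)
      ultimately show "(F has_real_derivative pi * d s * (R\<^sup>2 - s\<^sup>2)) (at s)"
        by (simp add: d_def right_diff_distrib mult.assoc)
      show "0 \<le> pi * d s * (R\<^sup>2 - s\<^sup>2)" using s by (auto simp: d_def power_mono)
    qed (use assms in auto)
    then show ?thesis using n by (simp add: F_def p_def zero_power)
  qed
  also have "pi * (R ^ n * R\<^sup>2 - real n / (n + 2) * R ^ (n + 2)) = pi * R ^ (2 * a + 2) / (a + 1)"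
    by (simp add: n_def field_simps power_add power2_eq_square)
  finally show ?thesis by (simp add: n_def)
qed

lemma disc_moment:
  assumes R: "0 < R" "R \<le> 1"
  shows "integrable area_measure (\<lambda>z. indicator (ball 0 R) z *\<^sub>R (z ^ a * cnj z ^ b))"
    and "(LINT z|area_measure. indicator (ball 0 R) z *\<^sub>R (z ^ a * cnj z ^ b)) =
      (if a = b then complex_of_real (R ^ (2 * a + 2) / (a + 1)) else 0)"
proof -
  define f where "f z = indicator (ball 0 R) z *\<^sub>R (z ^ a * cnj z ^ b)" for z :: complex
  have [measurable]: "cnj \<in> borel_measurable borel"
    by (intro borel_measurable_continuous_onI continuous_intros)
  have ball[measurable]: "ball (0::complex) R \<in> sets borel" by simp
  have f[measurable]: "f \<in> borel_measurable borel"
    unfolding f_def by (intro borel_measurable_scaleR borel_measurable_indicator ball) measurable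
  have fin: "finite_measure area_measure"
    unfolding area_measure_def
    by (intro prob_space.finite_measure prob_space_uniform_measure) (simp_all add: emeasure_ball_complex)
  have sets_area[measurable_cong]: "sets area_measure = sets borel" by (simp add: area_measure_def)
  have bnd: "norm (f z) \<le> 1" for z
  proof (cases "cmod z < R")
    case True
    then have "cmod z ^ a * cmod z ^ b \<le> 1" using R by (intro mult_le_one power_le_one) auto
    then show ?thesis using True by (simp add: f_def norm_mult norm_power)
  qed (simp add: f_def)
  have int: "integrable area_measure f"
    by (rule finite_measure.integrable_const_bound[OF fin, where B=1]) (auto simp: bnd)
  then show "integrable area_measure (\<lambda>z. indicator (ball 0 R) z *\<^sub>R (z ^ a * cnj z ^ b))"
    by (simp only: f_def[abs_def])
  have area: "area_measure = density lborel (\<lambda>z. ennreal (indicator (ball 0 1) z / pi))"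
    unfolding area_measure_def uniform_measure_def
    by (intro density_cong) (auto simp: emeasure_ball_complex divide_ennreal ennreal_indicator[symmetric] indicator_def
        ennreal_divide_numeral simp flip: divide_ennreal ennreal_1)
  have I: "(LINT z|area_measure. f z) = (LINT z|lborel. (1 / pi) *\<^sub>R f z)"
    unfolding area
    by (subst integral_density) (auto intro!: Bochner_Integration.integral_cong simp: f_def indicator_def divide_simps, (use R in auto)?)
  show "(LINT z|area_measure. indicator (ball 0 R) z *\<^sub>R (z ^ a * cnj z ^ b)) =
      (if a = b then complex_of_real (R ^ (2 * a + 2) / (a + 1)) else 0)"
  proof (cases "a = b")
    case False
    \<comment> \<open>A rotation under which \<open>z ^ a * cnj z ^ b\<close> changes sign: the
      exponents differ by \<open>a - b\<close>, so the angle is pi divided by that. Invariance then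
      makes the integral equal to its negative.\<close>
    define w where "w = cis (pi / (real a - real b))"
    have w: "cmod w = 1" "w ^ a * cnj w ^ b = -1"
    proof -
      have "w ^ a * cnj w ^ b = cis (real a * (pi / (real a - real b)) + real b * - (pi / (real a - real b)))"
        by (simp add: w_def Complex.DeMoivre cis_cnj cis_mult del: minus_divide_left)
      also have "real a * (pi / (real a - real b)) + real b * - (pi / (real a - real b)) = pi"
        using False by (simp add: divide_simps) (simp add: algebra_simps)?
      finally show "w ^ a * cnj w ^ b = -1" by simp
    qed (simp add: w_def)
    have "(LINT z|lborel. f z) = (LINT z|distr lborel borel (\<lambda>z. w * z). f z)"
      by (simp only: lborel_complex_rotation[OF w(1)])
    also have "\<dots> = (LINT z|lborel. f (w * z))"
      by (subst integral_distr) simp_all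
    also have "\<dots> = (LINT z|lborel. (w ^ a * cnj w ^ b) * f z)"
      by (intro Bochner_Integration.integral_cong refl)
        (auto simp: f_def norm_mult w(1) indicator_def power_mult_distrib)
    also have "\<dots> = - (LINT z|lborel. f z)" unfolding w(2) by simp
    finally have "(LINT z|lborel. f z) = 0" by simp
    then have "(LINT z|area_measure. f z) = 0" unfolding I by simp
    then show ?thesis using False by (simp only: f_def if_False)
  next
    case True
    have fr: "f z = complex_of_real (cmod z ^ (2 * a) * indicator (ball 0 R) z)" for z
    proof -
      have "z ^ a * cnj z ^ a = complex_of_real (cmod z ^ (2 * a))"
        by (simp add: power_mult_distrib[symmetric] complex_norm_square[symmetric] power_mult)
      then show ?thesis using True by (auto simp: f_def indicator_def)
    qed
    have "(LINT z|lborel. cmod z ^ (2 * a) * indicator (ball 0 R) z) =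
      enn2real (\<integral>\<^sup>+z. ennreal (cmod z ^ (2 * a) * indicator (ball 0 R) z) \<partial>lborel)"
      by (rule integral_eq_nn_integral) (auto intro!: borel_measurable_times borel_measurable_indicator)
    also have "(\<integral>\<^sup>+z. ennreal (cmod z ^ (2 * a) * indicator (ball 0 R) z) \<partial>lborel) =
      (\<integral>\<^sup>+z. ennreal (cmod z ^ (2 * a)) * indicator (ball 0 R) z \<partial>lborel)"
      by (intro nn_integral_cong) (auto simp: indicator_def)
    also have "\<dots> = ennreal (pi * R ^ (2 * a + 2) / (a + 1))" by (rule nn_integral_radial_moment[OF R(1)])
    finally have "(LINT z|lborel. cmod z ^ (2 * a) * indicator (ball 0 R) z) = pi * R ^ (2 * a + 2) / (a + 1)"
      using R by (simp add: enn2real_ennreal)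
    then have "(LINT z|lborel. f z) = complex_of_real (pi * R ^ (2 * a + 2) / (a + 1))"
      unfolding fr integral_complex_of_real by simp
    then have "(LINT z|area_measure. f z) = complex_of_real (R ^ (2 * a + 2) / (a + 1))"
      unfolding I by (simp add: scaleR_conv_of_real)
    then show ?thesis using True by (simp only: f_def simp_thms if_True)
  qed
qed

subsection \<open>Trigonometric moments\<close>

lemma prob_space_angle_measure: "prob_space angle_measure"
  unfolding angle_measure_def by (rule prob_space_uniform_measure) simp_all

lemma sets_angle_measure [measurable_cong, simp]: "sets angle_measure = sets borel"
  by (simp add: angle_measure_def)

lemma space_angle_measure [simp]: "space angle_measure = UNIV"
  by (simp add: angle_measure_def)

lemma angle_measure_density: "angle_measure = density lborel (\<lambda>t. ennreal (indicator {0..2 * pi} t / (2 * pi)))"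
  unfolding angle_measure_def uniform_measure_def
  by (intro density_cong) (auto simp: indicator_def divide_ennreal simp flip: divide_ennreal ennreal_1)

lemma has_integral_cis:
  fixes m :: int
  shows "((\<lambda>t. cis (of_int m * t)) has_integral (if m = 0 then 2 * pi else 0)) {0..2 * pi}"
proof (cases "m = 0")
  case True
  then show ?thesis using has_integral_const_real[of "1::complex" 0 "2 * pi"]
    by (simp add: scaleR_conv_of_real)
next
  case False
  define F where "F t = cis (of_int m * t) / (\<i> * of_int m)" for t :: real
  have "((\<lambda>t. cis (of_int m * t)) has_integral (F (2 * pi) - F 0)) {0..2 * pi}"
  proof (rule fundamental_theorem_of_calculus)
    fix t
    have "((\<lambda>z. exp (\<i> * (of_int m * z)) / (\<i> * of_int m)) has_field_derivative
      exp (\<i> * (of_int m * of_real t))) (at (of_real t))"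
      using False by (auto intro!: derivative_eq_intros simp: field_simps)
    from has_vector_derivative_real_field[OF this]
    show "(F has_vector_derivative cis (of_int m * t)) (at t within {0..2 * pi})"
      by (simp add: F_def[abs_def] cis_conv_exp)
  qed simp
  moreover have "cis (of_int m * (2 * pi)) = 1"
    using cis_multiple_2pi[of "of_int m"] by (simp add: mult.commute)
  ultimately show ?thesis using False by (simp add: F_def)
qed

lemma integral_cis_angle_measure:
  fixes m :: int
  shows "(LINT t|angle_measure. cis (of_int m * t)) = (if m = 0 then 1 else 0)"
proof -
  have cont: "continuous_on {0..2 * pi} (\<lambda>t. cis (of_int m * t))"
    unfolding cis_conv_exp by (intro continuous_intros)
  have meas[measurable]: "(\<lambda>t. cis (of_int m * t)) \<in> borel_measurable borel"
    unfolding cis_conv_exp by (intro borel_measurable_continuous_onI continuous_intros)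
  have si: "set_integrable lborel {0..2 * pi} (\<lambda>t. cis (of_int m * t))"
    using borel_integrable_atLeastAtMost'[OF cont] .
  have "(LINT t:{0..2 * pi}|lborel. cis (of_int m * t)) = (if m = 0 then 2 * pi else 0)"
    using set_borel_integral_eq_integral(2)[OF si] integral_unique[OF has_integral_cis[of m]] by (rule trans)
  then have *: "(LINT t|lborel. indicator {0..2 * pi} t *\<^sub>R cis (of_int m * t)) = (if m = 0 then 2 * pi else 0)"
    by (simp add: set_lebesgue_integral_def)
  have "(LINT t|angle_measure. cis (of_int m * t)) =
    (LINT t|lborel. (1 / (2 * pi)) *\<^sub>R (indicator {0..2 * pi} t *\<^sub>R cis (of_int m * t)))"
    unfolding angle_measure_density by (subst integral_density) auto
  also have "\<dots> = complex_of_real ((1 / (2 * pi)) * (if m = 0 then 2 * pi else 0))"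
    unfolding integral_scaleR_right * by (simp add: scaleR_conv_of_real)
  finally show ?thesis by simp
qed

lemma integrable_cis_angle_measure [simp]: "integrable angle_measure (\<lambda>t. cis (r * t))"
proof (rule finite_measure.integrable_const_bound[where B=1])
  show "(\<lambda>t. cis (r * t)) \<in> borel_measurable angle_measure"
    unfolding cis_conv_exp
    by (subst measurable_cong_sets[OF sets_angle_measure refl])
      (intro borel_measurable_continuous_onI continuous_intros)
qed (simp_all add: prob_space.finite_measure prob_space_angle_measure)

subsection \<open>The scalar spectral measures\<close>

context two_isometry
begin

text \<open>The measures are weak limits of the Fejer means of the positive definite sequence
  \<open>\<langle>D T\<^sup>n x, x\<rangle>\<close>, whose densities are \<open>q (\<Sum>\<^sub>j\<^sub><\<^sub>N e\<^sup>-\<^sup>i\<^sup>j\<^sup>t T\<^sup>j x) / N\<close>.\<close>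

lemma herglotz:
  "\<exists>M. sets M = sets circle_borel \<and> finite_measure M \<and> (\<forall>n. (LINT \<zeta>|M. \<zeta> ^ n) = cinner (D ((T ^^ n) x)) x)"
proof (cases "q x = 0")
  case True
  \<comment> \<open>The densities below are normalized by \<open>q x\<close>. If it vanishes, then
    all moments vanish by the Cauchy-Schwarz type bound, and the null measure serves.\<close>
  have "cinner (D ((T ^^ n) x)) x = 0" for n
    using cmod_cinner_D_le[of "(T ^^ n) x" x] True by (simp add: q_Tn)
  then show ?thesis
    by (intro exI[of _ "null_measure circle_borel"]) (auto intro!: finite_measureI)
next
  case False
  define c where "c = q x"
  have c: "c > 0" using False q_nonneg[of x] by (simp add: c_def)
  define g where "g n = cinner (D ((T ^^ n) x)) x" for n
  define w where "w N t = (\<Sum>j<N. cis (- (real j * t)) *\<^sub>C (T ^^ j) x)" for N t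
  define f where "f N t = q (w N t) / (real N * c)" for N t
  have gjk: "cinner (D ((T ^^ (k + n)) x)) ((T ^^ k) x) = g n" for k n
    by (simp add: funpow_add cinner_D_Tn g_def)
  have cc: "cis (- (real j * t)) * cnj (cis (- (real k * t))) = cis (of_int (int k - int j) * t)" for j k t
    by (simp add: cis_cnj cis_mult algebra_simps)
  have qw: "complex_of_real (q (w N t)) =
    (\<Sum>j<N. \<Sum>k<N. cis (of_int (int k - int j) * t) * cinner (D ((T ^^ j) x)) ((T ^^ k) x))" for N t
  proof -
    have "complex_of_real (q (w N t)) =
      (\<Sum>j<N. \<Sum>k<N. cis (- (real j * t)) * cnj (cis (- (real k * t))) * cinner (D ((T ^^ j) x)) ((T ^^ k) x))"
      unfolding cinner_D_self[symmetric] w_def D.sum cinner_sum_left cinner_sum_right D.scaleC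
        cinner_scaleC_left cinner_scaleC_right
      by (subst sum.swap, intro sum.cong refl) (simp add: mult_ac sum_distrib_left)
    then show ?thesis by (simp only: cc)
  qed
  have f_nn: "0 \<le> f N t" for N t unfolding f_def using c q_nonneg by simp
  have f_cont: "continuous_on UNIV (f N)" for N
  proof -
    have "continuous_on UNIV (\<lambda>t. Re (complex_of_real (q (w N t))))"
      unfolding qw cis_conv_exp by (intro continuous_intros)
    then show ?thesis unfolding f_def using c by (cases "N = 0") (auto intro!: continuous_intros)
  qed
  have f_meas[measurable]: "f N \<in> borel_measurable borel" for N
    by (rule borel_measurable_continuous_onI[OF f_cont])
  define \<mu> where "\<mu> N = density angle_measure (\<lambda>t. ennreal (f (Suc N) t))" for N
  \<comment> \<open>By orthogonality only the pairs with \<open>j = k + n\<close> survive, all with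
    the value \<open>g n\<close>. There are \<open>Suc N - n\<close> of them; the truncated
    subtraction covers \<open>n > N\<close>.\<close>
  have moment: "(LINT t|angle_measure. f (Suc N) t *\<^sub>R cis (of_int (int n) * t)) =
    complex_of_real (real (Suc N - n) / (real (Suc N) * c)) * g n"
   and moment_int: "integrable angle_measure (\<lambda>t. f (Suc N) t *\<^sub>R cis (of_int (int n) * t))" for N n
  proof -
    define h where "h j k = cinner (D ((T ^^ j) x)) ((T ^^ k) x) / (real (Suc N) * c)" for j k
    have cm: "cis (of_int (int n) * t) * cis (of_int (int k - int j) * t) = cis (of_int (int n + int k - int j) * t)" for j k t
      by (simp add: cis_mult algebra_simps)
    have eq: "f (Suc N) t *\<^sub>R cis (of_int (int n) * t) =
      (\<Sum>j<Suc N. \<Sum>k<Suc N. h j k * cis (of_int (int n + int k - int j) * t))" for t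
    proof -
      have "f (Suc N) t *\<^sub>R cis (of_int (int n) * t) =
        complex_of_real (q (w (Suc N) t)) / (real (Suc N) * c) * cis (of_int (int n) * t)"
        by (simp add: f_def scaleR_conv_of_real)
      also have "\<dots> = (\<Sum>j<Suc N. \<Sum>k<Suc N. cis (of_int (int k - int j) * t) *
          cinner (D ((T ^^ j) x)) ((T ^^ k) x) / (real (Suc N) * c) * cis (of_int (int n) * t))"
        unfolding qw by (simp only: sum_divide_distrib sum_distrib_right)
      also have "\<dots> = (\<Sum>j<Suc N. \<Sum>k<Suc N. h j k * (cis (of_int (int n) * t) * cis (of_int (int k - int j) * t)))"
        by (intro sum.cong refl) (simp add: h_def mult_ac)
      finally show ?thesis by (simp only: cm)
    qed
    show "integrable angle_measure (\<lambda>t. f (Suc N) t *\<^sub>R cis (of_int (int n) * t))"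
      unfolding eq by (intro Bochner_Integration.integrable_sum integrable_mult_right integrable_cis_angle_measure)
    have "(LINT t|angle_measure. f (Suc N) t *\<^sub>R cis (of_int (int n) * t)) =
      (\<Sum>j<Suc N. \<Sum>k<Suc N. h j k * (if int n + int k - int j = 0 then 1 else 0))"
      unfolding eq
      by (subst Bochner_Integration.integral_sum, intro Bochner_Integration.integrable_sum integrable_mult_right integrable_cis_angle_measure,
          intro sum.cong refl, subst Bochner_Integration.integral_sum, intro integrable_mult_right integrable_cis_angle_measure,
          simp only: integral_mult_right_zero integral_cis_angle_measure)
    also have "\<dots> = (\<Sum>k<Suc N. \<Sum>j<Suc N. if j = k + n then h j k else 0)"
      by (subst sum.swap, intro sum.cong refl) auto
    also have "\<dots> = (\<Sum>k<Suc N. if k + n < Suc N then g n / (real (Suc N) * c) else 0)"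
      by (intro sum.cong refl) (simp add: h_def gjk)
    also have "\<dots> = (\<Sum>k<Suc N - n. g n / (real (Suc N) * c))"
      by (rule sum.mono_neutral_cong_right) auto
    also have "\<dots> = of_nat (Suc N - n) * (g n / (real (Suc N) * c))" by simp
    finally show "(LINT t|angle_measure. f (Suc N) t *\<^sub>R cis (of_int (int n) * t)) =
      complex_of_real (real (Suc N - n) / (real (Suc N) * c)) * g n"
      by (simp only: of_real_divide of_real_of_nat_eq of_real_mult times_divide_eq_right times_divide_eq_left)
  qed
  have mu_int: "(LINT t|\<mu> N. cis (of_int (int n) * t)) = complex_of_real (real (Suc N - n) / (real (Suc N) * c)) * g n" for N n
  proof -
    have [measurable]: "(\<lambda>t. cis (real n * t)) \<in> borel_measurable borel"
      unfolding cis_conv_exp by (intro borel_measurable_continuous_onI continuous_intros)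
    show ?thesis unfolding \<mu>_def moment[symmetric] by (subst integral_density) (auto simp: f_nn)
  qed
  have g0: "g 0 = complex_of_real c" by (simp add: g_def c_def cinner_D_self)
  have mu_sets[simp]: "sets (\<mu> N) = sets borel" "space (\<mu> N) = UNIV" for N by (simp_all add: \<mu>_def)
  have mu_prob: "emeasure (\<mu> N) UNIV = 1" for N
  proof -
    have int: "integrable angle_measure (f (Suc N))"
      using integrable_Re[OF moment_int[of N 0]] by simp
    have "complex_of_real (LINT t|angle_measure. f (Suc N) t) = 1"
      using moment[of N 0] g0 c unfolding integral_complex_of_real[symmetric]
      by (simp add: scaleR_conv_of_real)
    then have one: "(LINT t|angle_measure. f (Suc N) t) = 1" using of_real_eq_1_iff by blast
    have "emeasure (\<mu> N) UNIV = (\<integral>\<^sup>+t. ennreal (f (Suc N) t) \<partial>angle_measure)"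
      unfolding \<mu>_def by (subst emeasure_density) auto
    also have "\<dots> = ennreal 1"
      using nn_integral_eq_integral[OF int] f_nn one by simp
    finally show ?thesis by simp
  qed
  have rd: "real_distribution (\<mu> N)" for N
    by (intro real_distribution.intro prob_spaceI real_distribution_axioms.intro) (simp_all add: mu_prob)
  \<comment> \<open>A half-open interval around \<open>{0..2 * pi}\<close>, in the form that
    tightness requires; the same interval serves for all \<open>N\<close>.\<close>
  have supp: "measure (\<mu> N) {-1<..7} = 1" for N
  proof -
    have "AE t in angle_measure. t \<in> {0..2*pi}" unfolding angle_measure_def by (rule AE_uniform_measureI) auto
    then have "AE t in angle_measure. t \<in> {-1<..7}"
      by (rule AE_mp) (use pi_less_4 pi_approx in \<open>auto intro!: AE_I2\<close>)
    then have "AE t in \<mu> N. t \<in> {-1<..7}" unfolding \<mu>_def by (subst AE_density) auto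
    then have "emeasure (\<mu> N) {-1<..7} = emeasure (\<mu> N) UNIV"
      by (intro emeasure_eq_AE) auto
    then show ?thesis by (simp add: measure_def mu_prob)
  qed
  have "tight \<mu>"
    unfolding tight_def
  proof (intro conjI allI impI)
    fix e :: real assume "e > 0"
    then show "\<exists>a b. a < b \<and> (\<forall>n. measure (\<mu> n) {a<..b} > 1 - e)"
      by (intro exI[of _ "-1"] exI[of _ 7]) (simp add: supp)
  qed (rule rd)
  from tight_imp_convergent_subsubsequence[OF this strict_mono_id]
  obtain r M0 where r: "strict_mono r" and M0: "real_distribution M0" "weak_conv_m (\<mu> \<circ> id \<circ> r) M0" by blast
  interpret M0: real_distribution M0 by fact
  have lim0: "(LINT t|M0. cis (of_int (int n) * t)) = g n / c" for n
  proof -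
    have "(\<lambda>i. LINT t|(\<mu> \<circ> id \<circ> r) i. cis (of_int (int n) * t)) \<longlonglongrightarrow> (LINT t|M0. cis (of_int (int n) * t))"
    proof (rule weak_conv_imp_integral_bdd_continuous_conv[OF _ M0, where B=1])
      show "isCont (\<lambda>t. cis (of_int (int n) * t)) t" for t unfolding cis_conv_exp by (intro continuous_intros)
    qed (simp_all add: rd)
    then have 1: "(\<lambda>i. complex_of_real (real (Suc (r i) - n) / (real (Suc (r i)) * c)) * g n) \<longlonglongrightarrow> (LINT t|M0. cis (of_int (int n) * t))"
      by (simp only: mu_int comp_apply id_apply)
    have "(\<lambda>N. (1 - real n * inverse (real (Suc N))) * (1 / c)) \<longlonglongrightarrow> (1 - real n * 0) * (1 / c)"
      by (intro tendsto_mult tendsto_diff tendsto_const LIMSEQ_inverse_real_of_nat)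
    moreover have "\<forall>\<^sub>F N in sequentially.
        (1 - real n * inverse (real (Suc N))) * (1 / c) = real (Suc N - n) / (real (Suc N) * c)"
      using eventually_ge_at_top[of n]
      by eventually_elim (use c in \<open>simp add: field_simps of_nat_diff\<close>)
    ultimately have "(\<lambda>N. real (Suc N - n) / (real (Suc N) * c)) \<longlonglongrightarrow> (1 - real n * 0) * (1 / c)"
      by (rule Lim_transform_eventually)
    then have "(\<lambda>N. real (Suc N - n) / (real (Suc N) * c)) \<longlonglongrightarrow> 1 / c" by simp
    then have "(\<lambda>N. complex_of_real (real (Suc N - n) / (real (Suc N) * c)) * g n) \<longlonglongrightarrow> complex_of_real (1 / c) * g n"
      by (intro tendsto_mult tendsto_of_real tendsto_const)
    from LIMSEQ_unique[OF 1 LIMSEQ_subseq_LIMSEQ[OF this r, unfolded comp_def]]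
    show ?thesis by simp
  qed
  have cis_meas: "cis \<in> measurable M0 circle_borel"
  proof (rule measurable_restrict_space2)
    have "cis \<in> borel_measurable borel" by (intro borel_measurable_continuous_onI continuous_intros)
    then show "cis \<in> borel_measurable M0" by simp
  qed auto
  \<comment> \<open>The weak limit lives on the line of angles. \<open>cis\<close> carries it to the
    circle, and the factor \<open>c\<close> undoes the normalization to total mass 1.\<close>
  define M where "M = density (distr M0 circle_borel cis) (\<lambda>_. ennreal c)"
  have "(LINT \<zeta>|M. \<zeta> ^ n) = g n" for n
  proof -
    have pm: "(\<lambda>\<zeta>. \<zeta> ^ n) \<in> borel_measurable circle_borel" by (intro measurable_restrict_space1) simp
    have "(LINT \<zeta>|M. \<zeta> ^ n) = (LINT \<zeta>|distr M0 circle_borel cis. c *\<^sub>R \<zeta> ^ n)"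
      unfolding M_def using c pm by (subst integral_density) auto
    also have "\<dots> = c *\<^sub>R (LINT t|M0. cis t ^ n)"
      unfolding integral_scaleR_right by (subst integral_distr[OF cis_meas pm]) simp
    also have "\<dots> = g n" using lim0[of n] c by (simp add: Complex.DeMoivre scaleR_conv_of_real)
    finally show ?thesis .
  qed
  moreover have "finite_measure M"
  proof (rule finite_measureI)
    have "emeasure M (space M) = ennreal c * emeasure (distr M0 circle_borel cis) (space M)"
      unfolding M_def space_density by (rule emeasure_density_const[OF sets.top])
    also have "emeasure (distr M0 circle_borel cis) (space M) = 1"
      using prob_space.emeasure_space_1[OF M0.prob_space_distr[OF cis_meas]] by (simp add: M_def)
    finally show "emeasure M (space M) \<noteq> \<infinity>" by simp
  qed
  moreover have "sets M = sets circle_borel" by (simp add: M_def)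
  ultimately show ?thesis unfolding g_def by blast
qed

end

subsection \<open>The operator measure\<close>

lemma space_circle_borel [simp]: "space circle_borel = sphere 0 1"
  by (simp add: space_restrict_space)

lemma measurable_circle_borelI:
  "f \<in> borel_measurable borel \<Longrightarrow> f \<in> borel_measurable circle_borel"
  by (rule measurable_restrict_space1)

text \<open>The functions whose integrals against the measures \<open>M x\<close> form a bounded quadratic form
  in \<open>x\<close> are closed under bounded pointwise limits; this reaches the indicators of Borel sets
  from the monomials.\<close>

locale spectral_family = two_isometry T D for T D :: "'a::chilbert_space \<Rightarrow> 'a" +
  fixes M :: "'a \<Rightarrow> complex measure"
  assumes sets_M [simp, measurable_cong]: "sets (M x) = sets circle_borel"
    and finite_M: "finite_measure (M x)"
    and moment_M: "(LINT \<zeta>|M x. \<zeta> ^ n) = cinner (D ((T ^^ n) x)) x"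
begin

lemma space_M [simp]: "space (M x) = sphere 0 1"
  using sets_eq_imp_space_eq[OF sets_M] by simp

lemma measure_M_space: "measure (M x) (sphere 0 1) = q x"
proof -
  interpret finite_measure "M x" by (rule finite_M)
  have "complex_of_real (measure (M x) (sphere 0 1)) = (LINT \<zeta>|M x. \<zeta> ^ 0)"
    by (simp add: scaleR_conv_of_real)
  also have "\<dots> = complex_of_real (q x)" unfolding moment_M by (simp add: cinner_D_self)
  finally show ?thesis using of_real_eq_iff by blast
qed

definition representable :: "(complex \<Rightarrow> complex) \<Rightarrow> bool" where
  "representable \<phi> \<longleftrightarrow> \<phi> \<in> borel_measurable circle_borel \<and> (\<exists>B. \<forall>\<zeta>\<in>sphere 0 1. cmod (\<phi> \<zeta>) \<le> B) \<and>
    (\<exists>A. bounded_clinear A \<and> (\<forall>x. (LINT \<zeta>|M x. \<phi> \<zeta>) = cinner (A x) x))"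

lemma integrable_M:
  assumes "\<phi> \<in> borel_measurable circle_borel" "\<And>\<zeta>. \<zeta> \<in> sphere 0 1 \<Longrightarrow> norm (\<phi> \<zeta> :: 'b::{banach,second_countable_topology}) \<le> B"
  shows "integrable (M x) \<phi>"
  using assms by (intro finite_measure.integrable_const_bound[OF finite_M, where B=B]) auto

lemma representable_integrable: "representable \<phi> \<Longrightarrow> integrable (M x) \<phi>"
  unfolding representable_def using integrable_M by blast

lemma representable_cong:
  assumes "representable \<phi>" "\<And>\<zeta>. \<zeta> \<in> sphere 0 1 \<Longrightarrow> \<phi> \<zeta> = \<psi> \<zeta>"
  shows "representable \<psi>"
proof -
  have "(LINT \<zeta>|M x. \<psi> \<zeta>) = (LINT \<zeta>|M x. \<phi> \<zeta>)" for x
    by (rule Bochner_Integration.integral_cong) (simp_all add: assms)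
  moreover have "\<psi> \<in> borel_measurable circle_borel \<longleftrightarrow> \<phi> \<in> borel_measurable circle_borel"
    by (rule measurable_cong) (simp add: assms)
  ultimately show ?thesis using assms unfolding representable_def by force
qed

lemma representable_power: "representable (\<lambda>\<zeta>. \<zeta> ^ n)"
  unfolding representable_def
proof (intro conjI exI ballI allI)
  show "(\<lambda>\<zeta>. \<zeta> ^ n) \<in> borel_measurable circle_borel" by (intro measurable_circle_borelI) simp
  show "cmod (\<zeta> ^ n) \<le> 1" if "\<zeta> \<in> sphere 0 1" for \<zeta> using that by (simp add: norm_power)
  show "bounded_clinear (\<lambda>x. D ((T ^^ n) x))"
    by (rule bounded_clinear_compose[OF D bounded_clinear_funpow[OF T]])
qed (rule moment_M)

lemma representable_cnj:
  assumes "representable \<phi>" shows "representable (\<lambda>\<zeta>. cnj (\<phi> \<zeta>))"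
proof -
  obtain A B where A: "bounded_clinear A" "\<And>x. (LINT \<zeta>|M x. \<phi> \<zeta>) = cinner (A x) x"
    and B: "\<And>\<zeta>. \<zeta> \<in> sphere 0 1 \<Longrightarrow> cmod (\<phi> \<zeta>) \<le> B" and m: "\<phi> \<in> borel_measurable circle_borel"
    using assms unfolding representable_def by blast
  show ?thesis unfolding representable_def
  proof (intro conjI exI ballI allI)
    show "(\<lambda>\<zeta>. cnj (\<phi> \<zeta>)) \<in> borel_measurable circle_borel"
      by (rule measurable_compose[OF m]) (intro borel_measurable_continuous_onI continuous_intros)
    show "cmod (cnj (\<phi> \<zeta>)) \<le> B" if "\<zeta> \<in> sphere 0 1" for \<zeta> using B[OF that] by simp
    show "bounded_clinear (cadjoint A)" by (rule bounded_clinear_cadjoint[OF A(1)])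
    show "(LINT \<zeta>|M x. cnj (\<phi> \<zeta>)) = cinner (cadjoint A x) x" for x
      by (simp add: A(2) cinner_cadjoint_left[OF A(1)] cinner_commute[of x "A x"])
  qed
qed

lemma representable_add:
  assumes "representable \<phi>" "representable \<psi>" shows "representable (\<lambda>\<zeta>. \<phi> \<zeta> + \<psi> \<zeta>)"
proof -
  obtain A B where A: "bounded_clinear A" "\<And>x. (LINT \<zeta>|M x. \<phi> \<zeta>) = cinner (A x) x"
    and B: "\<And>\<zeta>. \<zeta> \<in> sphere 0 1 \<Longrightarrow> cmod (\<phi> \<zeta>) \<le> B" and m: "\<phi> \<in> borel_measurable circle_borel"
    using assms(1) unfolding representable_def by blast
  obtain A' B' where A': "bounded_clinear A'" "\<And>x. (LINT \<zeta>|M x. \<psi> \<zeta>) = cinner (A' x) x"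
    and B': "\<And>\<zeta>. \<zeta> \<in> sphere 0 1 \<Longrightarrow> cmod (\<psi> \<zeta>) \<le> B'" and m': "\<psi> \<in> borel_measurable circle_borel"
    using assms(2) unfolding representable_def by blast
  show ?thesis unfolding representable_def
  proof (intro conjI exI ballI allI)
    show "(\<lambda>\<zeta>. \<phi> \<zeta> + \<psi> \<zeta>) \<in> borel_measurable circle_borel" using m m' by (rule borel_measurable_add)
    show "cmod (\<phi> \<zeta> + \<psi> \<zeta>) \<le> B + B'" if "\<zeta> \<in> sphere 0 1" for \<zeta>
      using norm_triangle_mono[OF B[OF that] B'[OF that]] .
    show "bounded_clinear (\<lambda>x. A x + A' x)" by (rule bounded_clinear_add[OF A(1) A'(1)])
    show "(LINT \<zeta>|M x. \<phi> \<zeta> + \<psi> \<zeta>) = cinner (A x + A' x) x" for x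
      by (simp add: representable_integrable[OF assms(1)] representable_integrable[OF assms(2)] A A' cinner_add_left)
  qed
qed

lemma representable_scale:
  assumes "representable \<phi>" shows "representable (\<lambda>\<zeta>. c * \<phi> \<zeta>)"
proof -
  obtain A B where A: "bounded_clinear A" "\<And>x. (LINT \<zeta>|M x. \<phi> \<zeta>) = cinner (A x) x"
    and B: "\<And>\<zeta>. \<zeta> \<in> sphere 0 1 \<Longrightarrow> cmod (\<phi> \<zeta>) \<le> B" and m: "\<phi> \<in> borel_measurable circle_borel"
    using assms unfolding representable_def by blast
  show ?thesis unfolding representable_def
  proof (intro conjI exI ballI allI)
    show "(\<lambda>\<zeta>. c * \<phi> \<zeta>) \<in> borel_measurable circle_borel" using m by (intro borel_measurable_times) auto
    show "cmod (c * \<phi> \<zeta>) \<le> cmod c * B" if "\<zeta> \<in> sphere 0 1" for \<zeta>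
      using B[OF that] by (simp add: norm_mult mult_left_mono)
    show "bounded_clinear (\<lambda>x. c *\<^sub>C A x)" by (rule bounded_clinear_scaleC[OF A(1)])
    show "(LINT \<zeta>|M x. c * \<phi> \<zeta>) = cinner (c *\<^sub>C A x) x" for x
      by (simp add: A cinner_scaleC_left)
  qed
qed

text \<open>Dominated convergence gives the limit of the forms. The total mass \<open>q x\<close> of
  \<open>M x\<close> is at most a multiple of the squared norm of \<open>x\<close>, which supplies
  the bound that \<open>quadratic_form_limit\<close> needs.\<close>

lemma representable_lim:
  assumes "\<And>n. representable (\<phi> n)" and B: "\<And>n \<zeta>. \<zeta> \<in> sphere 0 1 \<Longrightarrow> cmod (\<phi> n \<zeta>) \<le> B"
    and lim: "\<And>\<zeta>. \<zeta> \<in> sphere 0 1 \<Longrightarrow> (\<lambda>n. \<phi> n \<zeta>) \<longlonglongrightarrow> \<psi> \<zeta>"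
  shows "representable \<psi>"
proof -
  have "\<forall>n. \<exists>A. bounded_clinear A \<and> (\<forall>x. (LINT \<zeta>|M x. \<phi> n \<zeta>) = cinner (A x) x)"
    using assms(1) by (simp add: representable_def)
  then obtain A where A: "\<And>n. bounded_clinear (A n)" "\<And>n x. (LINT \<zeta>|M x. \<phi> n \<zeta>) = cinner (A n x) x"
    by metis
  have m: "\<phi> n \<in> borel_measurable circle_borel" for n using assms(1) by (simp add: representable_def)
  have m': "\<psi> \<in> borel_measurable circle_borel"
    by (rule borel_measurable_LIMSEQ_metric[OF m]) (use lim in simp)
  have B': "cmod (\<psi> \<zeta>) \<le> B" if "\<zeta> \<in> sphere 0 1" for \<zeta>
    by (rule tendsto_upperbound[OF tendsto_norm[OF lim[OF that]]]) (simp_all add: B[OF that])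
  have int_lim: "(\<lambda>n. LINT \<zeta>|M x. \<phi> n \<zeta>) \<longlonglongrightarrow> (LINT \<zeta>|M x. \<psi> \<zeta>)" for x
  proof (rule integral_dominated_convergence[where w="\<lambda>_. B"])
    show "integrable (M x) (\<lambda>_. B)" using finite_measure.integrable_const[OF finite_M] .
  qed (use m m' B lim in \<open>auto intro!: AE_I2\<close>)
  obtain K where K: "K > 0" "\<And>x. q x \<le> K * (norm x)\<^sup>2" using q_bound by blast
  have "\<exists>A. bounded_clinear A \<and> (\<forall>x. (LINT \<zeta>|M x. \<psi> \<zeta>) = cinner (A x) x)"
  proof (rule quadratic_form_limit[OF A(1), where C="B * K"])
    show "(\<lambda>n. cinner (A n x) x) \<longlonglongrightarrow> (LINT \<zeta>|M x. \<psi> \<zeta>)" for x using int_lim[of x] unfolding A(2) .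
    have "cmod (\<phi> 0 1) \<le> B" by (rule B) (simp only: mem_sphere dist_0_norm norm_one)
    then have B0: "B \<ge> 0" by (rule order_trans[OF norm_ge_zero])
    show "cmod (LINT \<zeta>|M x. \<psi> \<zeta>) \<le> (B * K) * (norm x)\<^sup>2" for x
    proof -
      interpret finite_measure "M x" by (rule finite_M)
      have "cmod (LINT \<zeta>|M x. \<psi> \<zeta>) \<le> (LINT \<zeta>|M x. B)"
        by (rule Bochner_Integration.integral_norm_bound_integral[OF integrable_M[OF m' B'] integrable_const])
          (simp_all only: space_M B')
      also have "\<dots> = B * q x" by (simp add: measure_M_space)
      also have "\<dots> \<le> B * (K * (norm x)\<^sup>2)" by (intro mult_left_mono K B0)
      finally show ?thesis by simp
    qed
  qed
  moreover have "\<exists>B. \<forall>\<zeta>\<in>sphere 0 1. cmod (\<psi> \<zeta>) \<le> B" using B' by blast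
  ultimately show ?thesis using m' unfolding representable_def by simp
qed

lemma representable_polynomial:
  assumes "real_polynomial_function p"
  shows "representable (\<lambda>\<zeta>. complex_of_real (p \<zeta>))"
proof -
  \<comment> \<open>Quantifying over all factors \<open>\<zeta> ^ j * cnj \<zeta> ^ k\<close> makes
    the class closed under multiplication by \<open>\<zeta>\<close> and \<open>cnj \<zeta>\<close>,
    and so by any real linear function. The induction over polynomials needs such a closure for its
    product case.\<close>
  define R where "R \<phi> \<longleftrightarrow> (\<forall>j k. representable (\<lambda>\<zeta>. \<zeta> ^ j * cnj \<zeta> ^ k * \<phi> \<zeta>))" for \<phi>
  have R_add: "R (\<lambda>\<zeta>. \<phi> \<zeta> + \<psi> \<zeta>)" if "R \<phi>" "R \<psi>" for \<phi> \<psi>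
    using that unfolding R_def by (auto simp: distrib_left intro: representable_add)
  have R_scale: "R (\<lambda>\<zeta>. c * \<phi> \<zeta>)" if "R \<phi>" for c \<phi>
    using that unfolding R_def by (auto simp: mult.left_commute[of _ c] intro: representable_scale)
  have R_id: "R (\<lambda>\<zeta>. \<zeta> * \<phi> \<zeta>)" if "R \<phi>" for \<phi>
    unfolding R_def
  proof (intro allI)
    fix j k
    have "representable (\<lambda>\<zeta>. \<zeta> ^ Suc j * cnj \<zeta> ^ k * \<phi> \<zeta>)" using that unfolding R_def by blast
    then show "representable (\<lambda>\<zeta>. \<zeta> ^ j * cnj \<zeta> ^ k * (\<zeta> * \<phi> \<zeta>))" by (simp add: mult_ac)
  qed
  have R_cnj: "R (\<lambda>\<zeta>. cnj \<zeta> * \<phi> \<zeta>)" if "R \<phi>" for \<phi>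
    unfolding R_def
  proof (intro allI)
    fix j k
    have "representable (\<lambda>\<zeta>. \<zeta> ^ j * cnj \<zeta> ^ Suc k * \<phi> \<zeta>)" using that unfolding R_def by blast
    then show "representable (\<lambda>\<zeta>. \<zeta> ^ j * cnj \<zeta> ^ k * (cnj \<zeta> * \<phi> \<zeta>))" by (simp add: mult_ac)
  qed
  have R_one: "R (\<lambda>\<zeta>. 1)"
    unfolding R_def
  proof (intro allI)
    fix j k :: nat
    have one: "(\<zeta> * cnj \<zeta>) ^ m = 1" if "\<zeta> \<in> sphere 0 1" for \<zeta> m
      using that by (simp add: complex_norm_square[symmetric])
    show "representable (\<lambda>\<zeta>. \<zeta> ^ j * cnj \<zeta> ^ k * 1)"
    proof (cases "k \<le> j")
      case True
      have "\<zeta> ^ j * cnj \<zeta> ^ k = \<zeta> ^ (j - k) * (\<zeta> * cnj \<zeta>) ^ k" for \<zeta>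
        using True by (simp add: power_mult_distrib power_add[symmetric] mult.assoc[symmetric])
      then show ?thesis using one by (intro representable_cong[OF representable_power[of "j - k"]]) simp
    next
      case False
      have "\<zeta> ^ j * cnj \<zeta> ^ k = (\<zeta> * cnj \<zeta>) ^ j * cnj \<zeta> ^ (k - j)" for \<zeta>
        using False by (simp add: power_mult_distrib power_add[symmetric] mult.assoc)
      then show ?thesis using one
        by (intro representable_cong[OF representable_cnj[OF representable_power[of "k - j"]]]) simp
    qed
  qed
  have "R \<phi> \<Longrightarrow> R (\<lambda>\<zeta>. complex_of_real (p \<zeta>) * \<phi> \<zeta>)" for \<phi>
    using assms
  proof (induction arbitrary: \<phi> rule: real_polynomial_function.induct)
    case (linear f)
    interpret f: bounded_linear f by fact
    define a where "a = (complex_of_real (f 1) - \<i> * complex_of_real (f \<i>)) / 2"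
    define b where "b = (complex_of_real (f 1) + \<i> * complex_of_real (f \<i>)) / 2"
    have f_eq: "complex_of_real (f \<zeta>) = a * \<zeta> + b * cnj \<zeta>" for \<zeta>
    proof -
      have "f \<zeta> = f (Re \<zeta> *\<^sub>R 1 + Im \<zeta> *\<^sub>R \<i>)" by (rule arg_cong[of _ _ f]) (simp add: complex_eq_iff)
      also have "\<dots> = Re \<zeta> * f 1 + Im \<zeta> * f \<i>" by (simp only: f.add f.scaleR real_scaleR_def)
      finally show ?thesis by (simp add: a_def b_def complex_eq_iff field_simps)
    qed
    have "R (\<lambda>\<zeta>. a * (\<zeta> * \<phi> \<zeta>) + b * (cnj \<zeta> * \<phi> \<zeta>))"
      by (intro R_add R_scale R_id R_cnj linear)
    then show ?case by (simp add: f_eq distrib_right mult.assoc)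
  next
    case (const c)
    then show ?case by (rule R_scale)
  next
    case (add f g)
    have "R (\<lambda>\<zeta>. complex_of_real (f \<zeta>) * \<phi> \<zeta> + complex_of_real (g \<zeta>) * \<phi> \<zeta>)"
      by (intro R_add add)
    then show ?case by (simp add: distrib_right)
  next
    case (mult f g)
    have "R (\<lambda>\<zeta>. complex_of_real (f \<zeta>) * (complex_of_real (g \<zeta>) * \<phi> \<zeta>))" by (intro mult)
    then show ?case by (simp add: mult.assoc)
  qed
  from this[OF R_one] have "R (\<lambda>\<zeta>. complex_of_real (p \<zeta>))" by simp
  then have "representable (\<lambda>\<zeta>. \<zeta> ^ 0 * cnj \<zeta> ^ 0 * complex_of_real (p \<zeta>))" unfolding R_def by blast
  then show ?thesis by simp
qed

lemma representable_continuous: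
  assumes g: "continuous_on (sphere 0 1) g"
  shows "representable (\<lambda>\<zeta>. complex_of_real (g \<zeta>))"
proof -
  have "\<exists>p. real_polynomial_function p \<and> (\<forall>\<zeta>\<in>sphere 0 1. \<bar>g \<zeta> - p \<zeta>\<bar> < inverse (real (Suc n)))" for n
    by (rule Stone_Weierstrass_real_polynomial_function[OF compact_sphere g, of "inverse (real (Suc n))"]) auto
  then obtain p where p: "\<And>n. real_polynomial_function (p n)"
    and approx: "\<And>n \<zeta>. \<zeta> \<in> sphere 0 1 \<Longrightarrow> \<bar>g \<zeta> - p n \<zeta>\<bar> < inverse (real (Suc n))" by metis
  have "bounded (g ` sphere 0 1)" by (intro compact_imp_bounded compact_continuous_image g compact_sphere)
  then obtain B where B: "\<And>\<zeta>. \<zeta> \<in> sphere 0 1 \<Longrightarrow> \<bar>g \<zeta>\<bar> \<le> B" unfolding bounded_iff real_norm_def by blast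
  show ?thesis
  proof (rule representable_lim[OF representable_polynomial[OF p]])
    show "cmod (complex_of_real (p n \<zeta>)) \<le> B + 1" if "\<zeta> \<in> sphere 0 1" for n \<zeta>
    proof -
      have "inverse (real (Suc n)) \<le> 1" by (simp add: inverse_le_1_iff)
      then show ?thesis using approx[OF that, of n] B[OF that] by simp
    qed
    show "(\<lambda>n. complex_of_real (p n \<zeta>)) \<longlonglongrightarrow> complex_of_real (g \<zeta>)" if "\<zeta> \<in> sphere 0 1" for \<zeta>
    proof (rule tendsto_of_real)
      have "(\<lambda>n. g \<zeta> - p n \<zeta>) \<longlonglongrightarrow> 0"
        by (rule Lim_null_comparison[OF _ LIMSEQ_inverse_real_of_nat])
          (use approx[OF that] in \<open>auto intro!: always_eventually less_imp_le\<close>)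
      from tendsto_diff[OF tendsto_const[of "g \<zeta>"] this] show "(\<lambda>n. p n \<zeta>) \<longlonglongrightarrow> g \<zeta>" by simp
    qed
  qed
qed

text \<open>The indicator of a closed set is the bounded limit of continuous functions of the
  distance to the set. Complements and disjoint unions follow by linearity and bounded limits, and
  the closed sets are an intersection-stable generator.\<close>

lemma representable_indicator:
  assumes "S \<in> sets borel"
  shows "representable (\<lambda>\<zeta>. complex_of_real (indicator S \<zeta>))"
proof -
  have rep0: "representable (\<lambda>\<zeta>. 0)" using representable_scale[OF representable_power, of 0 0] by simp
  have rep1: "representable (\<lambda>\<zeta>. 1)" using representable_power[of 0] by simp
  have "Int_stable (Collect closed :: complex set set)" by (auto simp: Int_stable_def)
  moreover have "Collect closed \<subseteq> Pow (UNIV :: complex set)" by simp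
  moreover have "S \<in> sigma_sets UNIV (Collect closed)" using assms by (simp add: borel_eq_closed)
  ultimately show ?thesis
  proof (induction rule: sigma_sets_induct_disjoint)
    case (basic A)
    show ?case
    proof (cases "A = {}")
      case False
      have cont: "continuous_on (sphere 0 1) (\<lambda>\<zeta>. max 0 (1 - real n * infdist \<zeta> A))" for n
        by (intro continuous_intros)
      show ?thesis
      proof (rule representable_lim[OF representable_continuous[OF cont]])
        show "cmod (complex_of_real (max 0 (1 - real n * infdist \<zeta> A))) \<le> 1" for n \<zeta>
          using infdist_nonneg[of \<zeta> A] by (simp add: max_def)
        show "(\<lambda>n. complex_of_real (max 0 (1 - real n * infdist \<zeta> A))) \<longlonglongrightarrow> complex_of_real (indicator A \<zeta>)" for \<zeta>
        proof (cases "\<zeta> \<in> A")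
          case True
          then show ?thesis by simp
        next
          case f: False
          have "infdist \<zeta> A > 0"
            using basic False f by (metis in_closed_iff_infdist_zero infdist_nonneg less_eq_real_def mem_Collect_eq)
          then obtain N :: nat where N: "real N * infdist \<zeta> A > 1" using reals_Archimedean3 by blast
          have "\<forall>\<^sub>F n in sequentially. 0 = complex_of_real (max 0 (1 - real n * infdist \<zeta> A))"
            using eventually_ge_at_top[of N]
          proof eventually_elim
            case (elim n)
            then have "real N * infdist \<zeta> A \<le> real n * infdist \<zeta> A"
              by (intro mult_right_mono infdist_nonneg) simp
            then show ?case using N by simp
          qed
          then have "(\<lambda>n. complex_of_real (max 0 (1 - real n * infdist \<zeta> A))) \<longlonglongrightarrow> 0"
            by (rule Lim_transform_eventually[OF tendsto_const])
          then show ?thesis using f by simp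
        qed
      qed
    qed (simp add: rep0)
  next
    case empty
    then show ?case by (simp add: rep0)
  next
    case (compl A)
    have "representable (\<lambda>\<zeta>. 1 + (-1) * complex_of_real (indicator A \<zeta>))"
      by (intro representable_add representable_scale rep1 compl)
    then show ?case by (rule representable_cong) (simp add: indicator_def)
  next
    case (union A)
    have fin: "representable (\<lambda>\<zeta>. complex_of_real (indicator (\<Union>i<n. A i) \<zeta>))" for n
    proof (induction n)
      case 0
      then show ?case by (simp add: rep0)
    next
      case (Suc n)
      have "A i \<inter> A n = {}" if "i < n" for i using disjoint_family_onD[OF union(1), of i n] that by simp
      then have "A n \<inter> (\<Union>i<n. A i) = {}" by blast
      then have "complex_of_real (indicator (\<Union>i<Suc n. A i) \<zeta>) =
          complex_of_real (indicator (\<Union>i<n. A i) \<zeta>) + complex_of_real (indicator (A n) \<zeta>)" for \<zeta>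
        by (auto simp: lessThan_Suc indicator_def)
      then show ?case by (simp only:) (intro representable_add Suc union)
    qed
    show ?case
    proof (rule representable_lim[OF fin, where B=1])
      show "(\<lambda>n. complex_of_real (indicator (\<Union>i<n. A i) \<zeta>)) \<longlonglongrightarrow> complex_of_real (indicator (\<Union>i. A i) \<zeta>)" for \<zeta>
      proof (intro tendsto_of_real)
        show "(\<lambda>n. indicator (\<Union>i<n. A i) \<zeta> :: real) \<longlonglongrightarrow> indicator (\<Union>i. A i) \<zeta>"
          using LIMSEQ_indicator_UN[of A \<zeta>] by (simp add: atLeast0LessThan)
      qed
    qed (simp add: indicator_def)
  qed
qed

lemma measure_M_representation:
  assumes "\<sigma> \<in> sets circle_borel"
  shows "\<exists>A. bounded_clinear A \<and> (\<forall>x. complex_of_real (measure (M x) \<sigma>) = cinner (A x) x)"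
proof -
  obtain S where S: "S \<in> sets borel" "\<sigma> = S \<inter> sphere 0 1"
    using assms by (auto simp: sets_restrict_space)
  obtain A where A: "bounded_clinear A" "\<And>x. (LINT \<zeta>|M x. complex_of_real (indicator S \<zeta>)) = cinner (A x) x"
    using representable_indicator[OF S(1)] unfolding representable_def by blast
  have "(LINT \<zeta>|M x. complex_of_real (indicator S \<zeta>)) = complex_of_real (measure (M x) \<sigma>)" for x
  proof -
    have "(LINT \<zeta>|M x. complex_of_real (indicator S \<zeta>)) = complex_of_real (LINT \<zeta>|M x. indicator \<sigma> \<zeta>)"
      unfolding integral_complex_of_real[symmetric]
    proof (rule Bochner_Integration.integral_cong[OF refl])
      show "complex_of_real (indicator S \<zeta>) = complex_of_real (indicator \<sigma> \<zeta>)" if "\<zeta> \<in> space (M x)" for \<zeta>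
        using that unfolding space_M S indicator_def by simp
    qed
    also have "(LINT \<zeta>|M x. indicator \<sigma> \<zeta>) = measure (M x) \<sigma>"
    proof -
      have "\<sigma> \<inter> sphere 0 1 = \<sigma>" using S by blast
      then show ?thesis by simp
    qed
    finally show ?thesis .
  qed
  then show ?thesis using A by metis
qed

end

subsection \<open>Integration against complex measures on the circle\<close>

text \<open>Equality of two differences of measures, written with sums so that it makes sense for
  values in \<open>[0, \<infinity>]\<close> and passes through the induction over measurable
  functions.\<close>

lemma nn_integral_cross_sum_eq:
  assumes sets: "sets B = sets A" "sets C = sets A" "sets D = sets A"
    and eq: "\<And>\<sigma>. \<sigma> \<in> sets A \<Longrightarrow> emeasure A \<sigma> + emeasure B \<sigma> = emeasure C \<sigma> + emeasure D \<sigma>"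
    and g: "g \<in> borel_measurable A"
  shows "(\<integral>\<^sup>+x. g x \<partial>A) + (\<integral>\<^sup>+x. g x \<partial>B) = (\<integral>\<^sup>+x. g x \<partial>C) + (\<integral>\<^sup>+x. g x \<partial>D)"
  using g
proof (induction rule: borel_measurable_induct)
  case (cong f g)
  have "integral\<^sup>N M f = integral\<^sup>N M g" if "sets M = sets A" for M
    using sets_eq_imp_space_eq[OF that] cong(3) by (intro nn_integral_cong) simp
  then show ?case using cong(4) sets by simp
next
  case (set \<sigma>)
  then show ?case using eq sets by simp
next
  case (mult u c)
  have "u \<in> borel_measurable M" if "sets M = sets A" for M
    using mult(2) measurable_cong_sets[OF that refl] by blast
  then have *: "(\<integral>\<^sup>+x. c * u x \<partial>M) = c * integral\<^sup>N M u" if "sets M = sets A" for M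
    using that by (intro nn_integral_cmult)
  show ?case
    unfolding *[OF refl] *[OF sets(1)] *[OF sets(2)] *[OF sets(3)] distrib_left[symmetric] mult.IH ..
next
  case (add u v)
  have m: "u \<in> borel_measurable M" "v \<in> borel_measurable M" if "sets M = sets A" for M
    using add.hyps measurable_cong_sets[OF that refl, of borel] by auto
  have *: "(\<integral>\<^sup>+x. v x + u x \<partial>M) = integral\<^sup>N M v + integral\<^sup>N M u" if "sets M = sets A" for M
    using m[OF that] by (intro nn_integral_add)
  have "integral\<^sup>N A v + integral\<^sup>N A u + (integral\<^sup>N B v + integral\<^sup>N B u) =
      (integral\<^sup>N A v + integral\<^sup>N B v) + (integral\<^sup>N A u + integral\<^sup>N B u)"
    by (simp only: ac_simps)
  also have "\<dots> = (integral\<^sup>N C v + integral\<^sup>N D v) + (integral\<^sup>N C u + integral\<^sup>N D u)"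
    by (simp only: add.IH)
  also have "\<dots> = integral\<^sup>N C v + integral\<^sup>N C u + (integral\<^sup>N D v + integral\<^sup>N D u)"
    by (simp only: ac_simps)
  finally show ?case unfolding *[OF refl] *[OF sets(1)] *[OF sets(2)] *[OF sets(3)] .
next
  case (seq U)
  have m: "U i \<in> borel_measurable M" if "sets M = sets A" for i M
    using seq(1) measurable_cong_sets[OF that refl] by blast
  have sup: "integral\<^sup>N M (SUP i. U i) = (SUP i. integral\<^sup>N M (U i))" if "sets M = sets A" for M
  proof -
    have "integral\<^sup>N M (SUP i. U i) = (\<integral>\<^sup>+x. (SUP i. U i x) \<partial>M)" by (simp add: image_comp SUP_apply[abs_def])
    also have "\<dots> = (SUP i. integral\<^sup>N M (U i))"
      by (rule nn_integral_monotone_convergence_SUP[OF seq(3) m[OF that]])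
    finally show ?thesis .
  qed
  have inc: "incseq (\<lambda>i. integral\<^sup>N M (U i))" for M
    using seq(3) by (auto simp: incseq_def le_fun_def intro!: nn_integral_mono)
  have "(SUP i. integral\<^sup>N A (U i)) + (SUP i. integral\<^sup>N B (U i)) =
      (SUP i. integral\<^sup>N A (U i) + integral\<^sup>N B (U i))"
    by (rule ennreal_SUP_add[symmetric]) (rule inc)+
  also have "\<dots> = (SUP i. integral\<^sup>N C (U i) + integral\<^sup>N D (U i))" by (simp only: seq.IH)
  also have "\<dots> = (SUP i. integral\<^sup>N C (U i)) + (SUP i. integral\<^sup>N D (U i))"
    by (rule ennreal_SUP_add) (rule inc)+
  finally show ?case unfolding sup[OF refl] sup[OF sets(1)] sup[OF sets(2)] sup[OF sets(3)] .
qed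

lemma integral_diff_eq_if_measure_diff_eq:
  assumes sets: "sets B = sets A" "sets C = sets A" "sets D = sets A"
    and fin: "finite_measure A" "finite_measure B" "finite_measure C" "finite_measure D"
    and eq: "\<And>\<sigma>. \<sigma> \<in> sets A \<Longrightarrow> measure A \<sigma> - measure B \<sigma> = measure C \<sigma> - measure D \<sigma>"
    and int: "integrable A g" "integrable B g" "integrable C g" "integrable D g"
    and nn: "\<And>x. x \<in> space A \<Longrightarrow> 0 \<le> (g x :: real)"
  shows "(LINT x|A. g x) - (LINT x|B. g x) = (LINT x|C. g x) - (LINT x|D. g x)"
proof -
  have sp: "space B = space A" "space C = space A" "space D = space A"
    using sets by (auto dest: sets_eq_imp_space_eq)
  have 1: "emeasure A \<sigma> + emeasure D \<sigma> = emeasure C \<sigma> + emeasure B \<sigma>" if "\<sigma> \<in> sets A" for \<sigma>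
    using eq[OF that]
    by (simp add: finite_measure.emeasure_eq_measure[OF fin(1)] finite_measure.emeasure_eq_measure[OF fin(2)]
        finite_measure.emeasure_eq_measure[OF fin(3)] finite_measure.emeasure_eq_measure[OF fin(4)] flip: ennreal_plus)
  have "(\<integral>\<^sup>+x. ennreal (g x) \<partial>A) + (\<integral>\<^sup>+x. ennreal (g x) \<partial>D) = (\<integral>\<^sup>+x. ennreal (g x) \<partial>C) + (\<integral>\<^sup>+x. ennreal (g x) \<partial>B)"
    by (rule nn_integral_cross_sum_eq) (use sets 1 int(1) in \<open>auto dest: borel_measurable_integrable\<close>)
  moreover have nn_int: "(\<integral>\<^sup>+x. ennreal (g x) \<partial>M) = ennreal (LINT x|M. g x)"
    and int_nn: "0 \<le> (LINT x|M. g x)" if "integrable M g" "space M = space A" for M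
    using that nn by (auto intro!: nn_integral_eq_integral integral_nonneg_AE AE_I2)
  ultimately have "ennreal (LINT x|A. g x) + ennreal (LINT x|D. g x) = ennreal (LINT x|C. g x) + ennreal (LINT x|B. g x)"
    by (simp only: nn_int[OF int(1) refl] nn_int[OF int(2) sp(1)] nn_int[OF int(3) sp(2)] nn_int[OF int(4) sp(3)])
  then have "(LINT x|A. g x) + (LINT x|D. g x) = (LINT x|C. g x) + (LINT x|B. g x)"
    using int_nn[OF int(1) refl] int_nn[OF int(2) sp(1)] int_nn[OF int(3) sp(2)] int_nn[OF int(4) sp(3)]
    by (simp add: add_nonneg_nonneg flip: ennreal_plus)
  then show ?thesis by simp
qed

text \<open>The real and imaginary parts of \<open>\<nu>\<close> fix the differences of the measures
  number 0 and 2 and of those number 1 and 3, and these differences fix the integrals. It justifies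
  the definite description in \<open>poisson_integral\<close>, whose kernel is nonnegative.\<close>

lemma has_circle_integral_unique:
  assumes I: "has_circle_integral (\<lambda>\<zeta>. complex_of_real (g \<zeta>)) \<nu> I"
    and J: "has_circle_integral (\<lambda>\<zeta>. complex_of_real (g \<zeta>)) \<nu> J"
    and nn: "\<And>\<zeta>. \<zeta> \<in> sphere 0 1 \<Longrightarrow> 0 \<le> g \<zeta>"
  shows "I = J"
proof -
  have ex4: "(\<Sum>k<4. \<i> ^ k * complex_of_real (a k)) = Complex (a 0 - a 2) (a 1 - a 3)" for a :: "nat \<Rightarrow> real"
    by (simp add: eval_nat_numeral lessThan_Suc complex_eq_iff)
  have *: "\<exists>M. (\<forall>k<4::nat. sets (M k) = sets circle_borel \<and> finite_measure (M k) \<and> integrable (M k) g) \<and>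
      (\<forall>\<sigma>\<in>sets circle_borel. \<nu> \<sigma> = Complex (measure (M 0) \<sigma> - measure (M 2) \<sigma>) (measure (M 1) \<sigma> - measure (M 3) \<sigma>)) \<and>
      I = Complex ((LINT \<zeta>|M 0. g \<zeta>) - (LINT \<zeta>|M 2. g \<zeta>)) ((LINT \<zeta>|M 1. g \<zeta>) - (LINT \<zeta>|M 3. g \<zeta>))"
    if "has_circle_integral (\<lambda>\<zeta>. complex_of_real (g \<zeta>)) \<nu> I" for I
    using that unfolding has_circle_integral_def integral_complex_of_real ex4 complex_of_real_integrable_eq .
  obtain M where M: "\<And>k. k < 4 \<Longrightarrow> sets (M k) = sets circle_borel \<and> finite_measure (M k) \<and> integrable (M k) g"
    "\<And>\<sigma>. \<sigma> \<in> sets circle_borel \<Longrightarrow> \<nu> \<sigma> = Complex (measure (M 0) \<sigma> - measure (M 2) \<sigma>) (measure (M 1) \<sigma> - measure (M 3) \<sigma>)"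
    "I = Complex ((LINT \<zeta>|M 0. g \<zeta>) - (LINT \<zeta>|M 2. g \<zeta>)) ((LINT \<zeta>|M 1. g \<zeta>) - (LINT \<zeta>|M (3::nat). g \<zeta>))"
    using *[OF I] by blast
  obtain N where N: "\<And>k. k < 4 \<Longrightarrow> sets (N k) = sets circle_borel \<and> finite_measure (N k) \<and> integrable (N k) g"
    "\<And>\<sigma>. \<sigma> \<in> sets circle_borel \<Longrightarrow> \<nu> \<sigma> = Complex (measure (N 0) \<sigma> - measure (N 2) \<sigma>) (measure (N 1) \<sigma> - measure (N 3) \<sigma>)"
    "J = Complex ((LINT \<zeta>|N 0. g \<zeta>) - (LINT \<zeta>|N 2. g \<zeta>)) ((LINT \<zeta>|N 1. g \<zeta>) - (LINT \<zeta>|N (3::nat). g \<zeta>))"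
    using *[OF J] by blast
  have sM: "sets (M k) = sets circle_borel" and sN: "sets (N k) = sets circle_borel" if "k < 4" for k
    using M(1)[OF that] N(1)[OF that] by auto
  have sp: "space (M k) = sphere 0 1" if "k < 4" for k
    using sets_eq_imp_space_eq[OF sM[OF that]] by simp
  have eq: "measure (M 0) \<sigma> - measure (M 2) \<sigma> = measure (N 0) \<sigma> - measure (N 2) \<sigma>"
    "measure (M 1) \<sigma> - measure (M 3) \<sigma> = measure (N 1) \<sigma> - measure (N 3) \<sigma>"
    if "\<sigma> \<in> sets circle_borel" for \<sigma>
    using M(2)[OF that] N(2)[OF that] by simp_all
  have "(LINT \<zeta>|M j. g \<zeta>) - (LINT \<zeta>|M k. g \<zeta>) = (LINT \<zeta>|N j. g \<zeta>) - (LINT \<zeta>|N k. g \<zeta>)"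
    if jk: "j < 4" "k < 4" and eq: "\<And>\<sigma>. \<sigma> \<in> sets circle_borel \<Longrightarrow>
      measure (M j) \<sigma> - measure (M k) \<sigma> = measure (N j) \<sigma> - measure (N k) \<sigma>" for j k
  proof (rule integral_diff_eq_if_measure_diff_eq)
    show "measure (M j) \<sigma> - measure (M k) \<sigma> = measure (N j) \<sigma> - measure (N k) \<sigma>" if "\<sigma> \<in> sets (M j)" for \<sigma>
      using that eq unfolding sM[OF jk(1)] by blast
    show "0 \<le> g \<zeta>" if "\<zeta> \<in> space (M j)" for \<zeta> using that nn unfolding sp[OF jk(1)] by blast
  qed (use M(1)[OF jk(1)] M(1)[OF jk(2)] N(1)[OF jk(1)] N(1)[OF jk(2)] in simp_all)
  from this[of 0 2, OF _ _ eq(1)] this[of 1 3, OF _ _ eq(2)]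
  have "(LINT \<zeta>|M 0. g \<zeta>) - (LINT \<zeta>|M 2. g \<zeta>) = (LINT \<zeta>|N 0. g \<zeta>) - (LINT \<zeta>|N 2. g \<zeta>)"
    "(LINT \<zeta>|M 1. g \<zeta>) - (LINT \<zeta>|M 3. g \<zeta>) = (LINT \<zeta>|N 1. g \<zeta>) - (LINT \<zeta>|N 3. g \<zeta>)"
    by simp_all
  then show ?thesis using M(3) N(3) by simp
qed

lemma poisson_kernel_nonneg: "z \<in> ball 0 1 \<Longrightarrow> 0 \<le> poisson_kernel z \<zeta>"
  by (auto simp: poisson_kernel_def abs_square_le_1 intro!: divide_nonneg_nonneg)

lemma continuous_on_poisson_kernel: "z \<in> ball 0 1 \<Longrightarrow> continuous_on (sphere 0 1) (poisson_kernel z)"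
  unfolding poisson_kernel_def by (intro continuous_intros) auto

text \<open>With \<open>w = z * cnj \<zeta>\<close> the kernel is
  \<open>(1 - |w|^2) / |1 - w|^2\<close>, which is 1 plus twice the real part of the geometric
  series \<open>w / (1 - w)\<close>.\<close>

lemma poisson_kernel_sums:
  assumes z: "z \<in> ball 0 1" and \<zeta>: "\<zeta> \<in> sphere 0 1"
  shows "(\<lambda>n. z ^ Suc n * cnj \<zeta> ^ Suc n + cnj z ^ Suc n * \<zeta> ^ Suc n) sums (complex_of_real (poisson_kernel z \<zeta>) - 1)"
proof -
  define w where "w = z * cnj \<zeta>"
  have w: "cmod w < 1" using z \<zeta> by (simp add: w_def norm_mult)
  have "(\<lambda>n. w * w ^ n) sums (w * (1 / (1 - w)))" by (intro sums_mult geometric_sums w)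
  then have 1: "(\<lambda>n. w ^ Suc n) sums (w / (1 - w))" by simp
  have "(\<lambda>n. cnj (w ^ Suc n)) sums cnj (w / (1 - w))" using 1 by (simp only: sums_cnj)
  from sums_add[OF 1 this]
  have "(\<lambda>n. w ^ Suc n + cnj (w ^ Suc n)) sums (w / (1 - w) + cnj (w / (1 - w)))" .
  moreover have "w / (1 - w) + cnj (w / (1 - w)) = complex_of_real (poisson_kernel z \<zeta>) - 1"
  proof -
    have nw: "1 - w \<noteq> 0" using w by auto
    have "cmod (\<zeta> - z) = cmod (1 - w)"
    proof -
      have "\<zeta> * (1 - w) = \<zeta> - z * (\<zeta> * cnj \<zeta>)" by (simp add: w_def algebra_simps)
      also have "\<zeta> * cnj \<zeta> = 1" using \<zeta> by (simp add: complex_norm_square[symmetric])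
      finally have "\<zeta> - z = \<zeta> * (1 - w)" by simp
      then show ?thesis using \<zeta> by (simp add: norm_mult)
    qed
    moreover have "cmod z = cmod w" using \<zeta> by (simp add: w_def norm_mult)
    ultimately have "complex_of_real (poisson_kernel z \<zeta>) = (1 - w * cnj w) / ((1 - w) * cnj (1 - w))"
      unfolding complex_norm_square[symmetric] by (simp add: poisson_kernel_def)
    then show ?thesis using nw by (simp add: divide_simps) (simp add: algebra_simps)
  qed
  ultimately show ?thesis by (simp add: w_def power_mult_distrib mult_ac)
qed

text \<open>Moving the factor 1/4 into the vectors leaves exactly the coefficients
  \<open>\<i> ^ k\<close>, the form in which \<open>has_circle_integral\<close> decomposes a complex
  measure into four positive ones.\<close>

lemma cinner_polarization_half:
  assumes "bounded_clinear A"
  shows "cinner (A x) y = (\<Sum>k<4. \<i> ^ k * cinner (A ((1/2) *\<^sub>C (x + \<i> ^ k *\<^sub>C y))) ((1/2) *\<^sub>C (x + \<i> ^ k *\<^sub>C y)))"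
proof -
  interpret A: bounded_op A by unfold_locales fact
  have "\<i> ^ k / 4 * cinner (A (x + \<i> ^ k *\<^sub>C y)) (x + \<i> ^ k *\<^sub>C y) =
    \<i> ^ k * cinner (A ((1/2) *\<^sub>C (x + \<i> ^ k *\<^sub>C y))) ((1/2) *\<^sub>C (x + \<i> ^ k *\<^sub>C y))" for k
    by (simp only: A.scaleC cinner_scaleC_left cinner_scaleC_right) simp
  then show ?thesis using cinner_polarization[OF assms, of x y] by (simp only:)
qed

text \<open>The constant does not depend on \<open>n\<close> and \<open>m\<close> although the norms
  of the powers of \<open>T\<close> may grow, because \<open>q\<close> is invariant under
  \<open>T\<close>.\<close>

lemma (in two_isometry) cinner_D_bound:
  obtains K where "K > 0" "\<And>x y n m. cmod (cinner (D ((T ^^ n) x)) ((T ^^ m) y)) \<le> K * norm x * norm y"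
proof -
  obtain K where K: "K > 0" "\<And>x. q x \<le> K * (norm x)\<^sup>2" using q_bound by blast
  have unit: "cmod (cinner (D ((T ^^ n) x)) ((T ^^ m) y)) \<le> K" if "norm x = 1" "norm y = 1" for x y n m
    using cmod_cinner_D_le[of "(T ^^ n) x" "(T ^^ m) y"] K(2)[of x] K(2)[of y] that by (simp add: q_Tn)
  have "cmod (cinner (D ((T ^^ n) x)) ((T ^^ m) y)) \<le> K * norm x * norm y" for x y n m
  proof (cases "x = 0 \<or> y = 0")
    case True
    then show ?thesis by (auto simp: Tn.zero D.zero)
  next
    case False
    define x' where "x' = complex_of_real (1 / norm x) *\<^sub>C x"
    define y' where "y' = complex_of_real (1 / norm y) *\<^sub>C y"
    have n: "norm x' = 1" "norm y' = 1" using False by (simp_all add: x'_def y'_def norm_divide)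
    have x: "x = complex_of_real (norm x) *\<^sub>C x'" and y: "y = complex_of_real (norm y) *\<^sub>C y'"
      using False by (simp_all add: x'_def y'_def scaleC_scaleC)
    have "cinner (D ((T ^^ n) x)) ((T ^^ m) y) =
        complex_of_real (norm x) * (complex_of_real (norm y) * cinner (D ((T ^^ n) x')) ((T ^^ m) y'))"
      by (subst x, subst y) (simp only: Tn.scaleC D.scaleC cinner_scaleC_left cinner_scaleC_right complex_cnj_complex_of_real mult.left_commute)
    then have "cmod (cinner (D ((T ^^ n) x)) ((T ^^ m) y)) = norm x * norm y * cmod (cinner (D ((T ^^ n) x')) ((T ^^ m) y'))"
      by (simp add: norm_mult)
    also have "\<dots> \<le> norm x * norm y * K" by (intro mult_left_mono unit n) simp
    finally show ?thesis by (simp add: mult_ac)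
  qed
  then show ?thesis using K(1) that by blast
qed

subsection \<open>The Poisson integral of the operator measure\<close>

context spectral_family
begin

definition poisson_op :: "complex \<Rightarrow> 'a \<Rightarrow> 'a" where
  "poisson_op z = (SOME A. bounded_clinear A \<and>
    (\<forall>x. (LINT \<zeta>|M x. complex_of_real (poisson_kernel z \<zeta>)) = cinner (A x) x))"

lemma
  assumes z: "z \<in> ball 0 1"
  shows bounded_clinear_poisson_op: "bounded_clinear (poisson_op z)"
    and cinner_poisson_op: "cinner (poisson_op z x) x = complex_of_real (LINT \<zeta>|M x. poisson_kernel z \<zeta>)"
    and integrable_poisson_kernel: "integrable (M x) (poisson_kernel z)"
proof -
  have rep: "representable (\<lambda>\<zeta>. complex_of_real (poisson_kernel z \<zeta>))"
    by (rule representable_continuous[OF continuous_on_poisson_kernel[OF z]])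
  then have ex: "\<exists>A. bounded_clinear A \<and> (\<forall>x. (LINT \<zeta>|M x. complex_of_real (poisson_kernel z \<zeta>)) = cinner (A x) x)"
    unfolding representable_def by blast
  from someI_ex[OF this, folded poisson_op_def]
  show "bounded_clinear (poisson_op z)" "cinner (poisson_op z x) x = complex_of_real (LINT \<zeta>|M x. poisson_kernel z \<zeta>)"
    by auto
  show "integrable (M x) (poisson_kernel z)"
    using representable_integrable[OF rep, of x] unfolding complex_of_real_integrable_eq .
qed

lemma cinner_poisson_op_nonneg: "z \<in> ball 0 1 \<Longrightarrow> 0 \<le> Re (cinner (poisson_op z x) x)"
  by (simp add: cinner_poisson_op integral_nonneg_AE poisson_kernel_nonneg)

text \<open>Partial sums of the Poisson kernel integrated term by term: \<open>\<zeta> ^ n\<close>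
  has the polarized moment \<open>cinner (D ((T ^^ n) x)) y\<close>, and
  \<open>cnj \<zeta> ^ n\<close> has \<open>cinner (D x) ((T ^^ n) y)\<close>.\<close>

definition poisson_partial :: "nat \<Rightarrow> complex \<Rightarrow> 'a \<Rightarrow> 'a \<Rightarrow> complex" where
  "poisson_partial N z x y = cinner (D x) y + (\<Sum>n<N. z ^ Suc n * cinner (D x) ((T ^^ Suc n) y) +
    cnj z ^ Suc n * cinner (D ((T ^^ Suc n) x)) y)"

lemma sum_power_Suc_le:
  assumes "0 \<le> r" "r < (1::real)" shows "(\<Sum>n<N. r ^ Suc n) \<le> 1 / (1 - r)"
proof -
  have "(\<Sum>n<N. r ^ Suc n) \<le> (\<Sum>n<N. r ^ n)" using assms by (intro sum_mono) (simp add: mult_left_le_one_le)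
  also have "\<dots> \<le> (\<Sum>n. r ^ n)" using assms by (intro sum_le_suminf summable_geometric) auto
  also have "\<dots> = 1 / (1 - r)" using assms by (simp add: suminf_geometric)
  finally show ?thesis .
qed

text \<open>On the diagonal this is dominated convergence of the kernel series against
  \<open>M x\<close>; polarization carries it to all pairs of vectors.\<close>

lemma poisson_partial_tendsto:
  assumes z: "z \<in> ball 0 1"
  shows "(\<lambda>N. poisson_partial N z x y) \<longlonglongrightarrow> cinner (poisson_op z x) y"
proof -
  define S where "S N \<zeta> = 1 + (\<Sum>n<N. z ^ Suc n * cnj \<zeta> ^ Suc n + cnj z ^ Suc n * \<zeta> ^ Suc n)" for N \<zeta>
  \<comment> \<open>The operator behind \<open>poisson_partial\<close>; it makes the polarization
    identity for operators applicable to the partial sums.\<close>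
  define O' where "O' N x = D x + (\<Sum>n<N. (z ^ Suc n) *\<^sub>C cadjoint (T ^^ Suc n) (D x) + (cnj z ^ Suc n) *\<^sub>C D ((T ^^ Suc n) x))" for N x
  have TS: "bounded_clinear (T ^^ n)" for n by (rule bounded_clinear_funpow[OF T])
  have O': "bounded_clinear (O' N)" for N
    unfolding O'_def[abs_def]
    by (intro bounded_clinear_add[OF D] bounded_clinear_sum bounded_clinear_add bounded_clinear_scaleC
        bounded_clinear_compose[OF D TS] bounded_clinear_compose[OF bounded_clinear_cadjoint[OF TS] D])
  have cO': "cinner (O' N x) y = poisson_partial N z x y" for N x y
    unfolding O'_def poisson_partial_def cinner_add_left cinner_sum_left cinner_scaleC_left cinner_cadjoint_left[OF TS] ..
  have bm: "(\<lambda>\<zeta>. \<zeta> ^ n) \<in> borel_measurable circle_borel" "(\<lambda>\<zeta>. cnj \<zeta> ^ n) \<in> borel_measurable circle_borel" for n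
    by (intro measurable_circle_borelI borel_measurable_continuous_onI continuous_intros)+
  have int: "integrable (M x) (\<lambda>\<zeta>. \<zeta> ^ n)" "integrable (M x) (\<lambda>\<zeta>. cnj \<zeta> ^ n)" for x n
    by (intro integrable_M[OF bm(1), of n 1] integrable_M[OF bm(2), of n 1]; simp add: norm_power)+
  have intS: "integrable (M x) (S N)" for N x
    unfolding S_def by (intro Bochner_Integration.integrable_add Bochner_Integration.integrable_sum integrable_mult_right int
        finite_measure.integrable_const[OF finite_M])
  have cnj_moment: "(LINT \<zeta>|M x. cnj \<zeta> ^ n) = cinner (D x) ((T ^^ n) x)" for x n
  proof -
    have "(LINT \<zeta>|M x. cnj \<zeta> ^ n) = cnj (LINT \<zeta>|M x. \<zeta> ^ n)"
      unfolding complex_cnj_power[symmetric] by (rule Bochner_Integration.integral_cnj)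
    also have "\<dots> = cinner x (D ((T ^^ n) x))" unfolding moment_M by (rule cinner_commute[symmetric])
    finally show ?thesis by (simp add: D_adj)
  qed
  have "(LINT \<zeta>|M x. S N \<zeta>) = poisson_partial N z x x" for N x
  proof -
    have "(LINT \<zeta>|M x. S N \<zeta>) = (LINT \<zeta>|M x. \<zeta> ^ 0) + (\<Sum>n<N. z ^ Suc n * (LINT \<zeta>|M x. cnj \<zeta> ^ Suc n) + cnj z ^ Suc n * (LINT \<zeta>|M x. \<zeta> ^ Suc n))"
      unfolding S_def
      by (subst Bochner_Integration.integral_add,
          (intro Bochner_Integration.integrable_sum Bochner_Integration.integrable_add integrable_mult_right int
            finite_measure.integrable_const[OF finite_M])+,
          subst Bochner_Integration.integral_sum,
          (intro Bochner_Integration.integrable_sum Bochner_Integration.integrable_add integrable_mult_right int)+,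
          subst Bochner_Integration.integral_add,
          (intro integrable_mult_right int)+,
          simp only: integral_mult_right_zero power_0)
    then show ?thesis unfolding moment_M cnj_moment by (simp add: poisson_partial_def)
  qed
  moreover have "(\<lambda>N. LINT \<zeta>|M x. S N \<zeta>) \<longlonglongrightarrow> (LINT \<zeta>|M x. complex_of_real (poisson_kernel z \<zeta>))" for x
  proof (rule integral_dominated_convergence[where w="\<lambda>_. 1 + 2 * (1 / (1 - cmod z))"])
    show "AE \<zeta> in M x. (\<lambda>N. S N \<zeta>) \<longlonglongrightarrow> complex_of_real (poisson_kernel z \<zeta>)"
    proof (rule AE_I2)
      fix \<zeta> assume "\<zeta> \<in> space (M x)"
      then have "(\<lambda>N. S N \<zeta>) \<longlonglongrightarrow> 1 + (complex_of_real (poisson_kernel z \<zeta>) - 1)"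
        unfolding S_def by (intro tendsto_add tendsto_const poisson_kernel_sums[OF z, unfolded sums_def]) simp
      then show "(\<lambda>N. S N \<zeta>) \<longlonglongrightarrow> complex_of_real (poisson_kernel z \<zeta>)" by simp
    qed
    show "AE \<zeta> in M x. norm (S N \<zeta>) \<le> 1 + 2 * (1 / (1 - cmod z))" for N
    proof (rule AE_I2)
      fix \<zeta> assume "\<zeta> \<in> space (M x)"
      then have \<zeta>: "cmod \<zeta> = 1" by simp
      have "cmod (\<Sum>n<N. z ^ Suc n * cnj \<zeta> ^ Suc n + cnj z ^ Suc n * \<zeta> ^ Suc n) \<le> (\<Sum>n<N. 2 * cmod z ^ Suc n)"
      proof (rule sum_norm_le)
        fix n
        show "cmod (z ^ Suc n * cnj \<zeta> ^ Suc n + cnj z ^ Suc n * \<zeta> ^ Suc n) \<le> 2 * cmod z ^ Suc n"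
          using norm_triangle_ineq[of "z ^ Suc n * cnj \<zeta> ^ Suc n" "cnj z ^ Suc n * \<zeta> ^ Suc n"]
          by (simp only: norm_mult norm_power complex_mod_cnj \<zeta>) simp
      qed
      also have "\<dots> = 2 * (\<Sum>n<N. cmod z ^ Suc n)" by (simp only: sum_distrib_left)
      also have "\<dots> \<le> 2 * (1 / (1 - cmod z))" by (intro mult_left_mono sum_power_Suc_le) (use z in auto)
      finally have *: "cmod (\<Sum>n<N. z ^ Suc n * cnj \<zeta> ^ Suc n + cnj z ^ Suc n * \<zeta> ^ Suc n) \<le> 2 * (1 / (1 - cmod z))" .
      have "cmod (S N \<zeta>) \<le> cmod 1 + cmod (\<Sum>n<N. z ^ Suc n * cnj \<zeta> ^ Suc n + cnj z ^ Suc n * \<zeta> ^ Suc n)"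
        unfolding S_def by (rule norm_triangle_ineq)
      then show "cmod (S N \<zeta>) \<le> 1 + 2 * (1 / (1 - cmod z))" using * by (simp only: norm_one)
    qed
    show "integrable (M x) (\<lambda>_. 1 + 2 * (1 / (1 - cmod z)))" by (rule finite_measure.integrable_const[OF finite_M])
    show "S N \<in> borel_measurable (M x)" for N by (rule borel_measurable_integrable[OF intS])
    show "(\<lambda>\<zeta>. complex_of_real (poisson_kernel z \<zeta>)) \<in> borel_measurable (M x)"
      using borel_measurable_integrable[OF integrable_poisson_kernel[OF z]] by simp
  qed
  ultimately have diag: "(\<lambda>N. poisson_partial N z x x) \<longlonglongrightarrow> cinner (poisson_op z x) x" for x
    using cinner_poisson_op[OF z] by simp
  have "(\<lambda>N. \<Sum>k<4. \<i> ^ k / 4 * poisson_partial N z (x + \<i> ^ k *\<^sub>C y) (x + \<i> ^ k *\<^sub>C y)) \<longlonglongrightarrow>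
    (\<Sum>k<4. \<i> ^ k / 4 * cinner (poisson_op z (x + \<i> ^ k *\<^sub>C y)) (x + \<i> ^ k *\<^sub>C y))"
    by (intro tendsto_sum tendsto_mult tendsto_const diag)
  moreover have "(\<Sum>k<4. \<i> ^ k / 4 * poisson_partial N z (x + \<i> ^ k *\<^sub>C y) (x + \<i> ^ k *\<^sub>C y)) = poisson_partial N z x y" for N
    using cinner_polarization[OF O'[of N], of x y] unfolding cO' by (rule sym)
  ultimately show ?thesis
    using cinner_polarization[OF bounded_clinear_poisson_op[OF z], of x y] by (simp only:)
qed

text \<open>Uniformity over the closed disc of radius \<open>R\<close> provides integrable constants
  for dominated convergence in the area integrals.\<close>

lemma poisson_op_bound:
  assumes "R < 1" "0 \<le> R"
  obtains C where "C > 0"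
    "\<And>N z x y. cmod z \<le> R \<Longrightarrow> cmod (poisson_partial N z x y) \<le> C * norm x * norm y"
    "\<And>z x y. cmod z \<le> R \<Longrightarrow> cmod (cinner (poisson_op z x) y) \<le> C * norm x * norm y"
proof -
  obtain K where K: "K > 0" and KD: "\<And>x y n m. cmod (cinner (D ((T ^^ n) x)) ((T ^^ m) y)) \<le> K * norm x * norm y"
    using cinner_D_bound by blast
  define C where "C = K * (1 + 2 * (1 / (1 - R)))"
  have C: "C > 0" unfolding C_def using K assms by (intro mult_pos_pos add_pos_nonneg) auto
  have part: "cmod (poisson_partial N z x y) \<le> C * norm x * norm y" if z: "cmod z \<le> R" for N z x y
  proof -
    have "cmod (\<Sum>n<N. z ^ Suc n * cinner (D x) ((T ^^ Suc n) y) + cnj z ^ Suc n * cinner (D ((T ^^ Suc n) x)) y)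
      \<le> (\<Sum>n<N. 2 * (R ^ Suc n * (K * norm x * norm y)))"
    proof (rule sum_norm_le)
      fix n
      have zn: "cmod z ^ Suc n \<le> R ^ Suc n" using z by (intro power_mono) auto
      have "cmod (z ^ Suc n * cinner (D x) ((T ^^ Suc n) y)) \<le> R ^ Suc n * (K * norm x * norm y)"
        unfolding norm_mult norm_power using KD[of 0 x "Suc n" y] zn assms by (intro mult_mono) auto
      moreover have "cmod (cnj z ^ Suc n * cinner (D ((T ^^ Suc n) x)) y) \<le> R ^ Suc n * (K * norm x * norm y)"
        unfolding norm_mult norm_power complex_mod_cnj using KD[of "Suc n" x 0 y] zn assms by (intro mult_mono) auto
      ultimately show "cmod (z ^ Suc n * cinner (D x) ((T ^^ Suc n) y) + cnj z ^ Suc n * cinner (D ((T ^^ Suc n) x)) y)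
          \<le> 2 * (R ^ Suc n * (K * norm x * norm y))"
        using norm_triangle_ineq[of "z ^ Suc n * cinner (D x) ((T ^^ Suc n) y)" "cnj z ^ Suc n * cinner (D ((T ^^ Suc n) x)) y"]
        by linarith
    qed
    also have "\<dots> = 2 * (K * norm x * norm y) * (\<Sum>n<N. R ^ Suc n)" by (simp add: sum_distrib_left mult_ac)
    also have "\<dots> \<le> 2 * (K * norm x * norm y) * (1 / (1 - R))"
      using K assms by (intro mult_left_mono sum_power_Suc_le) auto
    finally have "cmod (poisson_partial N z x y) \<le> K * norm x * norm y + 2 * (K * norm x * norm y) * (1 / (1 - R))"
      unfolding poisson_partial_def using KD[of 0 x 0 y]
        norm_triangle_ineq[of "cinner (D x) y" "\<Sum>n<N. z ^ Suc n * cinner (D x) ((T ^^ Suc n) y) + cnj z ^ Suc n * cinner (D ((T ^^ Suc n) x)) y"]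
      by (simp only: funpow_0)
    then show ?thesis by (simp add: C_def algebra_simps)
  qed
  moreover have "cmod (cinner (poisson_op z x) y) \<le> C * norm x * norm y" if z: "cmod z \<le> R" for z x y
    by (rule tendsto_upperbound[OF tendsto_norm[OF poisson_partial_tendsto]]) (use z assms part in auto)
  ultimately show ?thesis using C that by blast
qed

end

text \<open>\<open>pr\<close> is the orthogonal projection onto \<open>E\<close>. Compression makes
  the values of the measure act on \<open>E\<close> without changing their forms on
  \<open>E\<close>.\<close>

locale compressed_spectral_family = spectral_family T D M for T D :: "'a::chilbert_space \<Rightarrow> 'a" and M +
  fixes E :: "'a set" and pr :: "'a \<Rightarrow> 'a"
  assumes E: "hilbert_subspace E" and pr: "bounded_clinear pr" and pr_in: "pr x \<in> E"
    and pr_id: "x \<in> E \<Longrightarrow> pr x = x" and pr_adj: "cinner (pr x) y = cinner x (pr y)"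
begin

definition spectral_op :: "complex set \<Rightarrow> 'a \<Rightarrow> 'a" where
  "spectral_op \<sigma> = (SOME A. bounded_clinear A \<and> (\<forall>x. complex_of_real (measure (M x) \<sigma>) = cinner (A x) x))"

definition op_measure :: "complex set \<Rightarrow> 'a \<Rightarrow> 'a" where
  "op_measure \<sigma> x = pr (spectral_op \<sigma> x)"

lemma spectral_op:
  assumes "\<sigma> \<in> sets circle_borel"
  shows "bounded_clinear (spectral_op \<sigma>)" "cinner (spectral_op \<sigma> x) x = complex_of_real (measure (M x) \<sigma>)"
  using someI_ex[OF measure_M_representation[OF assms], folded spectral_op_def] by auto

lemma cinner_op_measure:
  assumes "\<sigma> \<in> sets circle_borel" "y \<in> E"
  shows "cinner (op_measure \<sigma> x) y =
    (\<Sum>k<4. \<i> ^ k * complex_of_real (measure (M ((1/2) *\<^sub>C (x + \<i> ^ k *\<^sub>C y))) \<sigma>))"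
proof -
  have "cinner (op_measure \<sigma> x) y = cinner (spectral_op \<sigma> x) y"
    by (simp add: op_measure_def pr_adj pr_id assms(2))
  also have "\<dots> = (\<Sum>k<4. \<i> ^ k * complex_of_real (measure (M ((1/2) *\<^sub>C (x + \<i> ^ k *\<^sub>C y))) \<sigma>))"
    unfolding spectral_op(2)[OF assms(1), symmetric] by (rule cinner_polarization_half[OF spectral_op(1)[OF assms(1)]])
  finally show ?thesis .
qed

lemma positive_operator_measure: "positive_operator_measure E op_measure"
  unfolding positive_operator_measure_def
proof (intro conjI ballI)
  fix \<sigma> assume \<sigma>: "\<sigma> \<in> sets circle_borel"
  interpret bounded_op "op_measure \<sigma>"
    unfolding bounded_op_def op_measure_def[abs_def]
    by (rule bounded_clinear_compose[OF pr spectral_op(1)[OF \<sigma>]])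
  obtain K where K: "\<And>x. norm (op_measure \<sigma> x) \<le> K * norm x" using bound by blast
  have "cinner (op_measure \<sigma> x) x \<in> \<real>\<^sub>\<ge>\<^sub>0" if "x \<in> E" for x
    using that by (simp add: op_measure_def pr_adj pr_id spectral_op(2)[OF \<sigma>])
  moreover have "op_measure \<sigma> x \<in> E" for x by (simp add: op_measure_def pr_in)
  ultimately show "positive_operator_on E (op_measure \<sigma>)"
    unfolding positive_operator_on_def using K by (auto simp: add scaleC)
next
  fix x y assume y: "y \<in> E"
  define v where "v k = (1/2) *\<^sub>C (x + \<i> ^ k *\<^sub>C y)" for k
  note rep = cinner_op_measure[OF _ y, of _ x, folded v_def]
  show "complex_circle_measure (\<lambda>\<sigma>. cinner (op_measure \<sigma> x) y)"
    unfolding complex_circle_measure_def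
  proof (intro conjI allI impI)
    show "cinner (op_measure {} x) y = 0" by (subst rep) simp_all
    fix A :: "nat \<Rightarrow> complex set" assume A: "range A \<subseteq> sets circle_borel" "disjoint_family A"
    have An: "A n \<in> sets circle_borel" "(\<Union>n. A n) \<in> sets circle_borel" for n using A(1) by auto
    have "(\<lambda>n. measure (M w) (A n)) sums measure (M w) (\<Union>n. A n)" for w
      using finite_measure.finite_measure_UNION[OF finite_M, of A w] A by simp
    then have "(\<lambda>n. \<Sum>k<4. \<i> ^ k * complex_of_real (measure (M (v k)) (A n))) sums
      (\<Sum>k<4. \<i> ^ k * complex_of_real (measure (M (v k)) (\<Union>n. A n)))"
      by (intro sums_sum sums_mult sums_of_real)
    then show "(\<lambda>n. cinner (op_measure (A n) x) y) sums cinner (op_measure (\<Union>n. A n) x) y"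
      by (simp only: rep An)
  qed
qed

text \<open>The vector on the right satisfies the weak definition by polarization. Any other
  solution in \<open>E\<close> has the same inner products with \<open>E\<close>, and so with all
  vectors, since both are fixed by \<open>pr\<close>.\<close>

lemma poisson_integral_eq:
  assumes z: "z \<in> ball 0 1" and x: "x \<in> E"
  shows "poisson_integral E op_measure z x = pr (poisson_op z x)"
  unfolding poisson_integral_def
proof (rule the_equality)
  have has: "has_circle_integral (\<lambda>\<zeta>. complex_of_real (poisson_kernel z \<zeta>)) (\<lambda>\<sigma>. cinner (op_measure \<sigma> x) y)
      (cinner (pr (poisson_op z x)) y)" if y: "y \<in> E" for y
    unfolding has_circle_integral_def
  proof (intro exI conjI allI impI ballI)
    fix k :: nat
    show "sets (M ((1/2) *\<^sub>C (x + \<i> ^ k *\<^sub>C y))) = sets circle_borel" by (rule sets_M)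
    show "finite_measure (M ((1/2) *\<^sub>C (x + \<i> ^ k *\<^sub>C y)))" by (rule finite_M)
    show "integrable (M ((1/2) *\<^sub>C (x + \<i> ^ k *\<^sub>C y))) (\<lambda>\<zeta>. complex_of_real (poisson_kernel z \<zeta>))"
      using integrable_poisson_kernel[OF z] by simp
  next
    fix \<sigma> assume "\<sigma> \<in> sets circle_borel"
    then show "cinner (op_measure \<sigma> x) y =
      (\<Sum>k<4. \<i> ^ k * complex_of_real (measure (M ((1/2) *\<^sub>C (x + \<i> ^ k *\<^sub>C y))) \<sigma>))"
      by (rule cinner_op_measure[OF _ y])
  next
    have "cinner (pr (poisson_op z x)) y = cinner (poisson_op z x) y" by (simp add: pr_adj pr_id y)
    also have "\<dots> = (\<Sum>k<4. \<i> ^ k * (LINT \<zeta>|M ((1/2) *\<^sub>C (x + \<i> ^ k *\<^sub>C y)). complex_of_real (poisson_kernel z \<zeta>)))"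
      unfolding integral_complex_of_real cinner_poisson_op[OF z, symmetric]
      by (rule cinner_polarization_half[OF bounded_clinear_poisson_op[OF z]])
    finally show "cinner (pr (poisson_op z x)) y =
      (\<Sum>k<4. \<i> ^ k * (LINT \<zeta>|M ((1/2) *\<^sub>C (x + \<i> ^ k *\<^sub>C y)). complex_of_real (poisson_kernel z \<zeta>)))" .
  qed
  then show "pr (poisson_op z x) \<in> E \<and> (\<forall>y\<in>E. has_circle_integral (\<lambda>\<zeta>. complex_of_real (poisson_kernel z \<zeta>))
      (\<lambda>\<sigma>. cinner (op_measure \<sigma> x) y) (cinner (pr (poisson_op z x)) y))"
    using pr_in by blast
  fix u assume u: "u \<in> E \<and> (\<forall>y\<in>E. has_circle_integral (\<lambda>\<zeta>. complex_of_real (poisson_kernel z \<zeta>))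
      (\<lambda>\<sigma>. cinner (op_measure \<sigma> x) y) (cinner u y))"
  have eq: "cinner u y = cinner (pr (poisson_op z x)) y" if "y \<in> E" for y
    using u that by (intro has_circle_integral_unique[OF _ has[OF that]] poisson_kernel_nonneg[OF z]) auto
  show "u = pr (poisson_op z x)"
  proof (rule cinner_eqI)
    fix y
    have "cinner u y = cinner u (pr y)" using u pr_id pr_adj by metis
    also have "\<dots> = cinner (pr (poisson_op z x)) (pr y)" by (rule eq[OF pr_in])
    also have "\<dots> = cinner (pr (poisson_op z x)) y" by (metis pr_adj pr_id pr_in)
    finally show "cinner u y = cinner (pr (poisson_op z x)) y" .
  qed
qed

lemma cinner_poisson_integral:
  assumes "z \<in> ball 0 1" "x \<in> E"
  shows "cinner (poisson_integral E op_measure z x) x = cinner (poisson_op z x) x"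
  using assms by (simp add: poisson_integral_eq pr_adj pr_id)

end

subsection \<open>The Dirichlet integral in one variable\<close>

text \<open>Half of the decay goes to each factor: \<open>r ^ n\<close> is the square of
  \<open>sqrt r ^ n\<close>, and one copy bounds the linear growth.\<close>

lemma summable_Suc_power:
  assumes "0 \<le> r" "r < (1::real)" shows "summable (\<lambda>n. real (Suc n) * r ^ n)"
proof -
  have "summable (\<lambda>n. sqrt r ^ n * (real (Suc n) * sqrt r ^ n))"
    using assms by (intro summable_abel_weighted summable_geometric) auto
  moreover have "sqrt r ^ n * (real (Suc n) * sqrt r ^ n) = real (Suc n) * r ^ n" for n
    using assms by (simp add: power_mult_distrib[symmetric])
  ultimately show ?thesis by (simp only:)
qed

text \<open>The cube is the growth bound for \<open>poly_energy\<close>: a square of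
  \<open>Suc N\<close> times \<open>Suc N\<close> terms, each with a factor \<open>min j k\<close>
  of size at most \<open>N\<close>.\<close>

lemma cube_power_tendsto_0:
  assumes "0 < r" "r < (1::real)" shows "(\<lambda>n. real (Suc n) ^ 3 * r ^ n) \<longlonglongrightarrow> 0"
proof -
  define s where "s = root 3 r"
  have s: "0 \<le> s" "s < 1" "s ^ 3 = r" using assms by (simp_all add: s_def)
  have "(\<lambda>n. (real (Suc n) * s ^ n) ^ 3) \<longlonglongrightarrow> 0 ^ 3"
    by (intro tendsto_power summable_LIMSEQ_zero summable_Suc_power s)
  moreover have "(real (Suc n) * s ^ n) ^ 3 = real (Suc n) ^ 3 * r ^ n" for n
  proof -
    have "(s ^ n) ^ 3 = (s ^ 3) ^ n" by (simp only: power_mult[symmetric] mult.commute)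
    then show ?thesis by (simp only: power_mult_distrib s)
  qed
  ultimately show ?thesis by (simp only: power_zero_numeral)
qed

definition deriv_partial :: "nat \<Rightarrow> (nat \<Rightarrow> 'a::complex_inner) \<Rightarrow> complex \<Rightarrow> 'a" where
  "deriv_partial N a z = (\<Sum>k<N. (of_nat (Suc k) * z ^ k) *\<^sub>C a (Suc k))"

definition deriv_series :: "(nat \<Rightarrow> 'a::chilbert_space) \<Rightarrow> complex \<Rightarrow> 'a" where
  "deriv_series a z = (\<Sum>k. (of_nat (Suc k) * z ^ k) *\<^sub>C a (Suc k))"

lemma
  fixes a :: "nat \<Rightarrow> 'a::chilbert_space"
  assumes a: "\<And>k. norm (a k) \<le> B" and z: "cmod z < 1"
  shows summable_norm_deriv_series: "summable (\<lambda>k. norm ((of_nat (Suc k) * z ^ k) *\<^sub>C a (Suc k)))"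
    and deriv_partial_tendsto: "(\<lambda>N. deriv_partial N a z) \<longlonglongrightarrow> deriv_series a z"
proof -
  show s: "summable (\<lambda>k. norm ((of_nat (Suc k) * z ^ k) *\<^sub>C a (Suc k)))"
  proof (rule summable_comparison_test'[where N=0])
    show "summable (\<lambda>k. (real (Suc k) * cmod z ^ k) * B)"
      using z by (intro summable_mult2 summable_Suc_power) auto
    show "norm (norm ((of_nat (Suc k) * z ^ k) *\<^sub>C a (Suc k))) \<le> (real (Suc k) * cmod z ^ k) * B" for k
      unfolding norm_scaleC norm_mult norm_power norm_of_nat real_norm_def abs_mult abs_norm_cancel power_abs
      using a[of "Suc k"] by (intro mult_mono) auto
  qed
  show "(\<lambda>N. deriv_partial N a z) \<longlonglongrightarrow> deriv_series a z"
    unfolding deriv_partial_def deriv_series_def by (rule summable_LIMSEQ[OF summable_norm_cancel[OF s]])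
qed

lemma norm_deriv_partial_le:
  fixes a :: "nat \<Rightarrow> 'a::complex_inner"
  assumes a: "\<And>k. norm (a k) \<le> B" and z: "cmod z \<le> R" "R < 1"
  shows "norm (deriv_partial N a z) \<le> (\<Sum>k. real (Suc k) * R ^ k) * B"
proof -
  have R: "0 \<le> R" using z(1) norm_ge_zero order_trans by blast
  have B: "0 \<le> B" using a norm_ge_zero order_trans by blast
  have "norm (deriv_partial N a z) \<le> (\<Sum>k<N. (real (Suc k) * R ^ k) * B)"
    unfolding deriv_partial_def
  proof (rule sum_norm_le)
    fix k
    show "norm ((of_nat (Suc k) * z ^ k) *\<^sub>C a (Suc k)) \<le> (real (Suc k) * R ^ k) * B"
      unfolding norm_scaleC norm_mult norm_power norm_of_nat
      using a[of "Suc k"] z R by (intro mult_mono power_mono) auto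
  qed
  also have "\<dots> = (\<Sum>k<N. real (Suc k) * R ^ k) * B" by (simp only: sum_distrib_right)
  also have "\<dots> \<le> (\<Sum>k. real (Suc k) * R ^ k) * B"
    using R z B by (intro mult_right_mono sum_le_suminf summable_Suc_power) auto
  finally show ?thesis .
qed

text \<open>Summation by parts over squares: the pairs with \<open>max j k = n\<close> make up the
  difference of consecutive square sums. It converts the weights from the disc integral into an Abel
  mean.\<close>

lemma abel_summation_square:
  fixes g :: "nat \<Rightarrow> nat \<Rightarrow> complex"
  shows "(\<Sum>j\<le>N. \<Sum>k\<le>N. of_real r ^ max j k * g j k) =
    (1 - of_real r) * (\<Sum>n<N. of_real r ^ n * (\<Sum>j\<le>n. \<Sum>k\<le>n. g j k)) + of_real r ^ N * (\<Sum>j\<le>N. \<Sum>k\<le>N. g j k)"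
proof (induction N)
  case (Suc N)
  have split: "(\<Sum>j\<le>Suc N. \<Sum>k\<le>Suc N. f j k) =
    (\<Sum>j\<le>N. \<Sum>k\<le>N. f j k) + ((\<Sum>j\<le>N. f j (Suc N)) + (\<Sum>k\<le>Suc N. f (Suc N) k))" for f :: "nat \<Rightarrow> nat \<Rightarrow> complex"
    by (simp add: sum.distrib)
  have 1: "(\<Sum>j\<le>N. of_real r ^ max j (Suc N) * g j (Suc N)) = of_real r ^ Suc N * (\<Sum>j\<le>N. g j (Suc N))"
    unfolding sum_distrib_left by (rule sum.cong) (auto simp: max_def)
  have 2: "(\<Sum>k\<le>Suc N. of_real r ^ max (Suc N) k * g (Suc N) k) = of_real r ^ Suc N * (\<Sum>k\<le>Suc N. g (Suc N) k)"
    unfolding sum_distrib_left by (rule sum.cong) (auto simp: max_def)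
  show ?case unfolding split[of "\<lambda>j k. of_real r ^ max j k * g j k"] split[of g] 1 2 Suc.IH
    by (simp add: algebra_simps del: sum.atMost_Suc)
qed simp

lemma finite_measure_area_measure: "finite_measure area_measure"
  unfolding area_measure_def
  by (intro prob_space.finite_measure prob_space_uniform_measure) (simp_all add: emeasure_ball_complex)

lemma AE_area_measure: "AE z in area_measure. z \<in> ball 0 1"
  unfolding area_measure_def by (rule AE_uniform_measureI) auto

locale pure_spectral_family = pure_two_isometry T D L + spectral_family T D M
  for T D L :: "'a::chilbert_space \<Rightarrow> 'a" and M
begin

text \<open>In the expansion of the Poisson integral, only the one term whose powers of
  \<open>z\<close> and \<open>cnj z\<close> balance both exponents at \<open>max j k\<close>
  survives integration. Invariance of the form under \<open>T\<close> turns its moment into the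
  symmetric expression with \<open>T ^^ j\<close> and \<open>T ^^ k\<close>.\<close>

lemma disc_integral_monomial:
  assumes R: "0 < R" "R < 1"
  shows "integrable area_measure (\<lambda>z. indicator (ball 0 R) z *\<^sub>R (z ^ j * cnj z ^ k * cinner (poisson_op z x) y))"
    and "(LINT z|area_measure. indicator (ball 0 R) z *\<^sub>R (z ^ j * cnj z ^ k * cinner (poisson_op z x) y)) =
      complex_of_real (R ^ (2 * max j k + 2) / (max j k + 1)) * cinner (D ((T ^^ j) x)) ((T ^^ k) y)"
proof -
  define m where "m a b = (if a = b then complex_of_real (R ^ (2 * a + 2) / (a + 1)) else 0)" for a b :: nat
  define e where "e a b z = indicator (ball 0 R) z *\<^sub>R (z ^ a * cnj z ^ b)" for a b and z :: complex
  have e_int: "integrable area_measure (e a b)" and e_m: "(LINT z|area_measure. e a b z) = m a b" for a b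
    unfolding e_def[abs_def] m_def using disc_moment[of R] R by auto
  define F where "F N z = indicator (ball 0 R) z *\<^sub>R (z ^ j * cnj z ^ k * poisson_partial N z x y)" for N z
  define G where "G z = indicator (ball 0 R) z *\<^sub>R (z ^ j * cnj z ^ k * cinner (poisson_op z x) y)" for z
  have F_eq: "F N z = e j k z * cinner (D x) y + (\<Sum>n<N. e (j + Suc n) k z * cinner (D x) ((T ^^ Suc n) y) +
      e j (k + Suc n) z * cinner (D ((T ^^ Suc n) x)) y)" for N z
    unfolding F_def e_def poisson_partial_def
    by (cases "z \<in> ball 0 R") (simp_all add: algebra_simps sum_distrib_left power_add)
  have F_int: "integrable area_measure (F N)" for N
    unfolding F_eq[abs_def]
    by (intro Bochner_Integration.integrable_add Bochner_Integration.integrable_sum integrable_mult_left e_int)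
  define S where "S N = m j k * cinner (D x) y + (\<Sum>n<N. m (j + Suc n) k * cinner (D x) ((T ^^ Suc n) y) +
      m j (k + Suc n) * cinner (D ((T ^^ Suc n) x)) y)" for N
  have F_S: "(LINT z|area_measure. F N z) = S N" for N
    unfolding F_eq S_def e_m[symmetric]
    by (subst Bochner_Integration.integral_add,
        (intro Bochner_Integration.integrable_sum Bochner_Integration.integrable_add integrable_mult_left e_int)+,
        subst Bochner_Integration.integral_sum,
        (intro Bochner_Integration.integrable_add integrable_mult_left e_int)+,
        subst Bochner_Integration.integral_add,
        (intro integrable_mult_left e_int)+,
        simp only: integral_mult_left_zero)
  obtain C where C: "C > 0" "\<And>N z. cmod z \<le> R \<Longrightarrow> cmod (poisson_partial N z x y) \<le> C * norm x * norm y"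
    "\<And>z. cmod z \<le> R \<Longrightarrow> cmod (cinner (poisson_op z x) y) \<le> C * norm x * norm y"
    using poisson_op_bound[of R] R by (metis less_imp_le)
  have pw: "cmod (z ^ j * cnj z ^ k) \<le> 1" if "z \<in> ball 0 R" for z
    using that R by (auto simp: norm_mult norm_power intro!: mult_le_one power_le_one)
  have meas_G: "G \<in> borel_measurable area_measure"
  proof (rule borel_measurable_LIMSEQ_metric)
    show "F N \<in> borel_measurable area_measure" for N by (rule borel_measurable_integrable[OF F_int])
    show "(\<lambda>N. F N z) \<longlonglongrightarrow> G z" for z
      unfolding F_def G_def
      by (cases "z \<in> ball 0 R") (use R in \<open>auto intro!: tendsto_scaleR tendsto_mult tendsto_const poisson_partial_tendsto\<close>)
  qed
  have bnd: "norm (F N z) \<le> C * norm x * norm y" "norm (G z) \<le> C * norm x * norm y" for N z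
  proof -
    have 0: "0 \<le> C * norm x * norm y" using C(1) by simp
    have "cmod (z ^ j * cnj z ^ k) * cmod c \<le> 1 * (C * norm x * norm y)"
      if "z \<in> ball 0 R" "cmod c \<le> C * norm x * norm y" for c
      using that pw 0 by (intro mult_mono) auto
    then show "norm (F N z) \<le> C * norm x * norm y" "norm (G z) \<le> C * norm x * norm y"
      unfolding F_def G_def using C(2,3) 0 by (cases "z \<in> ball 0 R"; simp add: norm_mult)+
  qed
  have "integrable area_measure G"
    by (rule finite_measure.integrable_const_bound[where B="C * norm x * norm y", OF finite_measure_area_measure _ meas_G]) (simp add: bnd)
  then show "integrable area_measure (\<lambda>z. indicator (ball 0 R) z *\<^sub>R (z ^ j * cnj z ^ k * cinner (poisson_op z x) y))"
    by (simp only: G_def[abs_def])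
  have "(\<lambda>N. LINT z|area_measure. F N z) \<longlonglongrightarrow> (LINT z|area_measure. G z)"
  proof (rule integral_dominated_convergence[where w="\<lambda>_. C * norm x * norm y"])
    show "AE z in area_measure. (\<lambda>N. F N z) \<longlonglongrightarrow> G z"
      unfolding F_def G_def
    proof (rule AE_I2)
      fix z
      show "(\<lambda>N. indicator (ball 0 R) z *\<^sub>R (z ^ j * cnj z ^ k * poisson_partial N z x y))
        \<longlonglongrightarrow> indicator (ball 0 R) z *\<^sub>R (z ^ j * cnj z ^ k * cinner (poisson_op z x) y)"
        by (cases "z \<in> ball 0 R") (use R in \<open>auto intro!: tendsto_scaleR tendsto_mult tendsto_const poisson_partial_tendsto\<close>)
    qed
    show "integrable area_measure (\<lambda>_. C * norm x * norm y)"
      by (rule finite_measure.integrable_const[OF finite_measure_area_measure])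
  qed (auto simp: bnd meas_G borel_measurable_integrable[OF F_int])
  \<comment> \<open>The surviving term has index \<open>k - j - 1\<close> or
    \<open>j - k - 1\<close> in the sum, or is the leading term if \<open>j = k\<close>, so the
    partial sums are constant once \<open>N\<close> exceeds \<open>j + k\<close>.\<close>
  moreover have SN: "S N = complex_of_real (R ^ (2 * max j k + 2) / (max j k + 1)) * cinner (D ((T ^^ j) x)) ((T ^^ k) y)"
    if N: "N > j + k" for N
  proof -
    consider "j = k" | d where "k = j + Suc d" | d where "j = k + Suc d"
      by (metis add_Suc_right less_imp_Suc_add linorder_neqE_nat)
    then show ?thesis
    proof cases
      case 1
      then show ?thesis by (simp add: S_def m_def cinner_D_Tn)
    next
      case 2
      have m1: "m j k = 0" "m (j + Suc n) k = (if n = d then m k k else 0)" "m j (k + Suc n) = 0" for n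
        using 2 by (auto simp: m_def)
      have "S N = (\<Sum>n<N. if n = d then m k k * cinner (D x) ((T ^^ Suc n) y) else 0)"
        unfolding S_def m1 mult_zero_left add_0_left add_0_right by (intro sum.cong) auto
      also have "\<dots> = m k k * cinner (D x) ((T ^^ Suc d) y)"
        using N 2 by (simp del: funpow.simps)
      also have "cinner (D x) ((T ^^ Suc d) y) = cinner (D ((T ^^ j) x)) ((T ^^ k) y)"
        unfolding 2 by (simp only: funpow_add comp_apply cinner_D_Tn)
      finally show ?thesis using 2 by (simp add: m_def max_def)
    next
      case 3
      have m1: "m j k = 0" "m (j + Suc n) k = 0" "m j (k + Suc n) = (if n = d then m j j else 0)" for n
        using 3 by (auto simp: m_def)
      have "S N = (\<Sum>n<N. if n = d then m j j * cinner (D ((T ^^ Suc n) x)) y else 0)"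
        unfolding S_def m1 mult_zero_left add_0_left add_0_right by (intro sum.cong) auto
      also have "\<dots> = m j j * cinner (D ((T ^^ Suc d) x)) y"
        using N 3 by (simp del: funpow.simps)
      also have "cinner (D ((T ^^ Suc d) x)) y = cinner (D ((T ^^ j) x)) ((T ^^ k) y)"
        unfolding 3 by (simp only: funpow_add comp_apply cinner_D_Tn)
      finally show ?thesis using 3 by (simp add: m_def max_def)
    qed
  qed
  have "\<forall>\<^sub>F N in sequentially. complex_of_real (R ^ (2 * max j k + 2) / (max j k + 1)) * cinner (D ((T ^^ j) x)) ((T ^^ k) y) = S N"
    using eventually_gt_at_top[of "j + k"] by eventually_elim (simp only: SN)
  then have "S \<longlonglongrightarrow> complex_of_real (R ^ (2 * max j k + 2) / (max j k + 1)) * cinner (D ((T ^^ j) x)) ((T ^^ k) y)"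
    by (rule Lim_transform_eventually[OF tendsto_const])
  ultimately have "(LINT z|area_measure. G z) = complex_of_real (R ^ (2 * max j k + 2) / (max j k + 1)) * cinner (D ((T ^^ j) x)) ((T ^^ k) y)"
    unfolding F_S by (rule LIMSEQ_unique)
  then show "(LINT z|area_measure. indicator (ball 0 R) z *\<^sub>R (z ^ j * cnj z ^ k * cinner (poisson_op z x) y)) =
      complex_of_real (R ^ (2 * max j k + 2) / (max j k + 1)) * cinner (D ((T ^^ j) x)) ((T ^^ k) y)"
    by (simp only: G_def[abs_def])
qed

lemma poisson_form_partial_sum:
  assumes "z \<in> ball 0 1"
  shows "cinner (poisson_op z (deriv_partial N a z)) (deriv_partial N a z) =
    (\<Sum>j<N. \<Sum>k<N. of_nat (Suc j * Suc k) * (z ^ j * cnj z ^ k * cinner (poisson_op z (a (Suc j))) (a (Suc k))))"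
proof -
  interpret bounded_op "poisson_op z" unfolding bounded_op_def by (rule bounded_clinear_poisson_op[OF assms])
  show ?thesis
    unfolding deriv_partial_def sum cinner_sum_left cinner_sum_right scaleC cinner_scaleC_left cinner_scaleC_right
    by (subst sum.swap, intro sum.cong refl)
      (simp only: sum_distrib_left of_nat_mult complex_cnj_mult complex_cnj_power complex_cnj_of_nat mult_ac)
qed

text \<open>The Abel mean at \<open>R^2\<close> of the polynomial energies is the integral over the
  disc of radius \<open>R\<close>. It is shown for partial sums of the derivative, where one
  boundary term appears, and then passed to the limit by dominated convergence.\<close>

lemma disc_integral:
  assumes a: "\<And>k. norm (a k) \<le> B" and R: "0 < R" "R < 1"
  defines "h \<equiv> \<lambda>z. cinner (poisson_op z (deriv_series a z)) (deriv_series a z)"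
  shows "integrable area_measure (\<lambda>z. indicator (ball 0 R) z *\<^sub>R h z)"
    and "(\<lambda>N. (1 - complex_of_real (R\<^sup>2)) * (\<Sum>n<N. complex_of_real (R\<^sup>2) ^ n * poly_energy n a)) \<longlonglongrightarrow>
      (LINT z|area_measure. indicator (ball 0 R) z *\<^sub>R h z)"
proof -
  define hN where "hN N z = cinner (poisson_op z (deriv_partial N a z)) (deriv_partial N a z)" for N z
  define g where "g j k = of_nat (min j k) * cinner (D ((T ^^ j) (a j))) ((T ^^ k) (a k))" for j k
  have PE: "poly_energy N a = (\<Sum>j\<le>N. \<Sum>k\<le>N. g j k)" for N by (simp add: poly_energy_def g_def)
  have hN_eq: "indicator (ball 0 R) z *\<^sub>R hN N z = (\<Sum>j<N. \<Sum>k<N. of_nat (Suc j * Suc k) *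
      (indicator (ball 0 R) z *\<^sub>R (z ^ j * cnj z ^ k * cinner (poisson_op z (a (Suc j))) (a (Suc k)))))" for N z
    using R poisson_form_partial_sum[of z N a] by (cases "z \<in> ball 0 R") (auto simp: hN_def)
  have int_hN: "integrable area_measure (\<lambda>z. indicator (ball 0 R) z *\<^sub>R hN N z)" for N
    unfolding hN_eq by (intro Bochner_Integration.integrable_sum integrable_mult_right disc_integral_monomial R)
  \<comment> \<open>The product of two numbers is the product of their maximum and minimum, so the
    denominator from the disc integral cancels the maximum.\<close>
  have coeff: "of_nat (Suc j * Suc k) * (complex_of_real (R ^ (2 * max j k + 2) / (max j k + 1)) *
      cinner (D ((T ^^ j) (a (Suc j)))) ((T ^^ k) (a (Suc k)))) =
    complex_of_real (R\<^sup>2) ^ max (Suc j) (Suc k) * g (Suc j) (Suc k)" for j k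
  proof -
    have "real (Suc j * Suc k) * (R ^ (2 * max j k + 2) / (max j k + 1)) = (R\<^sup>2) ^ Suc (max j k) * min (Suc j) (Suc k)"
    proof -
      have "real (Suc j * Suc k) = real (max j k + 1) * min (Suc j) (Suc k)" by (cases "j \<le> k") (simp_all add: max_def min_def algebra_simps)
      moreover have "R ^ (2 * max j k + 2) = (R\<^sup>2) ^ Suc (max j k)"
        by (simp only: power_mult[symmetric]) simp
      ultimately show ?thesis by simp
    qed
    from arg_cong[OF this, of complex_of_real]
    have "of_nat (Suc j * Suc k) * complex_of_real (R ^ (2 * max j k + 2) / (max j k + 1)) =
      complex_of_real (R\<^sup>2) ^ Suc (max j k) * of_nat (min (Suc j) (Suc k))"
      by (simp only: of_real_mult of_real_of_nat_eq of_real_power)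
    moreover have "cinner (D ((T ^^ Suc j) (a (Suc j)))) ((T ^^ Suc k) (a (Suc k))) =
      cinner (D ((T ^^ j) (a (Suc j)))) ((T ^^ k) (a (Suc k)))" by (simp add: cinner_D_T_T)
    ultimately show ?thesis unfolding g_def max_Suc_Suc by (simp only: mult.assoc[symmetric])
  qed
  \<comment> \<open>Differentiation lowers the indices by one; the weight \<open>min j k\<close>
    vanishes at index 0, so the sums can be extended down to it.\<close>
  have sum_shift: "(\<Sum>j\<le>N. \<Sum>k\<le>N. f j k) = (\<Sum>j<N. \<Sum>k<N. f (Suc j) (Suc k))"
    if "\<And>j. f j 0 = 0" "\<And>k. f 0 k = 0" for f :: "nat \<Rightarrow> nat \<Rightarrow> complex" and N
    unfolding lessThan_Suc_atMost[symmetric] sum.lessThan_Suc_shift that by simp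
  have LN: "(LINT z|area_measure. indicator (ball 0 R) z *\<^sub>R hN N z) =
      (1 - complex_of_real (R\<^sup>2)) * (\<Sum>n<N. complex_of_real (R\<^sup>2) ^ n * poly_energy n a) +
      complex_of_real (R\<^sup>2) ^ N * poly_energy N a" for N
  proof -
    have "(LINT z|area_measure. indicator (ball 0 R) z *\<^sub>R hN N z) =
      (\<Sum>j<N. \<Sum>k<N. of_nat (Suc j * Suc k) * (complex_of_real (R ^ (2 * max j k + 2) / (max j k + 1)) *
        cinner (D ((T ^^ j) (a (Suc j)))) ((T ^^ k) (a (Suc k)))))"
      unfolding hN_eq
      by (subst Bochner_Integration.integral_sum,
          intro Bochner_Integration.integrable_sum integrable_mult_right disc_integral_monomial R,
          intro sum.cong refl, subst Bochner_Integration.integral_sum,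
          intro integrable_mult_right disc_integral_monomial R,
          simp only: integral_mult_right_zero disc_integral_monomial(2)[OF R])
    also have "\<dots> = (\<Sum>j<N. \<Sum>k<N. complex_of_real (R\<^sup>2) ^ max (Suc j) (Suc k) * g (Suc j) (Suc k))"
      by (simp only: coeff)
    also have "\<dots> = (\<Sum>j\<le>N. \<Sum>k\<le>N. complex_of_real (R\<^sup>2) ^ max j k * g j k)"
      by (rule sum_shift[symmetric]) (simp_all add: g_def)
    finally show ?thesis unfolding PE abel_summation_square .
  qed
  obtain K where K: "K > 0" "\<And>x y n m. cmod (cinner (D ((T ^^ n) x)) ((T ^^ m) y)) \<le> K * norm x * norm y"
    using cinner_D_bound by blast
  have B: "0 \<le> B" using a norm_ge_zero order_trans by blast
  have PE_bound: "cmod (poly_energy N a) \<le> real (Suc N) ^ 3 * (K * B * B)" for N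
  proof -
    have "cmod (poly_energy N a) \<le> (\<Sum>j\<le>N. \<Sum>k\<le>N. real (Suc N) * (K * B * B))"
      unfolding PE
    proof (intro sum_norm_le)
      fix j k assume "j \<in> {..N}" "k \<in> {..N}"
      then have "real (min j k) \<le> real (Suc N)" by simp
      moreover have "cmod (cinner (D ((T ^^ j) (a j))) ((T ^^ k) (a k))) \<le> K * B * B"
        using K(2)[of j "a j" k "a k"] mult_mono[OF a[of j] a[of k] B norm_ge_zero] K(1)
        by (meson less_imp_le mult_left_mono mult.assoc order_trans mult_mono a B norm_ge_zero mult_nonneg_nonneg)
      ultimately show "cmod (g j k) \<le> real (Suc N) * (K * B * B)"
        unfolding g_def norm_mult norm_of_nat by (intro mult_mono) auto
    qed
    also have "\<dots> = real (Suc N) ^ 3 * (K * B * B)" by (simp add: power3_eq_cube mult.assoc)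
    finally show ?thesis .
  qed
  have R2: "0 < R\<^sup>2" "R\<^sup>2 < 1" using R by (auto simp: power_less_one_iff)
  \<comment> \<open>The boundary term of the summation by parts: the geometric decay of
    \<open>(R^2) ^ N\<close> beats the cubic growth of the energy.\<close>
  have rem: "(\<lambda>N. complex_of_real (R\<^sup>2) ^ N * poly_energy N a) \<longlonglongrightarrow> 0"
  proof (rule Lim_null_comparison)
    show "(\<lambda>N. (real (Suc N) ^ 3 * (R\<^sup>2) ^ N) * (K * B * B)) \<longlonglongrightarrow> 0"
      by (intro tendsto_mult_left_zero cube_power_tendsto_0 R2)
    show "\<forall>\<^sub>F N in sequentially. norm (complex_of_real (R\<^sup>2) ^ N * poly_energy N a) \<le> (real (Suc N) ^ 3 * (R\<^sup>2) ^ N) * (K * B * B)"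
    proof (rule always_eventually, rule allI)
      fix N
      have "norm (complex_of_real (R\<^sup>2) ^ N * poly_energy N a) = (R\<^sup>2) ^ N * cmod (poly_energy N a)"
        by (simp add: norm_mult norm_power)
      also have "\<dots> \<le> (R\<^sup>2) ^ N * (real (Suc N) ^ 3 * (K * B * B))" by (intro mult_left_mono PE_bound) simp
      finally show "norm (complex_of_real (R\<^sup>2) ^ N * poly_energy N a) \<le> (real (Suc N) ^ 3 * (R\<^sup>2) ^ N) * (K * B * B)"
        by (simp only: mult_ac)
    qed
  qed
  obtain C where C: "C > 0" "\<And>z x y. cmod z \<le> R \<Longrightarrow> cmod (cinner (poisson_op z x) y) \<le> C * norm x * norm y"
    using poisson_op_bound[of R] R by (metis less_imp_le)
  define G where "G = (\<Sum>k. real (Suc k) * R ^ k) * B"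
  have G0: "0 \<le> G" unfolding G_def using B R by (intro mult_nonneg_nonneg suminf_nonneg summable_Suc_power) auto
  have bnd: "norm (indicator (ball 0 R) z *\<^sub>R hN N z) \<le> C * G * G" for N z
  proof (cases "z \<in> ball 0 R")
    case True
    then have z: "cmod z \<le> R" by simp
    have n: "norm (deriv_partial N a z) \<le> G" unfolding G_def by (rule norm_deriv_partial_le[OF a z R(2)])
    have "cmod (hN N z) \<le> C * norm (deriv_partial N a z) * norm (deriv_partial N a z)"
      unfolding hN_def by (rule C(2)[OF z])
    also have "\<dots> \<le> C * G * G" using n C(1) G0 by (intro mult_mono mult_left_mono mult_nonneg_nonneg) auto
    finally show ?thesis using True by simp
  qed (use C(1) G0 in simp)
  have lim: "(\<lambda>N. indicator (ball 0 R) z *\<^sub>R hN N z) \<longlonglongrightarrow> indicator (ball 0 R) z *\<^sub>R h z" for z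
  proof (cases "z \<in> ball 0 R")
    case True
    then have z: "z \<in> ball 0 1" "cmod z < 1" using R by auto
    interpret bounded_op "poisson_op z" unfolding bounded_op_def by (rule bounded_clinear_poisson_op[OF z(1)])
    show ?thesis unfolding hN_def h_def
      by (intro tendsto_scaleR tendsto_const tendsto_cinner tendsto deriv_partial_tendsto[OF a z(2)])
  qed simp
  have meas: "(\<lambda>z. indicator (ball 0 R) z *\<^sub>R h z) \<in> borel_measurable area_measure"
    by (rule borel_measurable_LIMSEQ_metric[OF borel_measurable_integrable[OF int_hN] lim])
  have "norm (indicator (ball 0 R) z *\<^sub>R h z) \<le> C * G * G" for z
    by (rule tendsto_upperbound[OF tendsto_norm[OF lim]]) (simp_all add: bnd del: scaleR_scaleR norm_scaleR)
  then show "integrable area_measure (\<lambda>z. indicator (ball 0 R) z *\<^sub>R h z)"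
    by (intro finite_measure.integrable_const_bound[where B="C * G * G", OF finite_measure_area_measure _ meas] AE_I2)
  have "(\<lambda>N. LINT z|area_measure. indicator (ball 0 R) z *\<^sub>R hN N z) \<longlonglongrightarrow> (LINT z|area_measure. indicator (ball 0 R) z *\<^sub>R h z)"
    by (rule integral_dominated_convergence[OF meas borel_measurable_integrable[OF int_hN]
          finite_measure.integrable_const[OF finite_measure_area_measure] AE_I2[OF lim] AE_I2[OF bnd]])
  from tendsto_diff[OF this rem]
  show "(\<lambda>N. (1 - complex_of_real (R\<^sup>2)) * (\<Sum>n<N. complex_of_real (R\<^sup>2) ^ n * poly_energy n a)) \<longlonglongrightarrow>
      (LINT z|area_measure. indicator (ball 0 R) z *\<^sub>R h z)"
    unfolding LN by simp
qed

end

lemma indicator_subset_le: "A \<subseteq> B \<Longrightarrow> indicator A x \<le> (indicator B x :: ennreal)"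
  by (auto simp: indicator_def)

text \<open>The double successor lets the radii start at 1/2, so that all of them are
  positive.\<close>

lemma indicator_ball_tendsto:
  defines "R \<equiv> \<lambda>i. 1 - inverse (real (Suc (Suc i)))"
  shows "0 < R i" "R i < 1" "incseq R" "R \<longlonglongrightarrow> 1"
    "(\<lambda>i. c * indicator (ball 0 (R i)) (z::complex)) \<longlonglongrightarrow> (c * indicator (ball 0 1) z :: ennreal)"
proof -
  show "0 < R i" "R i < 1" by (simp_all add: R_def field_simps)
  show "incseq R" unfolding incseq_def R_def by (intro allI impI diff_left_mono le_imp_inverse_le) auto
  have "(\<lambda>i. 1 - inverse (real (Suc (Suc i)))) \<longlonglongrightarrow> 1 - 0"
    by (intro tendsto_diff tendsto_const LIMSEQ_Suc[OF LIMSEQ_inverse_real_of_nat])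
  then show lim: "R \<longlonglongrightarrow> 1" by (simp add: R_def[abs_def])
  have lt: "R i < 1" for i by (simp add: R_def field_simps)
  show "(\<lambda>i. c * indicator (ball 0 (R i)) z) \<longlonglongrightarrow> c * indicator (ball 0 1) z"
  proof (cases "z \<in> ball 0 1")
    case True
    then have "\<forall>\<^sub>F i in sequentially. cmod z < R i" using order_tendstoD(1)[OF lim] by simp
    then have "\<forall>\<^sub>F i in sequentially. c = c * indicator (ball 0 (R i)) z" by eventually_elim simp
    then have "(\<lambda>i. c * indicator (ball 0 (R i)) z) \<longlonglongrightarrow> c" by (rule Lim_transform_eventually[OF tendsto_const])
    then show ?thesis using True by simp
  next
    case False
    then have "\<not> cmod z < R i" for i using lt[of i] by simp
    then show ?thesis using False by simp
  qed
qed

context pure_spectral_family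
begin

definition dirichlet_energy :: "(nat \<Rightarrow> 'a) \<Rightarrow> ennreal" where
  "dirichlet_energy a = (\<integral>\<^sup>+z. ennreal (Re (cinner (poisson_op z (deriv_series a z)) (deriv_series a z))) *
    indicator (ball 0 1) z \<partial>area_measure)"

context
  fixes a :: "nat \<Rightarrow> 'a" and B :: real
  assumes a: "\<And>k. norm (a k) \<le> B" and La: "\<And>k. L (a k) = 0"
begin

lemma disc_energy:
  assumes R: "0 < R" "R < 1"
  shows "(\<integral>\<^sup>+z. ennreal (Re (cinner (poisson_op z (deriv_series a z)) (deriv_series a z))) * indicator (ball 0 R) z \<partial>area_measure) =
      ennreal (abel_mean (R\<^sup>2) (\<lambda>n. energy (\<Sum>k\<le>n. (T ^^ k) (a k))))"
    and "summable (\<lambda>n. (R\<^sup>2) ^ n * energy (\<Sum>k\<le>n. (T ^^ k) (a k)))"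
    and "(\<lambda>z. ennreal (Re (cinner (poisson_op z (deriv_series a z)) (deriv_series a z))) * indicator (ball 0 R) z)
      \<in> borel_measurable area_measure"
proof -
  define h where "h z = cinner (poisson_op z (deriv_series a z)) (deriv_series a z)" for z
  define e where "e n = energy (\<Sum>k\<le>n. (T ^^ k) (a k))" for n
  define I where "I = (LINT z|area_measure. indicator (ball 0 R) z *\<^sub>R h z)"
  note di = disc_integral[where a=a, OF a R, folded h_def, folded I_def]
  have R2: "0 < R\<^sup>2" "R\<^sup>2 < 1" using R by (auto simp: power_less_one_iff)
  have pe: "poly_energy n a = complex_of_real (e n)" for n
    unfolding e_def by (rule energy_poly[where a=a, OF La, symmetric])
  have "(\<lambda>N. complex_of_real ((1 - R\<^sup>2) * (\<Sum>n<N. (R\<^sup>2) ^ n * e n))) \<longlonglongrightarrow> I"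
    using di(2) unfolding pe by simp
  from tendsto_Re[OF this] have lim: "(\<lambda>N. (1 - R\<^sup>2) * (\<Sum>n<N. (R\<^sup>2) ^ n * e n)) \<longlonglongrightarrow> Re I" by simp
  from tendsto_divide[OF this tendsto_const[of "1 - R\<^sup>2"]]
  have sums: "(\<lambda>n. (R\<^sup>2) ^ n * e n) sums (Re I / (1 - R\<^sup>2))"
    using R2 by (simp add: sums_def)
  then show "summable (\<lambda>n. (R\<^sup>2) ^ n * energy (\<Sum>k\<le>n. (T ^^ k) (a k)))"
    unfolding e_def by (rule sums_summable)
  have am: "abel_mean (R\<^sup>2) e = Re I" unfolding abel_mean_def sums_unique[OF sums, symmetric] using R2 by simp
  have int: "integrable area_measure (\<lambda>z. Re (indicator (ball 0 R) z *\<^sub>R h z))" by (rule integrable_Re[OF di(1)])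
  have eq: "ennreal (Re (h z)) * indicator (ball 0 R) z = ennreal (Re (indicator (ball 0 R) z *\<^sub>R h z))" for z
    by (cases "z \<in> ball 0 R") simp_all
  have nn: "0 \<le> Re (indicator (ball 0 R) z *\<^sub>R h z)" for z
    using R cinner_poisson_op_nonneg[of z] by (cases "z \<in> ball 0 R") (auto simp: h_def)
  have "(\<integral>\<^sup>+z. ennreal (Re (h z)) * indicator (ball 0 R) z \<partial>area_measure) = ennreal (LINT z|area_measure. Re (indicator (ball 0 R) z *\<^sub>R h z))"
    unfolding eq by (rule nn_integral_eq_integral[OF int]) (rule AE_I2, rule nn)
  also have "(LINT z|area_measure. Re (indicator (ball 0 R) z *\<^sub>R h z)) = Re I" unfolding I_def by (rule integral_Re[OF di(1)])
  finally show "(\<integral>\<^sup>+z. ennreal (Re (cinner (poisson_op z (deriv_series a z)) (deriv_series a z))) * indicator (ball 0 R) z \<partial>area_measure) =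
      ennreal (abel_mean (R\<^sup>2) (\<lambda>n. energy (\<Sum>k\<le>n. (T ^^ k) (a k))))"
    using am by (simp only: h_def e_def[abs_def])
  show "(\<lambda>z. ennreal (Re (cinner (poisson_op z (deriv_series a z)) (deriv_series a z))) * indicator (ball 0 R) z)
      \<in> borel_measurable area_measure"
    unfolding h_def[symmetric] eq using borel_measurable_integrable[OF int] by (rule measurable_compose) simp
qed

lemma dirichlet_energy_measurable:
  "(\<lambda>z. ennreal (Re (cinner (poisson_op z (deriv_series a z)) (deriv_series a z))) * indicator (ball 0 1) z)
      \<in> borel_measurable area_measure"
  by (rule borel_measurable_LIMSEQ_order[OF indicator_ball_tendsto(5) disc_energy(3)[OF indicator_ball_tendsto(1,2)]])

lemma dirichlet_energy_tendsto:
  "(\<lambda>i. ennreal (abel_mean ((1 - inverse (real (Suc (Suc i))))\<^sup>2) (\<lambda>n. energy (\<Sum>k\<le>n. (T ^^ k) (a k))))) \<longlonglongrightarrow> dirichlet_energy a"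
  unfolding dirichlet_energy_def disc_energy(1)[OF indicator_ball_tendsto(1,2), symmetric]
proof (rule nn_integral_LIMSEQ)
  define h where "h z = ennreal (Re (cinner (poisson_op z (deriv_series a z)) (deriv_series a z)))" for z
  show "incseq (\<lambda>i z. ennreal (Re (cinner (poisson_op z (deriv_series a z)) (deriv_series a z))) *
      indicator (ball 0 (1 - inverse (real (Suc (Suc i))))) z)"
    unfolding h_def[symmetric]
  proof (rule incseq_SucI, rule le_funI, rule mult_left_mono)
    fix i z
    show "indicator (ball 0 (1 - inverse (real (Suc (Suc i))))) z \<le> (indicator (ball 0 (1 - inverse (real (Suc (Suc (Suc i)))))) z :: ennreal)"
      by (intro indicator_subset_le subset_ball diff_left_mono le_imp_inverse_le) auto
  qed simp
qed (rule disc_energy(3)[OF indicator_ball_tendsto(1,2)], rule indicator_ball_tendsto(5))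

text \<open>The Abel mean at \<open>r\<close> is the integral of the nonnegative integrand over the
  smaller disc of radius \<open>sqrt r\<close>. Nothing is assumed here about the coefficients
  belonging to a vector, which is what surjectivity needs.\<close>

lemma abel_mean_le_dirichlet_energy:
  assumes r: "0 < r" "r < 1"
  shows "ennreal (abel_mean r (\<lambda>n. energy (\<Sum>k\<le>n. (T ^^ k) (a k)))) \<le> dirichlet_energy a"
    and "summable (\<lambda>n. r ^ n * energy (\<Sum>k\<le>n. (T ^^ k) (a k)))"
proof -
  have R: "0 < sqrt r" "sqrt r < 1" "(sqrt r)\<^sup>2 = r" using r by auto
  show "ennreal (abel_mean r (\<lambda>n. energy (\<Sum>k\<le>n. (T ^^ k) (a k)))) \<le> dirichlet_energy a"
    using disc_energy(1)[OF R(1,2)] unfolding R(3) dirichlet_energy_def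
    by (simp only: flip: disc_energy(1)[OF R(1,2), unfolded R(3)])
      (intro nn_integral_mono mult_left_mono indicator_subset_le subset_ball, use R in auto)
  show "summable (\<lambda>n. r ^ n * energy (\<Sum>k\<le>n. (T ^^ k) (a k)))"
    using disc_energy(2)[OF R(1,2)] unfolding R(3) .
qed

end

text \<open>By \<open>remainder\<close> the polynomials formed from these coefficients are the
  Taylor polynomials of \<open>x\<close>, so the Abel means converge to the Dirichlet integral by
  monotone convergence and to the energy by \<open>abel_energy\<close>.\<close>

lemma dirichlet_energy_eq:
  "dirichlet_energy (\<lambda>k. P ((L ^^ k) x)) = ennreal (energy x)"
proof -
  have b: "norm (P ((L ^^ k) x)) \<le> norm x" for k
  proof -
    have "(norm (P ((L ^^ k) x)))\<^sup>2 \<le> (norm ((L ^^ k) x))\<^sup>2"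
      using norm_decomp[of "(L ^^ k) x"] q_nonneg[of "L ((L ^^ k) x)"] by simp
    then have "norm (P ((L ^^ k) x)) \<le> norm ((L ^^ k) x)" by (rule power2_le_imp_le) simp
    also have "\<dots> \<le> norm x" by (rule norm_Ln_le)
    finally show ?thesis .
  qed
  have e: "(\<Sum>k\<le>n. (T ^^ k) (P ((L ^^ k) x))) = x - (T ^^ Suc n) ((L ^^ Suc n) x)" for n
    unfolding remainder lessThan_Suc_atMost ..
  have "filterlim (\<lambda>i. (1 - inverse (real (Suc (Suc i))))\<^sup>2) (at_left 1) sequentially"
  proof (rule tendsto_imp_filterlim_at_left)
    show "(\<lambda>i. (1 - inverse (real (Suc (Suc i))))\<^sup>2) \<longlonglongrightarrow> 1"
      using tendsto_power[OF indicator_ball_tendsto(4), where n=2] by simp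
    show "\<forall>\<^sub>F i in sequentially. (1 - inverse (real (Suc (Suc i))))\<^sup>2 < 1"
    proof (rule always_eventually, rule allI)
      fix i
      show "(1 - inverse (real (Suc (Suc i))))\<^sup>2 < 1"
        using indicator_ball_tendsto(1,2)[where i=i] by (simp only: power_less_one_iff less_imp_le) simp
    qed
  qed
  from tendsto_ennrealI[OF filterlim_compose[OF abel_energy(2) this]]
  have "(\<lambda>i. ennreal (abel_mean ((1 - inverse (real (Suc (Suc i))))\<^sup>2) (\<lambda>n. energy (\<Sum>k\<le>n. (T ^^ k) (P ((L ^^ k) x)))))) \<longlonglongrightarrow> ennreal (energy x)"
    unfolding e .
  with dirichlet_energy_tendsto[where a="\<lambda>k. P ((L ^^ k) x)", OF b L_P] show ?thesis by (rule LIMSEQ_unique)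
qed

end

subsection \<open>Parseval's identity for quadratic forms\<close>

text \<open>Orthogonality of the exponentials leaves the diagonal terms. The geometric majorant
  permits the passage from partial sums to \<open>w\<close>.\<close>

lemma parseval_form:
  fixes v :: "nat \<Rightarrow> 'a::chilbert_space"
  assumes A: "bounded_clinear A" and nn: "\<And>x. 0 \<le> Re (cinner (A x) x)"
    and v: "\<And>n. norm (v n) \<le> V" and r: "0 \<le> r" "r < 1"
  defines "w \<equiv> \<lambda>t. \<Sum>n. (complex_of_real r * cis t) ^ n *\<^sub>C v n"
  shows "(\<integral>\<^sup>+t. ennreal (Re (cinner (A (w t)) (w t))) \<partial>angle_measure) = (\<Sum>n. ennreal (r ^ (2 * n) * Re (cinner (A (v n)) (v n))))"
proof -
  interpret A: bounded_op A by unfold_locales fact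
  obtain K where K: "K > 0" "\<And>x. norm (A x) \<le> K * norm x" using A.bound by blast
  define wN where "wN N t = (\<Sum>n<N. (complex_of_real r * cis t) ^ n *\<^sub>C v n)" for N t
  have V: "0 \<le> V" using v norm_ge_zero order_trans by blast
  have tm: "norm ((complex_of_real r * cis t) ^ n *\<^sub>C v n) \<le> r ^ n * V" for n t
    using v[of n] r by (simp add: norm_mult norm_power mult_left_mono)
  have sV: "summable (\<lambda>n. r ^ n * V)" using r by (intro summable_mult2 summable_geometric) auto
  have w_lim: "(\<lambda>N. wN N t) \<longlonglongrightarrow> w t" for t
    unfolding wN_def w_def
    by (rule summable_LIMSEQ, rule summable_norm_cancel, rule summable_comparison_test'[OF sV, where N=0]) (use tm in auto)
  define W where "W = (\<Sum>n. r ^ n * V)"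
  have wN_bd: "norm (wN N t) \<le> W" for N t
  proof -
    have "norm (wN N t) \<le> (\<Sum>n<N. r ^ n * V)" unfolding wN_def by (rule sum_norm_le) (rule tm)
    also have "\<dots> \<le> W" unfolding W_def by (rule sum_le_suminf[OF sV]) (use r V in auto)
    finally show ?thesis .
  qed
  have W: "0 \<le> W" using wN_bd norm_ge_zero order_trans by blast
  define h where "h N t = cinner (A (wN N t)) (wN N t)" for N t
  have h_eq: "h N t = (\<Sum>j<N. \<Sum>k<N. (complex_of_real (r ^ (j + k)) * cinner (A (v j)) (v k)) * cis (of_int (int j - int k) * t))" for N t
  proof -
    have c: "(complex_of_real r * cis t) ^ j * cnj ((complex_of_real r * cis t) ^ k) = complex_of_real (r ^ (j + k)) * cis (of_int (int j - int k) * t)" for j k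
    proof -
      have "(complex_of_real r * cis t) ^ j * cnj ((complex_of_real r * cis t) ^ k) = complex_of_real (r ^ (j + k)) * (cis t ^ j * cis (- t) ^ k)"
        by (simp add: power_mult_distrib power_add cis_cnj mult_ac)
      also have "cis t ^ j * cis (- t) ^ k = cis (of_int (int j - int k) * t)"
        by (simp add: Complex.DeMoivre cis_mult algebra_simps)
      finally show ?thesis .
    qed
    have "h N t = (\<Sum>j<N. \<Sum>k<N. ((complex_of_real r * cis t) ^ j * cnj ((complex_of_real r * cis t) ^ k)) * cinner (A (v j)) (v k))"
      unfolding h_def wN_def A.sum cinner_sum_left cinner_sum_right A.scaleC cinner_scaleC_left cinner_scaleC_right
      by (subst sum.swap, intro sum.cong refl) (simp only: sum_distrib_left mult_ac)
    then show ?thesis unfolding c by (simp only: mult_ac)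
  qed
  have int: "integrable angle_measure (h N)" for N
    unfolding h_eq[abs_def] by (intro Bochner_Integration.integrable_sum integrable_mult_right integrable_cis_angle_measure)
  have h_int: "(LINT t|angle_measure. h N t) = (\<Sum>n<N. complex_of_real (r ^ (2 * n)) * cinner (A (v n)) (v n))" for N
  proof -
    have "(LINT t|angle_measure. h N t) = (\<Sum>j<N. \<Sum>k<N. (complex_of_real (r ^ (j + k)) * cinner (A (v j)) (v k)) * (if int j - int k = 0 then 1 else 0))"
      unfolding h_eq
      by (subst Bochner_Integration.integral_sum,
          intro Bochner_Integration.integrable_sum integrable_mult_right integrable_cis_angle_measure,
          intro sum.cong refl, subst Bochner_Integration.integral_sum,
          intro integrable_mult_right integrable_cis_angle_measure,
          simp only: integral_mult_right_zero integral_cis_angle_measure)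
    also have "\<dots> = (\<Sum>j<N. \<Sum>k<N. if k = j then complex_of_real (r ^ (2 * j)) * cinner (A (v j)) (v j) else 0)"
      by (intro sum.cong refl) (auto simp: mult_2)
    also have "\<dots> = (\<Sum>n<N. complex_of_real (r ^ (2 * n)) * cinner (A (v n)) (v n))"
      by (intro sum.cong refl) (simp del: of_real_power)
    finally show ?thesis .
  qed
  define hw where "hw t = cinner (A (w t)) (w t)" for t
  have h_lim: "(\<lambda>N. h N t) \<longlonglongrightarrow> hw t" for t
    unfolding h_def hw_def by (intro tendsto_cinner A.tendsto w_lim)
  have h_bd: "norm (h N t) \<le> K * W * W" for N t
  proof -
    have "norm (h N t) \<le> norm (A (wN N t)) * norm (wN N t)" unfolding h_def by (rule cmod_cinner_le)
    also have "\<dots> \<le> (K * norm (wN N t)) * norm (wN N t)" by (intro mult_right_mono K) simp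
    also have "\<dots> \<le> K * W * W" using K(1) W wN_bd by (intro mult_mono mult_left_mono) auto
    finally show ?thesis .
  qed
  have fin: "finite_measure angle_measure" by (rule prob_space.finite_measure[OF prob_space_angle_measure])
  have meas: "hw \<in> borel_measurable angle_measure"
    by (rule borel_measurable_LIMSEQ_metric[OF borel_measurable_integrable[OF int] h_lim])
  have hw_bd: "norm (hw t) \<le> K * W * W" for t
    by (rule tendsto_upperbound[OF tendsto_norm[OF h_lim]]) (simp_all add: h_bd)
  have int_hw: "integrable angle_measure hw"
    by (rule finite_measure.integrable_const_bound[OF fin AE_I2[OF hw_bd] meas])
  have "(\<lambda>N. LINT t|angle_measure. h N t) \<longlonglongrightarrow> (LINT t|angle_measure. hw t)"
    by (rule integral_dominated_convergence[OF meas borel_measurable_integrable[OF int]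
          finite_measure.integrable_const[OF fin] AE_I2[OF h_lim] AE_I2[OF h_bd]])
  from tendsto_Re[OF this[unfolded h_int]]
  have sums: "(\<lambda>n. r ^ (2 * n) * Re (cinner (A (v n)) (v n))) sums Re (LINT t|angle_measure. hw t)"
    unfolding sums_def by (simp del: of_real_power)
  have "(\<integral>\<^sup>+t. ennreal (Re (hw t)) \<partial>angle_measure) = ennreal (LINT t|angle_measure. Re (hw t))"
    by (rule nn_integral_eq_integral[OF integrable_Re[OF int_hw]]) (rule AE_I2, simp add: hw_def nn)
  also have "(LINT t|angle_measure. Re (hw t)) = (\<Sum>n. r ^ (2 * n) * Re (cinner (A (v n)) (v n)))"
    unfolding integral_Re[OF int_hw] by (rule sums_unique[OF sums])
  also have "ennreal \<dots> = (\<Sum>n. ennreal (r ^ (2 * n) * Re (cinner (A (v n)) (v n))))"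
    by (rule suminf_ennreal2[symmetric]) (use r nn sums_summable[OF sums] in auto)
  finally show ?thesis by (simp only: hw_def)
qed

subsection \<open>Power series in two variables\<close>

lemma prod_bound_summable_on:
  fixes F :: "nat \<Rightarrow> nat \<Rightarrow> 'a::banach"
  assumes F: "\<And>m n. norm (F m n) \<le> b m * c n" and b: "summable b" "\<And>m. 0 \<le> b m" and c: "summable c" "\<And>n. 0 \<le> c n"
  shows "(\<lambda>(m, n). F m n) summable_on UNIV"
proof (rule Infinite_Sum.abs_summable_summable, rule Infinite_Sum.abs_summable_on_comparison_test')
  have cs: "(c has_sum suminf c) UNIV"
    using c by (intro norm_summable_imp_has_sum) (auto intro: summable_sums)
  have bs: "b summable_on UNIV"
    using b by (intro norm_summable_imp_summable_on) auto
  have "(\<lambda>(m, n). b m * c n) summable_on Sigma UNIV (\<lambda>_. UNIV)"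
  proof (rule summable_on_SigmaI)
    show "((\<lambda>n. case (m, n) of (m, n) \<Rightarrow> b m * c n) has_sum b m * suminf c) UNIV" for m
      using has_sum_cmult_right[OF cs, of "b m"] by simp
    show "(\<lambda>m. b m * suminf c) summable_on UNIV" using bs by (rule summable_on_cmult_left)
  qed (use b c in auto)
  then show "(\<lambda>(m, n). b m * c n) summable_on UNIV" by simp
qed (use F in auto)

text \<open>Turns an unordered sum over pairs into an iterated series, the form in which one
  variable can be held fixed.\<close>

lemma double_series:
  fixes F :: "nat \<Rightarrow> nat \<Rightarrow> 'a::banach"
  assumes F: "\<And>m n. norm (F m n) \<le> b m * c n" and b: "summable b" "\<And>m. 0 \<le> b m" and c: "summable c" "\<And>n. 0 \<le> c n"
    and S: "((\<lambda>(m, n). F m n) has_sum S) UNIV"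
  shows "(\<lambda>m. \<Sum>n. F m n) sums S" "summable (\<lambda>n. F m n)"
proof -
  have row: "((\<lambda>n. F m n) has_sum (\<Sum>n. F m n)) UNIV" and sm: "summable (\<lambda>n. F m n)" for m
  proof -
    have "summable (\<lambda>n. norm (F m n))"
      by (rule summable_comparison_test'[OF summable_mult[OF c(1), of "b m"], where N=0]) (use F in auto)
    then show "((\<lambda>n. F m n) has_sum (\<Sum>n. F m n)) UNIV" "summable (\<lambda>n. F m n)"
      by (auto intro: norm_summable_imp_has_sum summable_norm_cancel summable_sums)
  qed
  have "((\<lambda>m. \<Sum>n. F m n) has_sum S) UNIV"
    by (rule has_sum_SigmaD[where f="\<lambda>(m, n). F m n" and B="\<lambda>_. UNIV"]) (use S row in auto)
  then show "(\<lambda>m. \<Sum>n. F m n) sums S" by (rule has_sum_imp_sums)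
  show "summable (\<lambda>n. F m n)" by (rule sm)
qed

lemma has_sum_swap_pairs:
  "((\<lambda>(m, n). F m n) has_sum S) (UNIV :: (nat \<times> nat) set) \<longleftrightarrow> ((\<lambda>(n, m). F m n) has_sum S) UNIV"
proof -
  have "((\<lambda>(n, m). F m n) has_sum S) (range prod.swap) \<longleftrightarrow> ((\<lambda>(n, m). F m n) \<circ> prod.swap has_sum S) UNIV"
    by (rule has_sum_reindex) (rule inj_swap)
  moreover have "(\<lambda>(n, m). F m n) \<circ> prod.swap = (\<lambda>(m, n). F m n)" by auto
  moreover have "range prod.swap = (UNIV :: (nat \<times> nat) set)" by (rule surj_swap)
  ultimately show ?thesis by (simp only:)
qed

lemma square_summable_bounded:
  fixes a :: "'b \<Rightarrow> 'a::real_normed_vector"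
  assumes "(\<lambda>k. (norm (a k))\<^sup>2) summable_on UNIV"
  obtains B where "\<And>k. norm (a k) \<le> B"
proof -
  have "norm (a k) \<le> sqrt (infsum (\<lambda>k. (norm (a k))\<^sup>2) UNIV)" for k
  proof (rule real_le_rsqrt)
    have "sum (\<lambda>k. (norm (a k))\<^sup>2) {k} \<le> infsum (\<lambda>k. (norm (a k))\<^sup>2) UNIV"
      by (rule finite_sum_le_infsum[OF assms]) auto
    then show "(norm (a k))\<^sup>2 \<le> infsum (\<lambda>k. (norm (a k))\<^sup>2) UNIV" by simp
  qed
  then show ?thesis using that by blast
qed

lemma power_series_summable_on:
  fixes a :: "nat \<times> nat \<Rightarrow> 'a::chilbert_space"
  assumes a: "\<And>k. norm (a k) \<le> B" and z: "z1 \<in> ball 0 1" "z2 \<in> ball 0 1"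
  shows "(\<lambda>(m, n). (z1 ^ m * z2 ^ n) *\<^sub>C a (m, n)) summable_on UNIV"
    and "norm ((z1 ^ m * z2 ^ n) *\<^sub>C a (m, n)) \<le> cmod z1 ^ m * (cmod z2 ^ n * B)"
proof -
  have B: "0 \<le> B" using a norm_ge_zero order_trans by blast
  show *: "norm ((z1 ^ m * z2 ^ n) *\<^sub>C a (m, n)) \<le> cmod z1 ^ m * (cmod z2 ^ n * B)" for m n
    using a[of "(m, n)"] by (simp add: norm_mult norm_power mult.assoc mult_left_mono)
  show "(\<lambda>(m, n). (z1 ^ m * z2 ^ n) *\<^sub>C a (m, n)) summable_on UNIV"
    by (rule prod_bound_summable_on[OF *]) (use z B in \<open>auto intro!: summable_geometric summable_mult2\<close>)
qed

lemma norm_deriv_series_diff: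
  fixes c :: "nat \<Rightarrow> 'a::chilbert_space"
  assumes c: "\<And>k. norm (c k) \<le> B" and z: "cmod z \<le> R" and R: "0 \<le> R" "R < 1"
  shows "norm (deriv_series c z - deriv_partial N c z) \<le> (\<Sum>k. real (Suc (k + N)) * R ^ (k + N)) * B"
proof -
  have B: "0 \<le> B" using c norm_ge_zero order_trans by blast
  have s: "summable (\<lambda>k. norm ((of_nat (Suc k) * z ^ k) *\<^sub>C c (Suc k)))"
    by (rule summable_norm_deriv_series[OF c]) (use z R in auto)
  have s': "summable (\<lambda>k. real (Suc (k + N)) * R ^ (k + N))"
    using summable_ignore_initial_segment[OF summable_Suc_power[OF R], of N] .
  have "deriv_series c z - deriv_partial N c z = (\<Sum>k. (of_nat (Suc (k + N)) * z ^ (k + N)) *\<^sub>C c (Suc (k + N)))"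
    unfolding deriv_series_def deriv_partial_def by (rule suminf_minus_initial_segment[OF summable_norm_cancel[OF s], symmetric])
  also have "norm \<dots> \<le> (\<Sum>k. real (Suc (k + N)) * R ^ (k + N) * B)"
  proof (rule norm_suminf_le)
    show "norm ((of_nat (Suc (k + N)) * z ^ (k + N)) *\<^sub>C c (Suc (k + N))) \<le> real (Suc (k + N)) * R ^ (k + N) * B" for k
      unfolding norm_scaleC norm_mult norm_power norm_of_nat
      using c[of "Suc (k + N)"] z R by (intro mult_mono power_mono) auto
    show "summable (\<lambda>k. real (Suc (k + N)) * R ^ (k + N) * B)" by (rule summable_mult2[OF s'])
  qed
  also have "\<dots> = (\<Sum>k. real (Suc (k + N)) * R ^ (k + N)) * B" by (rule suminf_mult2[OF s', symmetric])
  finally show ?thesis .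
qed

lemma complex_deriv_eq:
  assumes "(g has_derivative (\<lambda>h. h *\<^sub>C d)) (at z)"
  shows "complex_deriv g z = d"
  unfolding complex_deriv_def
proof (rule the_equality)
  fix d' assume "(g has_derivative (\<lambda>h. h *\<^sub>C d')) (at z)"
  from fun_cong[OF has_derivative_unique[OF this assms], of 1] show "d' = d" by simp
qed (rule assms)

text \<open>Termwise differentiation on a ball around 0 whose radius lies strictly between
  \<open>cmod z\<close> and 1, where the tails of the derived series are uniformly small.\<close>

lemma power_series_has_derivative:
  fixes c :: "nat \<Rightarrow> 'a::chilbert_space"
  assumes c: "\<And>k. norm (c k) \<le> B" and f: "\<And>w. w \<in> ball 0 1 \<Longrightarrow> (\<lambda>m. w ^ m *\<^sub>C c m) sums f w"
    and z: "z \<in> ball 0 1"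
  shows "(f has_derivative (\<lambda>h. h *\<^sub>C deriv_series c z)) (at z)"
proof -
  define R where "R = (1 + cmod z) / 2"
  have R: "0 \<le> R" "R < 1" "z \<in> ball 0 R" using z by (auto simp: R_def)
  have B: "0 \<le> B" using c norm_ge_zero order_trans by blast
  define f' where "f' m w h = (h * (of_nat m * w ^ (m - 1))) *\<^sub>C c m" for m and w h :: complex
  have "\<exists>g. \<forall>x\<in>ball 0 R. (\<lambda>n. x ^ n *\<^sub>C c n) sums g x \<and> (g has_derivative (\<lambda>h. h *\<^sub>C deriv_series c x)) (at x within ball 0 R)"
  proof (rule has_derivative_series[where f'=f'])
    show "((\<lambda>w. w ^ m *\<^sub>C c m) has_derivative f' m w) (at w within ball 0 R)" for m w
      unfolding f'_def
      by (rule bounded_linear.has_derivative[OF bounded_linear_scaleC_left])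
        (auto intro!: derivative_eq_intros simp: mult_ac)
    show "(\<lambda>n. z ^ n *\<^sub>C c n) sums f z" by (rule f[OF z])
    fix e :: real assume e: "e > 0"
    obtain N0 where N0: "\<And>N. N \<ge> N0 \<Longrightarrow> norm (\<Sum>k. real (Suc (k + N)) * R ^ (k + N)) < e / (B + 1)"
      using suminf_exist_split[OF _ summable_Suc_power[OF R(1,2)], of "e / (B + 1)"] e B by auto
    have "norm (sum (\<lambda>i. f' i w h) {..<Suc N} - h *\<^sub>C deriv_series c w) \<le> e * norm h"
      if N: "N \<ge> N0" and w: "w \<in> ball 0 R" for N w h
    proof -
      have "sum (\<lambda>i. f' i w h) {..<Suc N} = h *\<^sub>C deriv_partial N c w"
        unfolding sum.lessThan_Suc_shift deriv_partial_def scaleC_sum_right by (simp add: f'_def scaleC_scaleC)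
      then have "norm (sum (\<lambda>i. f' i w h) {..<Suc N} - h *\<^sub>C deriv_series c w) = norm h * norm (deriv_series c w - deriv_partial N c w)"
        by (simp add: scaleC_diff_right[symmetric] norm_minus_commute)
      also have "\<dots> \<le> norm h * e"
      proof (rule mult_left_mono)
        have "norm (deriv_series c w - deriv_partial N c w) \<le> (\<Sum>k. real (Suc (k + N)) * R ^ (k + N)) * B"
          by (rule norm_deriv_series_diff[where c=c, OF c _ R(1,2)]) (use w in auto)
      also have "(\<Sum>k. real (Suc (k + N)) * R ^ (k + N)) * B \<le> (e / (B + 1)) * (B + 1)"
        using N0[OF N] B e by (intro mult_mono) auto
      also have "\<dots> = e" using B by simp
      finally show "norm (deriv_series c w - deriv_partial N c w) \<le> e" .
      qed simp
      finally show ?thesis by (simp only: mult.commute)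
    qed
    then have "\<forall>\<^sub>F N in sequentially. \<forall>w\<in>ball 0 R. \<forall>h. norm (sum (\<lambda>i. f' i w h) {..<Suc N} - h *\<^sub>C deriv_series c w) \<le> e * norm h"
      unfolding eventually_sequentially by (intro exI[of _ N0]) blast
    then show "\<forall>\<^sub>F N in sequentially. \<forall>w\<in>ball 0 R. \<forall>h. norm (sum (\<lambda>i. f' i w h) {..<N} - h *\<^sub>C deriv_series c w) \<le> e * norm h"
      by (rule eventually_sequentially_Suc[THEN iffD1])
  qed (use R in auto)
  then obtain g where g: "\<And>x. x \<in> ball 0 R \<Longrightarrow> (\<lambda>n. x ^ n *\<^sub>C c n) sums g x"
    and gd: "\<And>x. x \<in> ball 0 R \<Longrightarrow> (g has_derivative (\<lambda>h. h *\<^sub>C deriv_series c x)) (at x within ball 0 R)" by blast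
  have "(g has_derivative (\<lambda>h. h *\<^sub>C deriv_series c z)) (at z)"
    using gd[OF R(3)] R(3) by (simp add: at_within_open[OF R(3) open_ball])
  then show ?thesis
  proof (rule has_derivative_transform_within_open[OF _ open_ball R(3)])
    show "g x = f x" if "x \<in> ball 0 R" for x
      by (rule sums_unique2[OF g[OF that] f]) (use that R in auto)
  qed
qed

text \<open>For fixed \<open>z2\<close> the function is a power series in the first variable and can
  be differentiated termwise. Exchanging the two absolutely convergent sums then exhibits the
  derivative as a power series in \<open>z2\<close>, as Parseval's identity requires.\<close>

lemma has_power_series_partial1:
  fixes a :: "nat \<times> nat \<Rightarrow> 'a::chilbert_space"
  assumes f: "has_power_series f a" and a: "\<And>k. norm (a k) \<le> B" and z: "z1 \<in> ball 0 1" "z2 \<in> ball 0 1"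
  shows "partial1 f (z1, z2) = (\<Sum>n. z2 ^ n *\<^sub>C deriv_series (\<lambda>m. a (m, n)) z1)"
proof -
  have B: "0 \<le> B" using a norm_ge_zero order_trans by blast
  define c where "c m = (\<Sum>n. z2 ^ n *\<^sub>C a (m, n))" for m
  have geo: "summable (\<lambda>n. cmod z2 ^ n * B)" "summable (\<lambda>n. cmod z2 ^ n)"
    using z by (auto intro!: summable_mult2 summable_geometric)
  have nb: "norm (z2 ^ n *\<^sub>C a (m, n)) \<le> cmod z2 ^ n * B" for m n
    using a[of "(m, n)"] by (simp add: norm_power mult_left_mono)
  have cs: "summable (\<lambda>n. z2 ^ n *\<^sub>C a (m, n))" for m
    by (rule summable_comparison_test'[OF geo(1), where N=0]) (rule nb)
  have cb: "norm (c m) \<le> (\<Sum>n. cmod z2 ^ n * B)" for m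
    unfolding c_def by (rule norm_suminf_le[OF nb geo(1)])
  have fs: "(\<lambda>m. w ^ m *\<^sub>C c m) sums f (w, z2)" if w: "w \<in> ball 0 1" for w
  proof -
    have "((\<lambda>(m, n). (w ^ m * z2 ^ n) *\<^sub>C a (m, n)) has_sum f (w, z2)) UNIV"
      using f w z by (auto simp: has_power_series_def)
    from double_series(1)[where F="\<lambda>m n. (w ^ m * z2 ^ n) *\<^sub>C a (m, n)",
        OF power_series_summable_on(2)[where a=a, OF a w z(2)] _ _ geo(1) _ this]
    have "(\<lambda>m. \<Sum>n. (w ^ m * z2 ^ n) *\<^sub>C a (m, n)) sums f (w, z2)"
      using w B by (simp add: summable_geometric)
    moreover have "(\<Sum>n. (w ^ m * z2 ^ n) *\<^sub>C a (m, n)) = w ^ m *\<^sub>C c m" for m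
      unfolding c_def scaleC_scaleC[symmetric]
      by (rule bounded_linear.suminf[OF bounded_linear_scaleC_right cs, symmetric])
    ultimately show ?thesis by simp
  qed
  have p: "partial1 f (z1, z2) = deriv_series c z1"
    unfolding partial1_def prod.case
    by (rule complex_deriv_eq, rule power_series_has_derivative[where c=c and f="\<lambda>w. f (w, z2)"])
      (rule cb, erule fs, rule z)
  define G where "G k n = (of_nat (Suc k) * z1 ^ k * z2 ^ n) *\<^sub>C a (Suc k, n)" for k n
  define b where "b k = real (Suc k) * cmod z1 ^ k" for k
  have b: "summable b" "0 \<le> b k" for k unfolding b_def using z by (auto intro!: summable_Suc_power simp del: of_nat_Suc)
  have bc: "0 \<le> cmod z2 ^ n * B" for n using B by simp
  have Gb: "norm (G k n) \<le> b k * (cmod z2 ^ n * B)" for k n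
  proof -
    have "norm (G k n) = b k * (cmod z2 ^ n * norm (a (Suc k, n)))"
      unfolding G_def b_def norm_scaleC norm_mult norm_power norm_of_nat by (simp only: mult.assoc)
    also have "\<dots> \<le> b k * (cmod z2 ^ n * B)" using a b(2) by (intro mult_left_mono) auto
    finally show ?thesis .
  qed
  have hs: "((\<lambda>(k, n). G k n) has_sum infsum (\<lambda>(k, n). G k n) UNIV) UNIV"
    by (rule has_sum_infsum[OF prod_bound_summable_on[OF Gb b geo(1) bc]])
  have 1: "(\<lambda>k. \<Sum>n. G k n) sums infsum (\<lambda>(k, n). G k n) UNIV"
    by (rule double_series(1)[OF Gb b geo(1) bc hs])
  have 2: "(\<lambda>n. \<Sum>k. G k n) sums infsum (\<lambda>(k, n). G k n) UNIV"
  proof (rule double_series(1)[OF _ geo(1) bc b])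
    show "norm (G k n) \<le> (cmod z2 ^ n * B) * b k" for n k using Gb[of k n] by (simp only: mult.commute)
    show "((\<lambda>(n, k). G k n) has_sum infsum (\<lambda>(k, n). G k n) UNIV) UNIV"
      by (rule has_sum_swap_pairs[THEN iffD1, OF hs])
  qed
  have "(\<Sum>n. G k n) = (of_nat (Suc k) * z1 ^ k) *\<^sub>C c (Suc k)" for k
  proof -
    have "G k n = (of_nat (Suc k) * z1 ^ k) *\<^sub>C z2 ^ n *\<^sub>C a (Suc k, n)" for n
      unfolding G_def scaleC_scaleC ..
    then show ?thesis unfolding c_def by (simp only: bounded_linear.suminf[OF bounded_linear_scaleC_right cs])
  qed
  moreover have "(\<Sum>k. G k n) = z2 ^ n *\<^sub>C deriv_series (\<lambda>m. a (m, n)) z1" for n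
  proof -
    have s: "summable (\<lambda>k. (of_nat (Suc k) * z1 ^ k) *\<^sub>C a (Suc k, n))"
      by (rule summable_norm_cancel[OF summable_norm_deriv_series[of "\<lambda>m. a (m, n)", OF a]]) (use z in auto)
    have "G k n = z2 ^ n *\<^sub>C (of_nat (Suc k) * z1 ^ k) *\<^sub>C a (Suc k, n)" for k
      unfolding G_def scaleC_scaleC by (simp only: mult_ac)
    then show ?thesis unfolding deriv_series_def
      by (simp only: bounded_linear.suminf[OF bounded_linear_scaleC_right s])
  qed
  ultimately show ?thesis
    unfolding p deriv_series_def[of c] using sums_unique[OF 1] sums_unique[OF 2] by (simp only:)
qed

section \<open>Uniqueness of the coefficients\<close>

lemma complex_power_series_zero:
  assumes "\<And>z. z \<in> ball 0 1 \<Longrightarrow> (\<lambda>n. z ^ n * e n) sums 0"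
  shows "e n = (0::complex)"
proof -
  have "summable (\<lambda>n. e n * (1/2) ^ n)"
    using sums_summable[OF assms[of "1/2"]] by (simp add: mult.commute)
  from conv_radius_geI[OF this] have "ereal (norm (1/2 :: complex)) \<le> fps_conv_radius (Abs_fps e)"
    unfolding fps_conv_radius_def by (simp only: fps_nth_Abs_fps[abs_def])
  then have r: "fps_conv_radius (Abs_fps e) > 0" by (rule order.strict_trans2[rotated]) simp
  have "\<forall>\<^sub>F z in nhds 0. eval_fps (Abs_fps e) z = eval_fps 0 z"
  proof (rule eventually_mono[OF eventually_nhds_in_open[OF open_ball, of 0 0 1]])
    show "eval_fps (Abs_fps e) z = eval_fps 0 z" if "z \<in> ball 0 1" for z
      using sums_unique[OF assms[OF that]] by (simp add: eval_fps_def mult.commute)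
  qed simp
  from eval_fps_eqD[OF r _ this] have "Abs_fps e = 0" by simp
  then show ?thesis by (metis fps_nth_Abs_fps fps_zero_nth)
qed

text \<open>Pairing with a vector makes the problem scalar. The one-variable statement applies first
  in \<open>z1\<close>, to the sums over rows, and then in \<open>z2\<close>. It justifies the
  definite description in \<open>hardy_norm_sq\<close>.\<close>

lemma has_power_series_unique:
  fixes a b :: "nat \<times> nat \<Rightarrow> 'a::chilbert_space"
  assumes "has_power_series f a" "has_power_series f b"
  shows "a = b"
proof -
  have "cinner (a (m, n)) y = cinner (b (m, n)) y" for m n y
  proof -
    define d where "d m n = cinner (a (m, n) - b (m, n)) y" for m n
    have hs: "((\<lambda>(m, n). z1 ^ m * (z2 ^ n * d m n)) has_sum 0) UNIV" if "z1 \<in> ball 0 1" "z2 \<in> ball 0 1" for z1 z2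
    proof -
      have "((\<lambda>(m, n). (z1 ^ m * z2 ^ n) *\<^sub>C a (m, n)) has_sum f (z1, z2)) UNIV"
        "((\<lambda>(m, n). (z1 ^ m * z2 ^ n) *\<^sub>C b (m, n)) has_sum f (z1, z2)) UNIV"
        using assms that by (auto simp: has_power_series_def)
      note hc = this[THEN has_sum_bounded_linear[OF bounded_linear_cinner_left[of y]]]
      from has_sum_add[OF hc(1) has_sum_cmult_right[OF hc(2), of "-1"]]
      show ?thesis
        by (simp add: comp_def d_def case_prod_unfold cinner_scaleC_left cinner_diff_left algebra_simps)
    qed
    have row: "(\<lambda>n. z2 ^ n * d m n) summable_on UNIV" if z2: "z2 \<in> ball 0 1" for m z2
    proof -
      \<comment> \<open>Any nonzero point of the disc would do for \<open>z1\<close>: it yields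
        convergence of each row, which is then freed from the factor
        \<open>(1/2) ^ m\<close>.\<close>
      have "(\<lambda>(m, n). (1/2) ^ m * (z2 ^ n * d m n)) summable_on Sigma UNIV (\<lambda>_. UNIV)"
        using hs[of "1/2" z2] z2 by (auto simp: summable_on_def norm_divide)
      from summable_on_SigmaD1[OF this, of m] have "(\<lambda>n. (1/2) ^ m * (z2 ^ n * d m n)) summable_on UNIV" by simp
      from summable_on_cmult_right[OF this, of "2 ^ m"] show ?thesis
        by (simp add: power_divide)
    qed
    have inf0: "infsum (\<lambda>n. z2 ^ n * d m n) UNIV = 0" if z2: "z2 \<in> ball 0 1" for m z2
    proof (rule complex_power_series_zero)
      fix z1 :: complex assume z1: "z1 \<in> ball 0 1"
      have "((\<lambda>m. z1 ^ m * infsum (\<lambda>n. z2 ^ n * d m n) UNIV) has_sum 0) UNIV"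
        by (rule has_sum_SigmaD[where f="\<lambda>(m, n). z1 ^ m * (z2 ^ n * d m n)" and B="\<lambda>_. UNIV"])
          (use hs[OF z1 z2] has_sum_cmult_right[OF has_sum_infsum[OF row[OF z2]]] in auto)
      then show "(\<lambda>m. z1 ^ m * infsum (\<lambda>n. z2 ^ n * d m n) UNIV) sums 0" by (rule has_sum_imp_sums)
    qed
    have "(\<lambda>n. z2 ^ n * d m n) sums 0" if "z2 \<in> ball 0 1" for m z2
      using has_sum_imp_sums[OF has_sum_infsum[OF row[OF that, of m]]] unfolding inf0[OF that] .
    then have "d m n = 0" by (rule complex_power_series_zero)
    then show ?thesis by (simp add: d_def cinner_diff_left)
  qed
  then have eq: "a (m, n) = b (m, n)" for m n by (rule cinner_eqI)
  show ?thesis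
  proof
    show "a p = b p" for p using eq[of "fst p" "snd p"] by simp
  qed
qed

subsection \<open>The Dirichlet integral in two variables\<close>

text \<open>Finite partial sums bound the limit from below and monotonicity bounds it from above.
  Infinite values are included, so the limits in \<open>dirichlet_integral\<close> exist whether or
  not the integral is finite.\<close>

lemma abel_limit_ennreal:
  fixes x :: "nat \<Rightarrow> ennreal"
  shows "((\<lambda>r. \<Sum>n. ennreal (r ^ (2 * n)) * x n) \<longlongrightarrow> (\<Sum>n. x n)) (at_left (1::real))"
proof (rule order_tendstoI)
  have ev: "\<forall>\<^sub>F r in at_left (1::real). 0 < r \<and> r < 1"
    using eventually_at_left_real[of 0 1] by (auto elim: eventually_mono)
  {
    fix c assume "c < (\<Sum>n. x n)"
    then obtain N where N: "c < (\<Sum>n<N. x n)"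
      unfolding suminf_eq_SUP by (auto simp: less_SUP_iff)
    have "((\<lambda>r. \<Sum>n<N. ennreal (r ^ (2 * n)) * x n) \<longlongrightarrow> (\<Sum>n<N. ennreal (1 ^ (2 * n)) * x n)) (at_left (1::real))"
      by (intro tendsto_sum tendsto_mult_ennreal tendsto_ennrealI tendsto_power tendsto_ident_at tendsto_const) simp
    then have "\<forall>\<^sub>F r in at_left (1::real). c < (\<Sum>n<N. ennreal (r ^ (2 * n)) * x n)"
      using N by (intro order_tendstoD(1)) auto
    then show "\<forall>\<^sub>F r in at_left 1. c < (\<Sum>n. ennreal (r ^ (2 * n)) * x n)"
      by (rule eventually_mono) (rule less_le_trans, assumption, rule sum_le_suminf, auto)
  next
    fix c assume c: "(\<Sum>n. x n) < c"
    show "\<forall>\<^sub>F r in at_left 1. (\<Sum>n. ennreal (r ^ (2 * n)) * x n) < c"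
      using ev
    proof eventually_elim
      case (elim r)
      have "ennreal (r ^ (2 * n)) * x n \<le> 1 * x n" for n
        using elim by (intro mult_right_mono) (auto simp: power_le_one)
      then have "(\<Sum>n. ennreal (r ^ (2 * n)) * x n) \<le> (\<Sum>n. x n)"
        by (intro suminf_le) (simp_all del: ennreal_suminf_multc)
      then show ?case using c by (rule order.strict_trans1)
    qed
  }
qed

lemma has_power_series_swap:
  assumes "has_power_series f a"
  shows "has_power_series (f \<circ> prod.swap) (a \<circ> prod.swap)"
  unfolding has_power_series_def
proof safe
  fix z1 z2 :: complex assume z: "z1 \<in> ball 0 1" "z2 \<in> ball 0 1"
  then have "((\<lambda>(m, n). (z2 ^ m * z1 ^ n) *\<^sub>C a (m, n)) has_sum f (z2, z1)) UNIV"
    using assms by (auto simp: has_power_series_def)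
  from has_sum_swap_pairs[THEN iffD1, OF this]
  show "((\<lambda>(m, n). (z1 ^ m * z2 ^ n) *\<^sub>C (a \<circ> prod.swap) (m, n)) has_sum (f \<circ> prod.swap) (z1, z2)) UNIV"
    by (simp add: mult.commute)
qed

lemma partial2_eq_partial1_swap: "partial2 f (z1, z2) = partial1 (f \<circ> prod.swap) (z2, z1)"
  by (simp add: partial1_def partial2_def)

text \<open>\<open>L_E\<close> puts coefficients from \<open>E\<close> into the kernel of
  \<open>L\<close>, as \<open>energy_poly\<close> requires of them.\<close>

locale dirichlet_model = pure_spectral_family T D L M + compressed_spectral_family T D M E pr
  for T D L :: "'a::chilbert_space \<Rightarrow> 'a" and M E pr +
  assumes L_E: "x \<in> E \<Longrightarrow> L x = 0"
begin

lemma E_suminf: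
  assumes "summable f" "\<And>n. f n \<in> E" shows "suminf f \<in> E"
proof -
  interpret pr: bounded_op pr unfolding bounded_op_def by (rule pr)
  have "pr (suminf f) = (\<Sum>n. pr (f n))" by (rule bounded_linear.suminf[OF pr.bounded_linear assms(1)])
  also have "\<dots> = suminf f" using assms(2) by (simp add: pr_id)
  finally show ?thesis using pr_in by metis
qed

lemma scaleC_E: "x \<in> E \<Longrightarrow> c *\<^sub>C x \<in> E"
  using E by (auto simp: hilbert_subspace_def)

definition dirichlet_half :: "(complex \<times> complex \<Rightarrow> 'a) \<Rightarrow> real \<Rightarrow> ennreal" where
  "dirichlet_half f r = (\<integral>\<^sup>+ z1. \<integral>\<^sup>+ t. ennreal (Re (cinner
     (poisson_integral E op_measure z1 (partial1 f (z1, complex_of_real r * cis t)))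
     (partial1 f (z1, complex_of_real r * cis t)))) \<partial>angle_measure \<partial>area_measure)"

text \<open>For fixed \<open>z1\<close> the partial derivative is a power series in the second
  variable with coefficients in \<open>E\<close>. Parseval's identity for the positive form of
  \<open>poisson_op z1\<close> evaluates the inner integral and reduces the outer one to
  one-variable Dirichlet integrals.\<close>

lemma dirichlet_half_eq:
  assumes f: "has_power_series f a" and aE: "range a \<subseteq> E" and a: "\<And>k. norm (a k) \<le> B" and r: "0 < r" "r < 1"
  shows "dirichlet_half f r = (\<Sum>n. ennreal (r ^ (2 * n)) * dirichlet_energy (\<lambda>m. a (m, n)))"
proof -
  define v where "v z n = deriv_series (\<lambda>m. a (m, n)) z" for z n
  define Q where "Q z n = Re (cinner (poisson_op z (v z n)) (v z n))" for z n
  have aE': "a k \<in> E" for k using aE by auto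
  have inner: "(\<integral>\<^sup>+ t. ennreal (Re (cinner
     (poisson_integral E op_measure z (partial1 f (z, complex_of_real r * cis t)))
     (partial1 f (z, complex_of_real r * cis t)))) \<partial>angle_measure) = (\<Sum>n. ennreal (r ^ (2 * n)) * ennreal (Q z n))"
    if z: "z \<in> ball 0 1" for z
  proof -
    have z': "cmod z < 1" using z by simp
    define V where "V = (\<Sum>k. real (Suc k) * cmod z ^ k) * B"
    have vV: "norm (v z n) \<le> V" for n
    proof -
      have "norm (deriv_partial N (\<lambda>m. a (m, n)) z) \<le> V" for N
        unfolding V_def by (rule norm_deriv_partial_le[where a="\<lambda>m. a (m, n)", OF a order_refl z'])
      then show ?thesis
        unfolding v_def
        by (intro tendsto_upperbound[OF tendsto_norm[OF deriv_partial_tendsto[where a="\<lambda>m. a (m, n)", OF a z']]]) simp_all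
    qed
    have vE: "v z n \<in> E" for n
      unfolding v_def deriv_series_def
      by (intro E_suminf summable_norm_cancel[OF summable_norm_deriv_series[where a="\<lambda>m. a (m, n)", OF a z']] scaleC_E aE')
    define w where "w t = (\<Sum>n. (complex_of_real r * cis t) ^ n *\<^sub>C v z n)" for t
    have wE: "w t \<in> E" for t
      unfolding w_def
    proof (intro E_suminf scaleC_E vE)
      show "summable (\<lambda>n. (complex_of_real r * cis t) ^ n *\<^sub>C v z n)"
      proof (rule summable_comparison_test'[where N=0])
        show "summable (\<lambda>n. r ^ n * V)" using r by (intro summable_mult2 summable_geometric) auto
        show "norm ((complex_of_real r * cis t) ^ n *\<^sub>C v z n) \<le> r ^ n * V" for n
          using r vV by (simp add: norm_mult norm_power mult_left_mono)
      qed
    qed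
    have pw: "partial1 f (z, complex_of_real r * cis t) = w t" for t
      unfolding w_def v_def by (rule has_power_series_partial1[OF f a z]) (use r in \<open>simp add: norm_mult\<close>)
    have "(\<integral>\<^sup>+ t. ennreal (Re (cinner (poisson_integral E op_measure z (w t)) (w t))) \<partial>angle_measure) =
      (\<integral>\<^sup>+ t. ennreal (Re (cinner (poisson_op z (w t)) (w t))) \<partial>angle_measure)"
      by (simp only: cinner_poisson_integral[OF z wE])
    also have "\<dots> = (\<Sum>n. ennreal (r ^ (2 * n) * Q z n))"
      unfolding w_def Q_def
      by (rule parseval_form[OF bounded_clinear_poisson_op[OF z] cinner_poisson_op_nonneg[OF z] vV]) (use r in auto)
    also have "\<dots> = (\<Sum>n. ennreal (r ^ (2 * n)) * ennreal (Q z n))"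
    proof -
      have "0 \<le> Q z n" for n unfolding Q_def by (rule cinner_poisson_op_nonneg[OF z])
      then show ?thesis using r by (simp add: ennreal_mult)
    qed
    finally show ?thesis unfolding pw .
  qed
  have dm: "(\<lambda>z. ennreal (Q z n) * indicator (ball 0 1) z) \<in> borel_measurable area_measure" for n
    unfolding Q_def v_def by (rule dirichlet_energy_measurable[where a="\<lambda>m. a (m, n)", OF a L_E[OF aE']])
  have "dirichlet_half f r = (\<integral>\<^sup>+ z. (\<Sum>n. ennreal (r ^ (2 * n)) * (ennreal (Q z n) * indicator (ball 0 1) z)) \<partial>area_measure)"
    unfolding dirichlet_half_def
  proof (rule nn_integral_cong_AE, rule AE_mp[OF AE_area_measure], rule AE_I2, rule impI)
    fix z :: complex assume z: "z \<in> ball 0 1"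
    show "(\<integral>\<^sup>+ t. ennreal (Re (cinner
     (poisson_integral E op_measure z (partial1 f (z, complex_of_real r * cis t)))
     (partial1 f (z, complex_of_real r * cis t)))) \<partial>angle_measure) = (\<Sum>n. ennreal (r ^ (2 * n)) * (ennreal (Q z n) * indicator (ball 0 1) z))"
      unfolding inner[OF z] using z by simp
  qed
  also have "\<dots> = (\<Sum>n. \<integral>\<^sup>+ z. ennreal (r ^ (2 * n)) * (ennreal (Q z n) * indicator (ball 0 1) z) \<partial>area_measure)"
    by (intro nn_integral_suminf borel_measurable_times_ennreal[OF borel_measurable_const dm])
  also have "\<dots> = (\<Sum>n. ennreal (r ^ (2 * n)) * dirichlet_energy (\<lambda>m. a (m, n)))"
    unfolding nn_integral_cmult[OF dm] by (simp only: Q_def v_def dirichlet_energy_def)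
  finally show ?thesis .
qed

lemma Lim_dirichlet_half:
  assumes "has_power_series f a" "range a \<subseteq> E" "\<And>k. norm (a k) \<le> B"
  shows "Lim (at_left 1) (dirichlet_half f) = (\<Sum>n. dirichlet_energy (\<lambda>m. a (m, n)))"
proof (rule tendsto_Lim)
  show "(dirichlet_half f \<longlongrightarrow> (\<Sum>n. dirichlet_energy (\<lambda>m. a (m, n)))) (at_left 1)"
  proof (rule Lim_transform_eventually[OF abel_limit_ennreal])
    have "\<forall>\<^sub>F r in at_left (1::real). 0 < r \<and> r < 1"
      using eventually_at_left_real[of 0 1] by (auto elim: eventually_mono)
    then show "\<forall>\<^sub>F r in at_left 1. (\<Sum>n. ennreal (r ^ (2 * n)) * dirichlet_energy (\<lambda>m. a (m, n))) = dirichlet_half f r"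
      by eventually_elim (use dirichlet_half_eq[OF assms] in auto)
  qed
qed simp

end

text \<open>Swapping the variables turns the second half of the integral into the first half for the
  transposed coefficients.\<close>

lemma dirichlet_integral_eq:
  assumes 1: "dirichlet_model T1 D1 L1 M1 E pr" and 2: "dirichlet_model T2 D2 L2 M2 E pr"
    and f: "has_power_series f a" and aE: "range a \<subseteq> E" and a: "\<And>k. norm (a k) \<le> B"
  shows "dirichlet_integral E (compressed_spectral_family.op_measure M1 pr) (compressed_spectral_family.op_measure M2 pr) f =
    (\<Sum>n. pure_spectral_family.dirichlet_energy M1 (\<lambda>m. a (m, n))) +
    (\<Sum>m. pure_spectral_family.dirichlet_energy M2 (\<lambda>n. a (m, n)))"
proof -
  interpret A: dirichlet_model T1 D1 L1 M1 E pr by fact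
  interpret B: dirichlet_model T2 D2 L2 M2 E pr by fact
  have "dirichlet_integral E A.op_measure B.op_measure f =
      Lim (at_left 1) (A.dirichlet_half f) + Lim (at_left 1) (B.dirichlet_half (f \<circ> prod.swap))"
    unfolding dirichlet_integral_def A.dirichlet_half_def[abs_def] B.dirichlet_half_def[abs_def] partial2_eq_partial1_swap ..
  moreover have "Lim (at_left 1) (A.dirichlet_half f) = (\<Sum>n. A.dirichlet_energy (\<lambda>m. a (m, n)))"
    by (rule A.Lim_dirichlet_half[OF f aE a])
  moreover have "Lim (at_left 1) (B.dirichlet_half (f \<circ> prod.swap)) = (\<Sum>n. B.dirichlet_energy (\<lambda>m. (a \<circ> prod.swap) (m, n)))"
    by (rule B.Lim_dirichlet_half[OF has_power_series_swap[OF f]]) (use aE a in auto)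
  ultimately show ?thesis by simp
qed

subsection \<open>Toral pairs\<close>

lemma suminf_ennreal_swap: "(\<Sum>m. \<Sum>n. f m n) = (\<Sum>n. \<Sum>m. f m n :: ennreal)"
proof -
  have "(\<Sum>m. \<Sum>n. f m n) = (\<integral>\<^sup>+m. (\<Sum>n. f m n) \<partial>count_space UNIV)" by (simp add: nn_integral_count_space_nat)
  also have "\<dots> = (\<Sum>n. \<integral>\<^sup>+m. f m n \<partial>count_space UNIV)" by (rule nn_integral_suminf) simp
  finally show ?thesis by (simp add: nn_integral_count_space_nat)
qed

lemma infsum_pairs_ennreal:
  fixes f :: "nat \<Rightarrow> nat \<Rightarrow> real"
  assumes nn: "\<And>m n. 0 \<le> f m n" and fin: "(\<Sum>m. \<Sum>n. ennreal (f m n)) < \<infinity>"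
  shows "(\<lambda>(m, n). f m n) summable_on UNIV"
    and "ennreal (infsum (\<lambda>(m, n). f m n) UNIV) = (\<Sum>m. \<Sum>n. ennreal (f m n))"
proof -
  have row_fin: "(\<Sum>n. ennreal (f m n)) < \<infinity>" for m
  proof -
    have "(\<Sum>n. ennreal (f m n)) \<le> (\<Sum>m. \<Sum>n. ennreal (f m n))"
      using sum_le_suminf[of "\<lambda>m. \<Sum>n. ennreal (f m n)" "{m}"] by simp
    then show ?thesis using fin by (rule order.strict_trans1)
  qed
  have row: "summable (f m)" for m
    by (rule summable_suminf_not_top) (use nn row_fin[of m] in auto)
  have rs: "(\<Sum>n. ennreal (f m n)) = ennreal (\<Sum>n. f m n)" for m
    by (rule suminf_ennreal2) (use nn row in auto)
  have nn2: "0 \<le> (\<Sum>n. f m n)" for m using nn row by (intro suminf_nonneg) auto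
  have col: "summable (\<lambda>m. \<Sum>n. f m n)"
    by (rule summable_suminf_not_top) (use nn2 fin in \<open>auto simp: rs\<close>)
  have hr: "(f m has_sum (\<Sum>n. f m n)) UNIV" for m
    using nn row by (intro norm_summable_imp_has_sum summable_sums) auto
  have hc: "((\<lambda>m. \<Sum>n. f m n) has_sum (\<Sum>m. \<Sum>n. f m n)) UNIV"
    using nn2 col by (intro norm_summable_imp_has_sum summable_sums) auto
  have "(\<lambda>(m, n). f m n) summable_on Sigma UNIV (\<lambda>_. UNIV)"
    by (rule summable_on_SigmaI) (use hr hc nn in \<open>auto simp: summable_on_def\<close>)
  then show s: "(\<lambda>(m, n). f m n) summable_on UNIV" by simp
  have "((\<lambda>m. \<Sum>n. f m n) has_sum infsum (\<lambda>(m, n). f m n) UNIV) UNIV"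
    by (rule has_sum_SigmaD[where f="\<lambda>(m, n). f m n" and B="\<lambda>_. UNIV"]) (use has_sum_infsum[OF s] hr in auto)
  then have "infsum (\<lambda>(m, n). f m n) UNIV = (\<Sum>m. \<Sum>n. f m n)" using hc has_sum_unique by blast
  moreover have "(\<Sum>m. \<Sum>n. ennreal (f m n)) = ennreal (\<Sum>m. \<Sum>n. f m n)"
    unfolding rs by (rule suminf_ennreal2) (use nn2 col in auto)
  ultimately show "ennreal (infsum (\<lambda>(m, n). f m n) UNIV) = (\<Sum>m. \<Sum>n. ennreal (f m n))" by simp
qed

context pure_two_isometry
begin

lemma P_Ln_poly:
  assumes "\<And>k. L (y k) = 0"
  shows "P ((L ^^ n) (\<Sum>k\<le>N. (T ^^ k) (y k))) = (if n \<le> N then y n else 0)"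
proof -
  have "P ((L ^^ n) ((T ^^ k) (y k))) = (if k = n then y n else 0)" for k
  proof (cases k n rule: linorder_cases)
    case less
    then show ?thesis using assms by (simp add: Ln_Tk' P.zero)
  next
    case equal
    then show ?thesis using assms by (simp add: P_eq)
  next
    case greater
    then obtain d where "k - n = Suc d" by (metis Suc_diff_Suc)
    then show ?thesis using greater by (simp add: Ln_Tk)
  qed
  then show ?thesis by (simp add: Ln.sum P.sum)
qed

lemma P_L_T_Suc: "P ((L ^^ Suc m) (T x)) = P ((L ^^ m) x)" and P_L_T_0: "P ((L ^^ 0) (T x)) = 0"
  by (simp_all add: funpow_swap1)

text \<open>Since \<open>A\<close> commutes with \<open>P\<close>, the cross terms between
  \<open>P x\<close> and \<open>T (L x)\<close> vanish, and invariance under \<open>T\<close> gives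
  \<open>Q x = Q (P x) + Q (L x)\<close>. Iteration leaves a remainder at \<open>(L ^^ n) x\<close>,
  which tends to 0. It is applied with the defect of one operator as \<open>A\<close> and the other
  operator as \<open>T\<close>.\<close>

lemma form_decomposition:
  assumes A: "bounded_clinear A" and AT: "\<And>x y. cinner (A (T x)) (T y) = cinner (A x) y"
    and AP: "\<And>x. A (P x) = P (A x)" and nn: "\<And>x. 0 \<le> Re (cinner (A x) x)"
  shows "(\<Sum>n. ennreal (Re (cinner (A (P ((L ^^ n) x))) (P ((L ^^ n) x))))) = ennreal (Re (cinner (A x) x))"
proof -
  interpret A: bounded_op A by unfold_locales fact
  define Q where "Q x = Re (cinner (A x) x)" for x
  have step: "Q x = Q (P x) + Q (L x)" for x
  proof -
    have x: "x = P x + T (L x)" by (simp add: P_def)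
    have "cinner (A (P x)) (T (L x)) = 0" by (simp add: AP cinner_P_T)
    moreover have "cinner (A (T (L x))) (P x) = 0"
    proof -
      have "cinner (A (T (L x))) (P x) = cinner (P (A (T (L x)))) x" by (simp add: P_adj)
      also have "\<dots> = 0" by (simp add: AP[symmetric] A.zero)
      finally show ?thesis .
    qed
    ultimately have "cinner (A (P x + T (L x))) (P x + T (L x)) = cinner (A (P x)) (P x) + cinner (A (L x)) (L x)"
      by (simp add: A.add cinner_add_left cinner_add_right AT)
    then show ?thesis unfolding Q_def using x by simp
  qed
  have "Q x = (\<Sum>k<n. Q (P ((L ^^ k) x))) + Q ((L ^^ n) x)" for n
  proof (induction n)
    case (Suc n)
    then show ?case using step[of "(L ^^ n) x"] by simp
  qed simp
  then have part: "(\<Sum>k<n. Q (P ((L ^^ k) x))) = Q x - Q ((L ^^ n) x)" for n by (metis add_diff_cancel_right')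
  have "(\<lambda>n. Q x - Q ((L ^^ n) x)) \<longlonglongrightarrow> Q x - Re (cinner (A 0) 0)"
    unfolding Q_def by (intro tendsto_intros tendsto_Re tendsto_cinner A.tendsto Ln_tendsto_0)
  then have "(\<lambda>k. Q (P ((L ^^ k) x))) sums Q x" by (simp add: sums_def part)
  then have "(\<lambda>k. ennreal (Q (P ((L ^^ k) x)))) sums ennreal (Q x)" using nn by (simp add: Q_def)
  then show ?thesis unfolding Q_def by (rule sums_unique[symmetric])
qed

lemma energy_zero: "energy 0 = 0"
  by (simp add: energy_def Ln.zero L.zero)

lemma ennreal_energy: "ennreal (energy x) = (\<Sum>k. ennreal (q ((L ^^ Suc k) x)))"
  unfolding energy_def by (rule suminf_ennreal2[symmetric]) (use summable_q q_nonneg in auto)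

lemma ennreal_norm_sq: "ennreal ((norm x)\<^sup>2) = (\<Sum>k. ennreal ((norm (P ((L ^^ k) x)))\<^sup>2)) + ennreal (energy x)"
proof -
  have "(\<Sum>k. ennreal ((norm (P ((L ^^ k) x)))\<^sup>2)) = ennreal (\<Sum>k. (norm (P ((L ^^ k) x)))\<^sup>2)"
    by (rule suminf_ennreal2) (use summable_P in auto)
  then show ?thesis using energy_nonneg[of x] norm_sq_eq[of x]
    by (simp add: suminf_nonneg summable_P flip: ennreal_plus)
qed

end

text \<open>\<open>D1_T2\<close> and \<open>D2_T1\<close> are the mixed toral identities. The last
  two assumptions say that each defect commutes with the projection onto the range of the other
  operator.\<close>

locale toral_pair = A: pure_two_isometry T1 D1 L1 + B: pure_two_isometry T2 D2 L2
  for T1 D1 L1 T2 D2 L2 :: "'a::chilbert_space \<Rightarrow> 'a" +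
  assumes T_T: "T1 (T2 x) = T2 (T1 x)" and L1_T2: "L1 (T2 x) = T2 (L1 x)" and L2_T1: "L2 (T1 x) = T1 (L2 x)"
    and L_L: "L1 (L2 x) = L2 (L1 x)"
    and D1_T2: "cinner (D1 (T2 x)) (T2 y) = cinner (D1 x) y" and D2_T1: "cinner (D2 (T1 x)) (T1 y) = cinner (D2 x) y"
    and D1_T2_L2: "D1 (T2 (L2 x)) = T2 (L2 (D1 x))" and D2_T1_L1: "D2 (T1 (L1 x)) = T1 (L1 (D2 x))"
begin

definition coef :: "'a \<Rightarrow> nat \<times> nat \<Rightarrow> 'a" where
  "coef x = (\<lambda>(m, n). A.P ((L1 ^^ m) (B.P ((L2 ^^ n) x))))"

lemma P1_comm: "A.P (T2 x) = T2 (A.P x)" "A.P (L2 x) = L2 (A.P x)"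
  and P2_comm: "B.P (T1 x) = T1 (B.P x)" "B.P (L1 x) = L1 (B.P x)"
  by (simp_all add: A.P_def B.P_def T_T L1_T2 L2_T1 L_L A.T.diff B.T.diff A.L.diff B.L.diff)

lemma P_P: "A.P (B.P x) = B.P (A.P x)"
  by (simp add: A.P_def[of "B.P x"] A.P_def[of x] P2_comm B.P.diff)

lemma P1_Ln: "A.P ((L2 ^^ n) x) = (L2 ^^ n) (A.P x)"
  and L1_Ln: "L1 ((L2 ^^ n) x) = (L2 ^^ n) (L1 x)" and L1_Tn: "L1 ((T2 ^^ n) x) = (T2 ^^ n) (L1 x)"
  and T1_Tn: "T1 ((T2 ^^ n) x) = (T2 ^^ n) (T1 x)" and L2_T1n: "L2 ((T1 ^^ n) x) = (T1 ^^ n) (L2 x)"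
  and P2_L1n: "B.P ((L1 ^^ n) x) = (L1 ^^ n) (B.P x)"
  by (induction n) (simp_all add: P1_comm P2_comm L_L L1_T2 T_T L2_T1)

lemma Ln_Ln: "(L1 ^^ m) ((L2 ^^ n) x) = (L2 ^^ n) ((L1 ^^ m) x)"
  by (induction m) (simp_all add: L1_Ln)

lemma Tn_Tn: "(T1 ^^ m) ((T2 ^^ n) x) = (T2 ^^ n) ((T1 ^^ m) x)"
  by (induction m) (simp_all add: T1_Tn)

text \<open>Both orders of extraction are needed: a column or a row of coefficients is then the
  one-variable coefficient sequence of a single vector.\<close>

lemma coef_alt: "coef x (m, n) = B.P ((L2 ^^ n) (A.P ((L1 ^^ m) x)))"
proof -
  have "coef x (m, n) = A.P (B.P ((L1 ^^ m) ((L2 ^^ n) x)))" by (simp add: coef_def P2_L1n)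
  also have "\<dots> = B.P (A.P ((L2 ^^ n) ((L1 ^^ m) x)))" by (simp only: P_P Ln_Ln)
  also have "\<dots> = B.P ((L2 ^^ n) (A.P ((L1 ^^ m) x)))" by (simp only: P1_Ln)
  finally show ?thesis .
qed

lemma L_coef: "L1 (coef x k) = 0" "L2 (coef x k) = 0"
proof -
  obtain m n where k: "k = (m, n)" by (cases k)
  show "L1 (coef x k) = 0" by (simp add: k coef_def)
  show "L2 (coef x k) = 0" unfolding k coef_alt by simp
qed

lemma bounded_clinear_coef: "bounded_clinear (\<lambda>x. coef x k)"
proof -
  obtain m n where k: "k = (m, n)" by (cases k)
  show ?thesis unfolding k coef_def prod.case
    by (rule bounded_clinear_compose[OF A.P.bounded_clinear bounded_clinear_compose[OF A.Ln.bounded_clinear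
          bounded_clinear_compose[OF B.P.bounded_clinear B.Ln.bounded_clinear]]])
qed

text \<open>\<open>form_decomposition\<close> splits each summand of the energy, and the sums of
  nonnegative terms are exchanged.\<close>

lemma energy_split:
  "ennreal (A.energy x) = (\<Sum>n. ennreal (A.energy (B.P ((L2 ^^ n) x))))"
  "ennreal (B.energy x) = (\<Sum>m. ennreal (B.energy (A.P ((L1 ^^ m) x))))"
proof -
  have 1: "ennreal (A.q y) = (\<Sum>n. ennreal (A.q (B.P ((L2 ^^ n) y))))" for y
    unfolding A.q_def
    by (rule B.form_decomposition[OF A.D D1_T2, symmetric])
      (simp_all add: B.P_def A.D.diff D1_T2_L2 A.q_nonneg[unfolded A.q_def])
  have "ennreal (A.energy x) = (\<Sum>k. \<Sum>n. ennreal (A.q ((L1 ^^ Suc k) (B.P ((L2 ^^ n) x)))))"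
    unfolding A.ennreal_energy by (subst 1) (simp only: P2_L1n[symmetric] Ln_Ln)
  also have "\<dots> = (\<Sum>n. ennreal (A.energy (B.P ((L2 ^^ n) x))))"
    unfolding A.ennreal_energy by (rule suminf_ennreal_swap)
  finally show "ennreal (A.energy x) = (\<Sum>n. ennreal (A.energy (B.P ((L2 ^^ n) x))))" .
  have 2: "ennreal (B.q y) = (\<Sum>n. ennreal (B.q (A.P ((L1 ^^ n) y))))" for y
    unfolding B.q_def
    by (rule A.form_decomposition[OF B.D D2_T1, symmetric])
      (simp_all add: A.P_def B.D.diff D2_T1_L1 B.q_nonneg[unfolded B.q_def])
  have "ennreal (B.energy x) = (\<Sum>k. \<Sum>n. ennreal (B.q ((L2 ^^ Suc k) (A.P ((L1 ^^ n) x)))))"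
    unfolding B.ennreal_energy by (subst 2) (simp only: P1_Ln[symmetric] Ln_Ln[symmetric])
  also have "\<dots> = (\<Sum>n. ennreal (B.energy (A.P ((L1 ^^ n) x))))"
    unfolding B.ennreal_energy by (rule suminf_ennreal_swap)
  finally show "ennreal (B.energy x) = (\<Sum>n. ennreal (B.energy (A.P ((L1 ^^ n) x))))" .
qed

text \<open>The one-variable identity in the first variable, applied to \<open>x\<close>, and in the
  second, applied to each \<open>A.P ((L1 ^^ m) x)\<close>, leaves the undivided
  \<open>A.energy x\<close>, which \<open>energy_split\<close> distributes. The result has the shape
  of the squared Dirichlet norm.\<close>

lemma norm_decomposition:
  "ennreal ((norm x)\<^sup>2) = (\<Sum>m. \<Sum>n. ennreal ((norm (coef x (m, n)))\<^sup>2)) +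
    ((\<Sum>n. ennreal (A.energy (B.P ((L2 ^^ n) x)))) + (\<Sum>m. ennreal (B.energy (A.P ((L1 ^^ m) x)))))"
proof -
  have "ennreal ((norm x)\<^sup>2) = (\<Sum>m. ennreal ((norm (A.P ((L1 ^^ m) x)))\<^sup>2)) + ennreal (A.energy x)"
    by (rule A.ennreal_norm_sq)
  also have "(\<Sum>m. ennreal ((norm (A.P ((L1 ^^ m) x)))\<^sup>2)) =
      (\<Sum>m. (\<Sum>n. ennreal ((norm (coef x (m, n)))\<^sup>2)) + ennreal (B.energy (A.P ((L1 ^^ m) x))))"
    unfolding coef_alt B.ennreal_norm_sq[symmetric] ..
  also have "\<dots> = (\<Sum>m. \<Sum>n. ennreal ((norm (coef x (m, n)))\<^sup>2)) + (\<Sum>m. ennreal (B.energy (A.P ((L1 ^^ m) x))))"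
    by (rule suminf_add[symmetric]) auto
  finally show ?thesis unfolding energy_split(1)[of x] by (simp only: ac_simps)
qed

lemma coef_summable:
  "(\<lambda>k. (norm (coef x k))\<^sup>2) summable_on UNIV"
  "ennreal (infsum (\<lambda>k. (norm (coef x k))\<^sup>2) UNIV) = (\<Sum>m. \<Sum>n. ennreal ((norm (coef x (m, n)))\<^sup>2))"
proof -
  have "(\<Sum>m. \<Sum>n. ennreal ((norm (coef x (m, n)))\<^sup>2)) \<le> ennreal ((norm x)\<^sup>2)"
    unfolding norm_decomposition[of x] by simp
  then have fin: "(\<Sum>m. \<Sum>n. ennreal ((norm (coef x (m, n)))\<^sup>2)) < \<infinity>"
    by (simp add: order.strict_trans1[OF _ ennreal_less_top])
  have eq: "(\<lambda>(m, n). (norm (coef x (m, n)))\<^sup>2) = (\<lambda>k. (norm (coef x k))\<^sup>2)"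
  proof
    fix k show "(case k of (m, n) \<Rightarrow> (norm (coef x (m, n)))\<^sup>2) = (norm (coef x k))\<^sup>2" by (cases k) simp
  qed
  note * = infsum_pairs_ennreal[where f="\<lambda>m n. (norm (coef x (m, n)))\<^sup>2", OF zero_le_power2 fin, unfolded eq]
  show "(\<lambda>k. (norm (coef x k))\<^sup>2) summable_on UNIV" by (rule *(1))
  show "ennreal (infsum (\<lambda>k. (norm (coef x k))\<^sup>2) UNIV) = (\<Sum>m. \<Sum>n. ennreal ((norm (coef x (m, n)))\<^sup>2))"
    by (rule *(2))
qed

lemma coef_bounded: obtains C where "\<And>k. norm (coef x k) \<le> C"
  using square_summable_bounded[OF coef_summable(1)] by blast

text \<open>These rectangular polynomials are the candidates from which a vector with prescribed
  coefficients is obtained. The energies in the first variable depend on \<open>M\<close> and those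
  in the second on \<open>N\<close>.\<close>

lemma coef_poly:
  assumes a: "\<And>k. L1 (a k) = 0" "\<And>k. L2 (a k) = 0"
  defines "X \<equiv> \<lambda>M N. \<Sum>n\<le>N. (T2 ^^ n) (\<Sum>m\<le>M. (T1 ^^ m) (a (m, n)))"
  shows "B.P ((L2 ^^ n) (X M N)) = (if n \<le> N then \<Sum>m\<le>M. (T1 ^^ m) (a (m, n)) else 0)"
    and "A.P ((L1 ^^ m) (X M N)) = (if m \<le> M then \<Sum>n\<le>N. (T2 ^^ n) (a (m, n)) else 0)"
    and "coef (X M N) (m, n) = (if m \<le> M \<and> n \<le> N then a (m, n) else 0)"
proof -
  show 1: "B.P ((L2 ^^ n) (X M N)) = (if n \<le> N then \<Sum>m\<le>M. (T1 ^^ m) (a (m, n)) else 0)"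
    unfolding X_def by (rule B.P_Ln_poly) (simp add: B.L.sum L2_T1n a A.Tn.zero)
  have X: "X M N = (\<Sum>m\<le>M. (T1 ^^ m) (\<Sum>n\<le>N. (T2 ^^ n) (a (m, n))))"
    unfolding X_def B.Tn.sum A.Tn.sum Tn_Tn by (rule sum.swap)
  show "A.P ((L1 ^^ m) (X M N)) = (if m \<le> M then \<Sum>n\<le>N. (T2 ^^ n) (a (m, n)) else 0)"
    unfolding X by (rule A.P_Ln_poly) (simp add: A.L.sum L1_Tn a B.Tn.zero)
  show "coef (X M N) (m, n) = (if m \<le> M \<and> n \<le> N then a (m, n) else 0)"
    unfolding coef_def prod.case 1
    using A.P_Ln_poly[of "\<lambda>m. a (m, n)" m M] a by (auto simp: A.Ln.zero A.P.zero)
qed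

end

subsection \<open>The model map\<close>

lemma has_sum_extend:
  assumes "((g \<circ> h) has_sum S) UNIV" "inj h" "\<And>k. k \<notin> range h \<Longrightarrow> g k = 0"
  shows "(g has_sum S) UNIV"
proof -
  have "(g has_sum S) (range h)" using assms(1,2) by (simp add: has_sum_reindex)
  then show ?thesis by (subst has_sum_cong_neutral[where T="range h"]) (use assms(3) in auto)
qed

lemma has_power_series_mult:
  assumes f: "has_power_series f a"
  shows "b \<circ> map_prod Suc id = a \<Longrightarrow> (\<And>n. b (0, n) = 0) \<Longrightarrow> has_power_series (mult_z1 f) b"
    and "b \<circ> map_prod id Suc = a \<Longrightarrow> (\<And>m. b (m, 0) = 0) \<Longrightarrow> has_power_series (mult_z2 f) b"
proof -
  have fz: "((\<lambda>(m, n). (z1 ^ m * z2 ^ n) *\<^sub>C a (m, n)) has_sum f (z1, z2)) UNIV" if "(z1, z2) \<in> bidisc" for z1 z2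
    using f that unfolding has_power_series_def by blast
  {
    assume b: "b \<circ> map_prod Suc id = a" "\<And>n. b (0, n) = 0"
    show "has_power_series (mult_z1 f) b" unfolding has_power_series_def
    proof safe
      fix z1 z2 :: complex assume z: "z1 \<in> ball 0 1" "z2 \<in> ball 0 1"
      show "((\<lambda>(m, n). (z1 ^ m * z2 ^ n) *\<^sub>C b (m, n)) has_sum mult_z1 f (z1, z2)) UNIV"
      proof (rule has_sum_extend[where h="map_prod Suc id"])
        have "((\<lambda>k. z1 *\<^sub>C (case k of (m, n) \<Rightarrow> (z1 ^ m * z2 ^ n) *\<^sub>C a (m, n))) has_sum z1 *\<^sub>C f (z1, z2)) UNIV"
          by (rule has_sum_bounded_linear[OF bounded_linear_scaleC_right fz]) (use z in auto)
        moreover have "(\<lambda>(m, n). (z1 ^ m * z2 ^ n) *\<^sub>C b (m, n)) \<circ> map_prod Suc id =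
            (\<lambda>k. z1 *\<^sub>C (case k of (m, n) \<Rightarrow> (z1 ^ m * z2 ^ n) *\<^sub>C a (m, n)))"
          by (simp add: fun_eq_iff b(1)[symmetric] scaleC_scaleC mult.assoc)
        ultimately show "((\<lambda>(m, n). (z1 ^ m * z2 ^ n) *\<^sub>C b (m, n)) \<circ> map_prod Suc id has_sum mult_z1 f (z1, z2)) UNIV"
          by (simp add: mult_z1_def)
      next
        fix k :: "nat \<times> nat" assume k: "k \<notin> range (map_prod Suc id)"
        obtain m n where mn: "k = (m, n)" by (cases k)
        have "m = 0" using k unfolding mn by (cases m) (auto simp: image_iff)
        then show "(case k of (m, n) \<Rightarrow> (z1 ^ m * z2 ^ n) *\<^sub>C b (m, n)) = 0" by (simp add: mn b(2))
      qed (simp add: prod.inj_map)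
    qed
  next
    assume b: "b \<circ> map_prod id Suc = a" "\<And>m. b (m, 0) = 0"
    show "has_power_series (mult_z2 f) b" unfolding has_power_series_def
    proof safe
      fix z1 z2 :: complex assume z: "z1 \<in> ball 0 1" "z2 \<in> ball 0 1"
      show "((\<lambda>(m, n). (z1 ^ m * z2 ^ n) *\<^sub>C b (m, n)) has_sum mult_z2 f (z1, z2)) UNIV"
      proof (rule has_sum_extend[where h="map_prod id Suc"])
        have "((\<lambda>k. z2 *\<^sub>C (case k of (m, n) \<Rightarrow> (z1 ^ m * z2 ^ n) *\<^sub>C a (m, n))) has_sum z2 *\<^sub>C f (z1, z2)) UNIV"
          by (rule has_sum_bounded_linear[OF bounded_linear_scaleC_right fz]) (use z in auto)
        moreover have "(\<lambda>(m, n). (z1 ^ m * z2 ^ n) *\<^sub>C b (m, n)) \<circ> map_prod id Suc =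
            (\<lambda>k. z2 *\<^sub>C (case k of (m, n) \<Rightarrow> (z1 ^ m * z2 ^ n) *\<^sub>C a (m, n)))"
          by (simp add: fun_eq_iff b(1)[symmetric] scaleC_scaleC mult.left_commute)
        ultimately show "((\<lambda>(m, n). (z1 ^ m * z2 ^ n) *\<^sub>C b (m, n)) \<circ> map_prod id Suc has_sum mult_z2 f (z1, z2)) UNIV"
          by (simp add: mult_z2_def)
      next
        fix k :: "nat \<times> nat" assume k: "k \<notin> range (map_prod id Suc)"
        obtain m n where mn: "k = (m, n)" by (cases k)
        have "n = 0" using k unfolding mn by (cases n) (auto simp: image_iff)
        then show "(case k of (m, n) \<Rightarrow> (z1 ^ m * z2 ^ n) *\<^sub>C b (m, n)) = 0" by (simp add: mn b(2))
      qed (simp add: prod.inj_map)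
    qed
  }
qed

lemma has_power_series_add:
  assumes "has_power_series f a" "has_power_series g b"
  shows "has_power_series (\<lambda>z. f z + g z) (\<lambda>k. a k + b k)"
  unfolding has_power_series_def
proof safe
  fix z1 z2 :: complex assume "z1 \<in> ball 0 1" "z2 \<in> ball 0 1"
  then have "((\<lambda>k. (case k of (m, n) \<Rightarrow> (z1 ^ m * z2 ^ n) *\<^sub>C a (m, n)) + (case k of (m, n) \<Rightarrow> (z1 ^ m * z2 ^ n) *\<^sub>C b (m, n)))
      has_sum f (z1, z2) + g (z1, z2)) UNIV"
    using assms by (intro has_sum_add) (auto simp: has_power_series_def)
  then show "((\<lambda>(m, n). (z1 ^ m * z2 ^ n) *\<^sub>C (a (m, n) + b (m, n))) has_sum f (z1, z2) + g (z1, z2)) UNIV"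
    by (simp add: scaleC_add_right case_prod_beta')
qed

lemma has_power_series_scaleC:
  assumes f: "has_power_series f a"
  shows "has_power_series (\<lambda>z. c *\<^sub>C f z) (\<lambda>k. c *\<^sub>C a k)"
  unfolding has_power_series_def
proof safe
  fix z1 z2 :: complex assume z: "z1 \<in> ball 0 1" "z2 \<in> ball 0 1"
  have "((\<lambda>(m, n). (z1 ^ m * z2 ^ n) *\<^sub>C a (m, n)) has_sum f (z1, z2)) UNIV"
    using f z by (auto simp: has_power_series_def)
  from has_sum_bounded_linear[OF bounded_linear_scaleC_right this, of c]
  show "((\<lambda>(m, n). (z1 ^ m * z2 ^ n) *\<^sub>C (c *\<^sub>C a (m, n))) has_sum c *\<^sub>C f (z1, z2)) UNIV"
    by (simp add: scaleC_scaleC case_prod_beta' mult_ac)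
qed

lemma hardy_norm_sq_eq:
  assumes "has_power_series f a"
  shows "hardy_norm_sq f = infsum (\<lambda>k. (norm (a k))\<^sup>2) UNIV"
proof -
  have "(THE a. has_power_series f a) = a" using assms has_power_series_unique by blast
  then show ?thesis by (simp add: hardy_norm_sq_def)
qed

text \<open>An Abel mean cannot stay below the limes inferior of the averaged sequence as \<open>r\<close> tends to \<open>1\<close>.\<close>

lemma frequently_le_of_abel_mean:
  fixes e :: "nat \<Rightarrow> nat \<Rightarrow> real"
  assumes nn: "\<And>n M. 0 \<le> e n M" and fin: "(\<Sum>n. d n) < \<infinity>"
    and le: "\<And>r n. 0 < r \<Longrightarrow> r < 1 \<Longrightarrow> ennreal (abel_mean r (e n)) \<le> d n"
    and s: "\<And>r n. 0 < r \<Longrightarrow> r < 1 \<Longrightarrow> summable (\<lambda>M. r ^ M * e n M)"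
  shows "\<exists>M\<ge>M0. (\<Sum>n. ennreal (e n M)) \<le> (\<Sum>n. d n) + 1"
proof (rule ccontr)
  assume "\<not> ?thesis"
  then have big: "(\<Sum>n. d n) + 1 \<le> (\<Sum>n. ennreal (e n M))" if "M0 \<le> M" for M using that by fastforce
  obtain c where c: "0 \<le> c" "(\<Sum>n. d n) = ennreal c" using fin by (cases "\<Sum>n. d n") auto
  \<comment> \<open>If all indices from \<open>M0\<close> on violated the claim, the Abel means,
    summed over \<open>n\<close>, would be at least \<open>(c + 1) * r ^ M0\<close>, since
    \<open>r ^ M0\<close> is \<open>1 - r\<close> times the tail of the geometric series. They are
    at most \<open>c\<close>, a contradiction as \<open>r\<close> tends to 1.\<close>
  have bound: "r ^ M0 * (c + 1) \<le> c" if r: "0 < r" "r < 1" for r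
  proof -
    have "ennreal (r ^ M0 * (c + 1)) = ennreal (1 - r) * ennreal (r ^ M0 * (c + 1) * (1 / (1 - r)))"
      using r c by (simp flip: ennreal_mult)
    also have "ennreal (r ^ M0 * (c + 1) * (1 / (1 - r))) = (\<Sum>M. ennreal (r ^ M0 * (c + 1) * r ^ M))"
      using r c geometric_sums[of r]
      by (intro sums_unique sums_ennreal[THEN iffD2] sums_mult) auto
    also have "(\<Sum>M. ennreal (r ^ M0 * (c + 1) * r ^ M)) \<le> (\<Sum>M. ennreal (r ^ (M + M0)) * (\<Sum>n. ennreal (e n (M + M0))))"
    proof (intro suminf_le allI summableI)
      fix M
      have "ennreal (r ^ M0 * (c + 1) * r ^ M) = ennreal (r ^ (M + M0)) * ((\<Sum>n. d n) + 1)"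
        using r c by (simp add: power_add mult_ac flip: ennreal_plus ennreal_mult ennreal_1)
      also have "\<dots> \<le> ennreal (r ^ (M + M0)) * (\<Sum>n. ennreal (e n (M + M0)))" by (intro mult_left_mono big) auto
      finally show "ennreal (r ^ M0 * (c + 1) * r ^ M) \<le> \<dots>" .
    qed
    also have "\<dots> \<le> (\<Sum>M. ennreal (r ^ M) * (\<Sum>n. ennreal (e n M)))"
      by (subst (2) suminf_offset[where i=M0]) (auto intro: summableI)
    also have "\<dots> = (\<Sum>n. \<Sum>M. ennreal (r ^ M * e n M))"
      unfolding ennreal_suminf_cmult[symmetric] using r nn
      by (subst suminf_ennreal_swap) (simp add: ennreal_mult del: ennreal_suminf_cmult)
    also have "\<dots> = (\<Sum>n. ennreal (\<Sum>M. r ^ M * e n M))"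
      using r nn s by (intro suminf_cong suminf_ennreal2) auto
    also have "ennreal (1 - r) * \<dots> = (\<Sum>n. ennreal (abel_mean r (e n)))"
      unfolding ennreal_suminf_cmult[symmetric] abel_mean_def using r nn s
      by (intro suminf_cong ennreal_mult[symmetric] suminf_nonneg) auto
    also have "\<dots> \<le> ennreal c" unfolding c(2)[symmetric] using r by (intro suminf_le le summableI)
    finally show ?thesis using c(1) by (simp add: mult_left_mono)
  qed
  have "c + 1 \<le> c"
  proof (rule tendsto_upperbound)
    show "((\<lambda>r. r ^ M0 * (c + 1)) \<longlongrightarrow> c + 1) (at_left 1)" by (auto intro!: tendsto_eq_intros)
    show "\<forall>\<^sub>F r in at_left 1. r ^ M0 * (c + 1) \<le> c"
      using eventually_at_left_real[OF zero_less_one] by (rule eventually_mono) (auto intro: bound)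
  qed simp
  then show False by simp
qed

text \<open>Together with \<open>L_E\<close> of the two models, \<open>E_I\<close> forces
  \<open>E\<close> to be the intersection of the kernels of \<open>L1\<close> and
  \<open>L2\<close>.\<close>

locale toral_model = toral_pair T1 D1 L1 T2 D2 L2
  for T1 D1 L1 T2 D2 L2 :: "'a::chilbert_space \<Rightarrow> 'a" +
  fixes M1 M2 E pr
  assumes M: "dirichlet_model T1 D1 L1 M1 E pr" "dirichlet_model T2 D2 L2 M2 E pr"
    and E_I: "L1 x = 0 \<Longrightarrow> L2 x = 0 \<Longrightarrow> x \<in> E"
begin

sublocale MA: dirichlet_model T1 D1 L1 M1 E pr by (rule M)
sublocale MB: dirichlet_model T2 D2 L2 M2 E pr by (rule M)

definition model_map :: "'a \<Rightarrow> complex \<times> complex \<Rightarrow> 'a" where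
  "model_map x z = (if z \<in> bidisc then infsum (\<lambda>(m, n). (fst z ^ m * snd z ^ n) *\<^sub>C coef x (m, n)) UNIV else 0)"

lemma model_map_power_series: "has_power_series (model_map x) (coef x)"
  unfolding has_power_series_def
proof safe
  fix z1 z2 :: complex assume z: "z1 \<in> ball 0 1" "z2 \<in> ball 0 1"
  obtain C where C: "\<And>k. norm (coef x k) \<le> C" using coef_bounded by blast
  show "((\<lambda>(m, n). (z1 ^ m * z2 ^ n) *\<^sub>C coef x (m, n)) has_sum model_map x (z1, z2)) UNIV"
    using has_sum_infsum[OF power_series_summable_on(1)[where a="coef x", OF C z]] z by (simp add: model_map_def)
qed

lemma model_map_eqI:
  assumes f: "has_power_series f (coef x)" and out: "\<And>z. z \<notin> bidisc \<Longrightarrow> f z = 0"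
  shows "model_map x = f"
proof
  fix z
  show "model_map x z = f z"
  proof (cases "z \<in> bidisc")
    case True
    obtain z1 z2 where z: "z = (z1, z2)" by (cases z)
    have "has_power_series g (coef x) \<Longrightarrow> ((\<lambda>(m, n). (z1 ^ m * z2 ^ n) *\<^sub>C coef x (m, n)) has_sum g (z1, z2)) UNIV" for g
      using True unfolding z has_power_series_def by blast
    then show ?thesis unfolding z using f model_map_power_series has_sum_unique by blast
  qed (auto simp: out model_map_def)
qed

lemma model_map_outside: "z \<notin> bidisc \<Longrightarrow> model_map x z = 0" by (auto simp: model_map_def)

lemma model_map_add: "model_map (x + y) = (\<lambda>z. model_map x z + model_map y z)"
proof (rule model_map_eqI)
  have "coef (x + y) = (\<lambda>k. coef x k + coef y k)"
    using bounded_clinear_coef by (simp add: bounded_clinear_def fun_eq_iff)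
  then show "has_power_series (\<lambda>z. model_map x z + model_map y z) (coef (x + y))"
    by (simp add: has_power_series_add model_map_power_series)
qed (simp add: model_map_outside)

lemma model_map_scaleC: "model_map (c *\<^sub>C x) = (\<lambda>z. c *\<^sub>C model_map x z)"
proof (rule model_map_eqI)
  have "coef (c *\<^sub>C x) = (\<lambda>k. c *\<^sub>C coef x k)"
    using bounded_clinear_coef by (simp add: bounded_clinear_def fun_eq_iff)
  then show "has_power_series (\<lambda>z. c *\<^sub>C model_map x z) (coef (c *\<^sub>C x))"
    by (simp add: has_power_series_scaleC model_map_power_series)
qed (simp add: model_map_outside)

lemma model_map_T1: "model_map (T1 x) = mult_z1 (model_map x)"
proof (rule model_map_eqI[OF has_power_series_mult(1)[OF model_map_power_series]])
  have L2n: "(L2 ^^ n) (T1 x) = T1 ((L2 ^^ n) x)" for n by (induction n) (simp_all add: L2_T1)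
  show "coef (T1 x) \<circ> map_prod Suc id = coef x"
    by (simp add: fun_eq_iff coef_def L2n P2_comm A.P_L_T_Suc del: funpow.simps)
  show "coef (T1 x) (0, n) = 0" for n
    unfolding coef_def prod.case L2n P2_comm by (rule A.P_L_T_0)
qed (simp add: mult_z1_def model_map_outside case_prod_beta)

lemma model_map_T2: "model_map (T2 x) = mult_z2 (model_map x)"
proof (rule model_map_eqI[OF has_power_series_mult(2)[OF model_map_power_series]])
  have L1n: "(L1 ^^ n) (T2 x) = T2 ((L1 ^^ n) x)" for n by (induction n) (simp_all add: L1_T2)
  show "coef (T2 x) \<circ> map_prod id Suc = coef x"
    by (simp add: fun_eq_iff coef_alt L1n P1_comm B.P_L_T_Suc del: funpow.simps)
  show "coef (T2 x) (m, 0) = 0" for m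
    unfolding coef_alt L1n P1_comm by (rule B.P_L_T_0)
qed (simp add: mult_z2_def model_map_outside case_prod_beta)

lemma coef_E: "range (coef x) \<subseteq> E" using E_I L_coef by blast

lemma dirichlet_integral_model_map:
  "dirichlet_integral E MA.op_measure MB.op_measure (model_map x) =
    (\<Sum>n. ennreal (A.energy (B.P ((L2 ^^ n) x)))) + (\<Sum>m. ennreal (B.energy (A.P ((L1 ^^ m) x))))"
proof -
  obtain C where C: "\<And>k. norm (coef x k) \<le> C" using coef_bounded by blast
  have "MA.dirichlet_energy (\<lambda>m. coef x (m, n)) = ennreal (A.energy (B.P ((L2 ^^ n) x)))" for n
    unfolding coef_def prod.case by (rule MA.dirichlet_energy_eq)
  moreover have "MB.dirichlet_energy (\<lambda>n. coef x (m, n)) = ennreal (B.energy (A.P ((L1 ^^ m) x)))" for m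
    unfolding coef_alt by (rule MB.dirichlet_energy_eq)
  ultimately show ?thesis
    using dirichlet_integral_eq[where a="coef x", OF M model_map_power_series coef_E C] by simp
qed

text \<open>\<open>norm_decomposition\<close> is an equation in \<open>[0, \<infinity>]\<close> with
  a finite left-hand side, so it yields finiteness of the Dirichlet integral and the value of the
  norm at once.\<close>

lemma model_map_norm:
  "dirichlet_integral E MA.op_measure MB.op_measure (model_map x) < \<infinity>"
  "dirichlet_norm E MA.op_measure MB.op_measure (model_map x) = norm x"
proof -
  define h where "h = hardy_norm_sq (model_map x)"
  define d where "d = dirichlet_integral E MA.op_measure MB.op_measure (model_map x)"
  have h: "0 \<le> h" unfolding h_def hardy_norm_sq_eq[OF model_map_power_series] by (rule infsum_nonneg) simp
  have eq: "ennreal ((norm x)\<^sup>2) = ennreal h + d"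
    unfolding norm_decomposition[of x] h_def d_def dirichlet_integral_model_map
      hardy_norm_sq_eq[OF model_map_power_series] coef_summable(2) ..
  then have "d \<le> ennreal ((norm x)\<^sup>2)" by simp
  then have d: "d < \<infinity>" by (simp add: order.strict_trans1[OF _ ennreal_less_top])
  then show "dirichlet_integral E MA.op_measure MB.op_measure (model_map x) < \<infinity>" by (simp only: d_def)
  have "(norm x)\<^sup>2 = enn2real (ennreal h + d)" by (simp flip: eq)
  also have "\<dots> = h + enn2real d" using h d by (simp add: enn2real_plus)
  finally show "dirichlet_norm E MA.op_measure MB.op_measure (model_map x) = norm x"
    unfolding dirichlet_norm_def h_def[symmetric] d_def[symmetric] by (metis norm_ge_zero real_sqrt_unique)
qed

lemma model_map_in: "model_map x \<in> dirichlet_space E MA.op_measure MB.op_measure"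
  unfolding dirichlet_space_def hardy_space_def
  using model_map_outside model_map_power_series coef_E coef_summable(1) model_map_norm(1) by blast

text \<open>Surjectivity: Abel summation bounds the norms of suitable rectangular partial sums, so that
  the affine subspaces fixing finitely many coefficients meet a common ball.\<close>

lemma coef_surj:
  assumes f: "has_power_series f a" and aE: "range a \<subseteq> E" and sq: "(\<lambda>k. (norm (a k))\<^sup>2) summable_on UNIV"
    and fin: "dirichlet_integral E MA.op_measure MB.op_measure f < \<infinity>"
  shows "\<exists>x. coef x = a"
proof -
  obtain C where C: "\<And>k. norm (a k) \<le> C" using square_summable_bounded[OF sq] by blast
  have La: "L1 (a k) = 0" "L2 (a k) = 0" for k using aE MA.L_E MB.L_E by auto
  define S1 where "S1 = (\<Sum>n. MA.dirichlet_energy (\<lambda>m. a (m, n)))"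
  define S2 where "S2 = (\<Sum>m. MB.dirichlet_energy (\<lambda>n. a (m, n)))"
  have "S1 + S2 < \<infinity>" using fin unfolding dirichlet_integral_eq[where a=a, OF M f aE C] S1_def S2_def .
  then have S: "S1 < \<infinity>" "S2 < \<infinity>" by auto
  define e1 where "e1 n K = A.energy (\<Sum>m\<le>K. (T1 ^^ m) (a (m, n)))" for n K
  define e2 where "e2 m K = B.energy (\<Sum>n\<le>K. (T2 ^^ n) (a (m, n)))" for m K
  have M1: "\<exists>K\<ge>l. (\<Sum>n. ennreal (e1 n K)) \<le> S1 + 1" for l
    unfolding S1_def
  proof (rule frequently_le_of_abel_mean)
    fix r :: real and n assume r: "0 < r" "r < 1"
    show "ennreal (abel_mean r (e1 n)) \<le> MA.dirichlet_energy (\<lambda>m. a (m, n))"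
      unfolding e1_def[abs_def]
      by (rule MA.abel_mean_le_dirichlet_energy(1)[where a="\<lambda>m. a (m, n)", OF C La(1) r])
    show "summable (\<lambda>K. r ^ K * e1 n K)"
      unfolding e1_def
      by (rule MA.abel_mean_le_dirichlet_energy(2)[where a="\<lambda>m. a (m, n)", OF C La(1) r])
  qed (use S in \<open>auto simp: e1_def S1_def A.energy_nonneg\<close>)
  have M2: "\<exists>K\<ge>l. (\<Sum>m. ennreal (e2 m K)) \<le> S2 + 1" for l
    unfolding S2_def
  proof (rule frequently_le_of_abel_mean)
    fix r :: real and m assume r: "0 < r" "r < 1"
    show "ennreal (abel_mean r (e2 m)) \<le> MB.dirichlet_energy (\<lambda>n. a (m, n))"
      unfolding e2_def[abs_def]
      by (rule MB.abel_mean_le_dirichlet_energy(1)[where a="\<lambda>n. a (m, n)", OF C La(2) r])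
    show "summable (\<lambda>K. r ^ K * e2 m K)"
      unfolding e2_def
      by (rule MB.abel_mean_le_dirichlet_energy(2)[where a="\<lambda>n. a (m, n)", OF C La(2) r])
  qed (use S in \<open>auto simp: e2_def S2_def B.energy_nonneg\<close>)
  define H where "H = infsum (\<lambda>k. (norm (a k))\<^sup>2) UNIV"
  have H: "0 \<le> H" unfolding H_def by (rule infsum_nonneg) simp
  define W where "W = ennreal H + ((S1 + 1) + (S2 + 1))"
  have W: "W < \<infinity>" using S by (auto simp: W_def)
  \<comment> \<open>A closed affine subspace of vectors whose coefficients agree with
    \<open>a\<close> on a square; a common point of all of them has the coefficients
    \<open>a\<close>.\<close>
  define K where "K l = (\<Inter>k\<in>{..l} \<times> {..l}. (\<lambda>x. coef x k) -` {a k})" for l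
  have coef_op: "bounded_op (\<lambda>x. coef x k)" for k unfolding bounded_op_def by (rule bounded_clinear_coef)
  have "\<exists>x. \<forall>l. x \<in> K l"
  proof (rule nested_convex_inter)
    fix l
    show "closed (K l)" unfolding K_def
      by (intro closed_INT ballI closed_vimage closed_singleton bounded_op.continuous_on[OF coef_op])
    show "convex (K l)" unfolding K_def
      by (intro convex_INT convex_linear_vimage convex_singleton bounded_op.linear[OF coef_op])
    \<comment> \<open>The two side lengths can be chosen independently: the energies in the first
      variable are bounded by those with \<open>m0\<close> alone, the others by those with
      \<open>n0\<close> alone.\<close>
    obtain m0 where m0: "l \<le> m0" "(\<Sum>n. ennreal (e1 n m0)) \<le> S1 + 1" using M1 by blast
    obtain n0 where n0: "l \<le> n0" "(\<Sum>m. ennreal (e2 m n0)) \<le> S2 + 1" using M2 by blast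
    define X where "X = (\<Sum>n\<le>n0. (T2 ^^ n) (\<Sum>m\<le>m0. (T1 ^^ m) (a (m, n))))"
    note X = coef_poly[where a=a and M=m0 and N=n0, OF La, folded X_def]
    have "ennreal (infsum (\<lambda>k. (norm (coef X k))\<^sup>2) UNIV) \<le> ennreal H"
      unfolding H_def
    proof (intro ennreal_leI infsum_mono coef_summable(1) sq)
      fix k show "(norm (coef X k))\<^sup>2 \<le> (norm (a k))\<^sup>2" by (cases k) (simp add: X(3))
    qed
    moreover have "(\<Sum>n. ennreal (A.energy (B.P ((L2 ^^ n) X)))) \<le> S1 + 1"
    proof (rule order.trans[OF suminf_le m0(2)])
      show "ennreal (A.energy (B.P ((L2 ^^ n) X))) \<le> ennreal (e1 n m0)" for n
        unfolding X(1) e1_def by (simp add: A.energy_zero)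
    qed (auto intro: summableI)
    moreover have "(\<Sum>m. ennreal (B.energy (A.P ((L1 ^^ m) X)))) \<le> S2 + 1"
    proof (rule order.trans[OF suminf_le n0(2)])
      show "ennreal (B.energy (A.P ((L1 ^^ m) X))) \<le> ennreal (e2 m n0)" for m
        unfolding X(2) e2_def by (simp add: B.energy_zero)
    qed (auto intro: summableI)
    ultimately have "ennreal ((norm X)\<^sup>2) \<le> W"
      unfolding norm_decomposition[of X] coef_summable(2)[symmetric] W_def by (intro add_mono)
    then have "(norm X)\<^sup>2 \<le> enn2real W" using W by (metis enn2real_ennreal enn2real_mono infinity_ennreal_def zero_le_power2)
    then have "norm X \<le> sqrt (enn2real W)" by (rule real_le_rsqrt)
    moreover have "X \<in> K l" unfolding K_def using m0(1) n0(1) by (auto simp: X(3))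
    ultimately show "\<exists>x\<in>K l. norm x \<le> sqrt (enn2real W)" by blast
  next
    show "decseq K" unfolding decseq_def K_def by (intro allI impI INF_superset_mono) auto
  qed
  then obtain x where x: "x \<in> K l" for l by blast
  have "coef x (m, n) = a (m, n)" for m n using x[of "max m n"] by (auto simp: K_def)
  then show ?thesis by (intro exI[of _ x]) (simp add: fun_eq_iff)
qed

lemma unitary_model_map: "unitary_onto_dirichlet E MA.op_measure MB.op_measure model_map"
proof -
  have diff: "model_map (x - y) = (\<lambda>z. model_map x z - model_map y z)" for x y
    using model_map_add[of "x - y" y] by (simp add: fun_eq_iff)
  have "inj model_map"
  proof (rule injI)
    fix x y assume xy: "model_map x = model_map y"
    have "model_map (x - y) = model_map 0" using xy diff[of x y] diff[of 0 0] by simp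
    then have "norm (x - y) = norm (0::'a)" by (metis model_map_norm(2))
    then show "x = y" by simp
  qed
  moreover have "dirichlet_space E MA.op_measure MB.op_measure \<subseteq> range model_map"
  proof
    fix f assume "f \<in> dirichlet_space E MA.op_measure MB.op_measure"
    then obtain a where out: "\<And>z. z \<notin> bidisc \<Longrightarrow> f z = 0" and a: "range a \<subseteq> E" "has_power_series f a"
      "(\<lambda>k. (norm (a k))\<^sup>2) summable_on UNIV" and fin: "dirichlet_integral E MA.op_measure MB.op_measure f < \<infinity>"
      unfolding dirichlet_space_def hardy_space_def by blast
    obtain x where "coef x = a" using coef_surj[OF a(2,1,3) fin] by blast
    then have "model_map x = f" using a(2) out by (intro model_map_eqI) auto
    then show "f \<in> range model_map" by blast
  qed
  ultimately show ?thesis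
    unfolding unitary_onto_dirichlet_def bij_betw_def
    using model_map_in model_map_add model_map_scaleC model_map_norm(2) by blast
qed

end

section \<open>From the hypotheses on the pair to the model\<close>

lemma self_adjoint_cadjoint_comm:
  fixes T A :: "'a::chilbert_space \<Rightarrow> 'a"
  assumes T: "bounded_clinear T" and A: "bounded_clinear A"
    and sa: "\<And>x y. cinner (A x) y = cinner x (A y)" and AT: "\<And>x. A (T x) = T (A x)"
  shows "A (cadjoint T x) = cadjoint T (A x)"
proof (rule cinner_eqI)
  fix y
  have "cinner (A (cadjoint T x)) y = cinner x (T (A y))" by (simp add: sa cinner_cadjoint_left[OF T])
  also have "\<dots> = cinner (cadjoint T (A x)) y" by (simp add: sa cinner_cadjoint_left[OF T] flip: AT)
  finally show "cinner (A (cadjoint T x)) y = cinner (cadjoint T (A x)) y" .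
qed

text \<open>For \<open>R = S\<close> the second identity is the 2-isometry equation of
  \<open>S\<close>; for distinct members of the pair it is the mixed identity of
  \<open>toral_pair\<close>.\<close>

lemma toral_2_isometry_two_isometry:
  fixes T1 T2 :: "'a::chilbert_space \<Rightarrow> 'a"
  assumes tor: "toral_2_isometry T1 T2" and T: "bounded_clinear T1" "bounded_clinear T2"
    and S: "S \<in> {T1, T2}" "R \<in> {T1, T2}"
  defines "D \<equiv> \<lambda>x. cadjoint S (S x) - x"
  shows "cinner (S x) (S y) = cinner x y + cinner (D x) y" "cinner (D (R x)) (R y) = cinner (D x) y"
proof -
  have Sb: "bounded_clinear S" "bounded_clinear R" using S T by auto
  show *: "cinner (S x) (S y) = cinner x y + cinner (D x) y" for x y
    by (simp add: D_def cinner_diff_left cinner_cadjoint_left[OF Sb(1)])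
  have "x - cadjoint S (S x) - cadjoint R (R x) + cadjoint R (cadjoint S (S (R x))) = 0"
    using tor S unfolding toral_2_isometry_def by blast
  then have "cinner (x - cadjoint S (S x) - cadjoint R (R x) + cadjoint R (cadjoint S (S (R x)))) y = 0" by simp
  then have "cinner (cadjoint S (S (R x))) (R y) - cinner (R x) (R y) = cinner (cadjoint S (S x)) y - cinner x y"
    by (simp add: cinner_diff_left cinner_add_left cinner_cadjoint_left[OF Sb(2)] algebra_simps)
  then show "cinner (D (R x)) (R y) = cinner (D x) y" by (simp add: D_def cinner_diff_left)
qed

lemma pure_two_isometry_canonical:
  fixes T :: "'a::chilbert_space \<Rightarrow> 'a"
  assumes T: "bounded_clinear T" and tor: "toral_2_isometry T1 T2" "bounded_clinear T1" "bounded_clinear T2"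
    and TT: "T \<in> {T1, T2}" and an: "analytic_operator T"
  shows "pure_two_isometry T (\<lambda>x. cadjoint T (T x) - x) (canonical_left_inverse T)"
proof -
  note toral_2_isometry_two_isometry[OF tor TT TT]
  then interpret two_isometry T "\<lambda>x. cadjoint T (T x) - x"
    by unfold_locales (use T in \<open>auto intro!: bounded_clinear_diff bounded_clinear_compose[OF bounded_clinear_cadjoint] bounded_clinear_id\<close>)
  note L = canonical_left_inverse_expansive[OF T T_expansive]
  show ?thesis
  proof
    fix x assume "\<And>m. x \<in> range (T ^^ m)"
    then have "x \<in> (\<Inter>m\<in>{1..}. range (T ^^ m))" by blast
    then show "x = 0" unfolding an[unfolded analytic_operator_def] by (rule singletonD)
  qed (rule L(1), rule L(2), rule L(3))
qed

lemma herglotz_family: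
  assumes "two_isometry T D"
  obtains M where "spectral_family T D M"
proof -
  interpret two_isometry T D by fact
  define M where "M x = (SOME M. sets M = sets circle_borel \<and> finite_measure M \<and>
      (\<forall>n. (LINT \<zeta>|M. \<zeta> ^ n) = cinner (D ((T ^^ n) x)) x))" for x
  note M = someI_ex[OF herglotz, folded M_def]
  have "spectral_family T D M"
  proof (rule spectral_family.intro[OF two_isometry_axioms spectral_family_axioms.intro])
    fix x and n :: nat
    from M[of x] show "sets (M x) = sets circle_borel" by (rule conjunct1)
    from M[of x] show "finite_measure (M x)" by (rule conjunct2[THEN conjunct1])
    from M[of x] show "(LINT \<zeta>|M x. \<zeta> ^ n) = cinner (D ((T ^^ n) x)) x"
      by (rule conjunct2[THEN conjunct2, THEN spec])
  qed
  then show thesis by (rule that)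
qed

theorem theorem3p3:
  fixes T1 T2 :: "'h::chilbert_space \<Rightarrow> 'h"
  assumes "separable_space (euclidean :: 'h topology)"
    and "bounded_clinear T1" and "bounded_clinear T2"
    and "left_inverse_commuting T1 T2"
    and "toral_2_isometry T1 T2"
    and "analytic_operator T1" and "analytic_operator T2"
  shows "\<exists>(E :: 'h set) \<mu>1 \<mu>2.
    hilbert_subspace E \<and>
    positive_operator_measure E \<mu>1 \<and> positive_operator_measure E \<mu>2 \<and>
    (\<exists>U :: 'h \<Rightarrow> complex \<times> complex \<Rightarrow> 'h.
      unitary_onto_dirichlet E \<mu>1 \<mu>2 U \<and>
      (\<forall>x. U (T1 x) = mult_z1 (U x)) \<and>
      (\<forall>x. U (T2 x) = mult_z2 (U x)))"
proof -
  define D1 where "D1 = (\<lambda>x. cadjoint T1 (T1 x) - x)"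
  define D2 where "D2 = (\<lambda>x. cadjoint T2 (T2 x) - x)"
  define L1 where "L1 = canonical_left_inverse T1"
  define L2 where "L2 = canonical_left_inverse T2"
  note T = assms(2,3) and tor = assms(5)
  have comm: "T1 (T2 x) = T2 (T1 x)" "L1 (T2 x) = T2 (L1 x)" "L2 (T1 x) = T1 (L2 x)" for x
    using assms(4) by (auto simp: left_inverse_commuting_def fun_eq_iff L1_def L2_def)
  interpret A: pure_two_isometry T1 D1 L1
    unfolding D1_def L1_def by (rule pure_two_isometry_canonical[OF T(1) tor T _ assms(6)]) simp
  interpret B: pure_two_isometry T2 D2 L2
    unfolding D2_def L2_def by (rule pure_two_isometry_canonical[OF T(2) tor T _ assms(7)]) simp
  have P1T2: "A.P (T2 x) = T2 (A.P x)" and P2T1: "B.P (T1 x) = T1 (B.P x)" for x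
    by (simp_all add: A.P_def B.P_def comm A.T.diff B.T.diff)
  \<comment> \<open>Here self-adjointness of the projections pays off: commuting with
    \<open>T2\<close> they commute with its adjoint, and therefore with the defect and the canonical
    left inverse of \<open>T2\<close>. The same holds with the indices exchanged.\<close>
  have P1T2a: "A.P (cadjoint T2 x) = cadjoint T2 (A.P x)" for x
    by (rule self_adjoint_cadjoint_comm[OF T(2) A.P.bounded_clinear A.P_adj P1T2])
  have P2T1a: "B.P (cadjoint T1 x) = cadjoint T1 (B.P x)" for x
    by (rule self_adjoint_cadjoint_comm[OF T(1) B.P.bounded_clinear B.P_adj P2T1])
  have P2L1: "B.P (L1 x) = L1 (B.P x)" for x
    unfolding L1_def
    by (rule canonical_left_inverse_expansive(4)[OF T(1) A.T_expansive B.P.bounded_clinear P2T1 P2T1a])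
  \<comment> \<open>Apply \<open>L2\<close> to the decomposition of \<open>L1 x\<close> into its
    part in the kernel of \<open>L2\<close> and its part in the range of \<open>T2\<close>: the
    first part vanishes because \<open>B.P\<close> commutes with \<open>L1\<close>.\<close>
  have LL: "L1 (L2 x) = L2 (L1 x)" for x
  proof -
    have "L1 x = L1 (B.P x) + T2 (L1 (L2 x))"
      by (simp add: B.P_def A.L.diff comm)
    then have "L2 (L1 x) = L2 (B.P (L1 x)) + L1 (L2 x)" by (metis B.L.add B.L_T P2L1)
    then show ?thesis by simp
  qed
  interpret tp: toral_pair T1 D1 L1 T2 D2 L2
  proof
    show "D1 (T2 (L2 x)) = T2 (L2 (D1 x))" for x
    proof -
      have "B.P (D1 x) = D1 (B.P x)" by (simp add: D1_def B.P.diff P2T1 P2T1a)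
      then show ?thesis by (simp add: B.P_def A.D.diff)
    qed
    show "D2 (T1 (L1 x)) = T1 (L1 (D2 x))" for x
    proof -
      have "A.P (D2 x) = D2 (A.P x)" by (simp add: D2_def A.P.diff P1T2 P1T2a)
      then show ?thesis by (simp add: A.P_def B.D.diff)
    qed
    show "cinner (D1 (T2 x)) (T2 y) = cinner (D1 x) y" for x y
      unfolding D1_def by (rule toral_2_isometry_two_isometry(2)[OF tor T]) auto
    show "cinner (D2 (T1 x)) (T1 y) = cinner (D2 x) y" for x y
      unfolding D2_def by (rule toral_2_isometry_two_isometry(2)[OF tor T]) auto
  qed (rule comm LL)+
  define E where "E = {x. L1 x = 0 \<and> L2 x = 0}"
  \<comment> \<open>The product of two commuting orthogonal projections is the orthogonal projection
    onto the intersection of their ranges, here the kernels of \<open>L1\<close> and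
    \<open>L2\<close>.\<close>
  define pr where "pr x = A.P (B.P x)" for x
  have E: "hilbert_subspace E"
    unfolding hilbert_subspace_def
  proof (intro conjI)
    have "closed {x. L1 x = 0}" "closed {x. L2 x = 0}"
      by (intro closed_Collect_eq A.L.continuous_on B.L.continuous_on continuous_on_const)+
    then show "closed E" unfolding E_def by (rule closed_Collect_conj)
  qed (auto simp: E_def A.L.add B.L.add A.L.scaleC B.L.scaleC A.L.zero B.L.zero)
  obtain M1 where M1: "spectral_family T1 D1 M1" by (rule herglotz_family[OF A.two_isometry_axioms])
  obtain M2 where M2: "spectral_family T2 D2 M2" by (rule herglotz_family[OF B.two_isometry_axioms])
  interpret A: spectral_family T1 D1 M1 by (rule M1)
  interpret B: spectral_family T2 D2 M2 by (rule M2)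
  have pr: "bounded_clinear pr" unfolding pr_def[abs_def]
    by (rule bounded_clinear_compose[OF A.P.bounded_clinear B.P.bounded_clinear])
  have pr_in: "pr x \<in> E" for x using tp.L_coef[of x "(0, 0)"] by (simp add: E_def pr_def tp.coef_def)
  have pr_id: "pr x = x" if "x \<in> E" for x
    using that by (simp add: E_def pr_def A.P_eq B.P_eq)
  have pr_adj: "cinner (pr x) y = cinner x (pr y)" for x y
    by (simp add: pr_def A.P_adj B.P_adj tp.P_P)
  have E_iff: "x \<in> E \<longleftrightarrow> L1 x = 0 \<and> L2 x = 0" for x by (simp add: E_def)
  have dm1: "dirichlet_model T1 D1 L1 M1 E pr"
    by unfold_locales (simp_all add: E pr pr_in pr_id pr_adj, simp add: E_iff)
  have dm2: "dirichlet_model T2 D2 L2 M2 E pr"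
    by unfold_locales (simp_all add: E pr pr_in pr_id pr_adj, simp add: E_iff)
  interpret toral_model T1 D1 L1 T2 D2 L2 M1 M2 E pr
    by (intro toral_model.intro toral_model_axioms.intro tp.toral_pair_axioms dm1 dm2) (simp add: E_iff)
  show ?thesis
    by (intro exI[of _ E] exI[of _ MA.op_measure] exI[of _ MB.op_measure] exI[of _ model_map] conjI allI
        E MA.positive_operator_measure MB.positive_operator_measure unitary_model_map model_map_T1 model_map_T2)
qed

end
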